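(* Fix $\alpha\in[-1,1)\setminus\{0\}$ and $x\in\partial\mathbb D$. Let $G$ be the infinitesimal generator of a one-parameter semigroup $(\phi_t)$ in $\mathbb D$ and let $h$ be its Kœnigs function. Then the following are equivalent: (i) $G$ has a regular singularity of order $\alpha$ at $x$; (ii) the angular limit $\angle\lim_{z\to x}\phi_t'(z)(1-\overline{x}z)^\alpha$ exists and belongs to $\mathbb C^*=\mathbb C\setminus\{0\}$ for all but at most one $t>0$; (iii) (a) if $\alpha<0$: the angular limit in (ii) exists and belongs to $\mathbb C^*$ for at least one $t>0$; (b) if $\alpha>0$: the angular limit in (ii) exists and belongs to $\mathbb C^*$ for at least two different values $t>0$; (iv) $\angle\lim_{z\to x}h'(z)(1-\overline{x}z)^\alpha$ exists and belongs to $\mathbb C^*$; (v) $\angle\lim_{z\to x}(h(z)-h(x))(1-\overline{x}z)^{\alpha-1}$ exists and belongs to $\mathbb C^*$, where $h(x):=\angle\lim_{z\to x}h(z)$. Moreover, if these hold, then $x$ is not a boundary fixed point of $(\phi_t)$, and, if $\alpha\in(-1,0)$, $x$ is not even a contact point of $\phi_t$ for any $t>0$.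
   Context: A one-parameter semigroup $(\phi_t)_{t\ge0}$ in the unit disc $\mathbb D$ is a continuous homomorphism $t\mapsto\phi_t$ from $([0,+\infty),+)$ into the semigroup of holomorphic self-maps of $\mathbb D$ under composition (with the topology of locally uniform convergence). Standing assumption: $\phi_t$ is not an automorphism of $\mathbb D$ for any $t>0$. Its infinitesimal generator is the unique holomorphic $G:\mathbb D\to\mathbb C$ with $\partial_t\phi_t(z)=G(\phi_t(z))$. There is a unique point $\tau\in\overline{\mathbb D}$ (the Denjoy–Wolff point) with $\phi_t\to\tau$ locally uniformly as $t\to+\infty$. The Kœnigs function $h$ is the unique univalent map $h:\mathbb D\to\mathbb C$ such that: if $\tau\in\mathbb D$, $h(\tau)=0$, $h'(\tau)=1$, $h\circ\phi_t=e^{G'(\tau)t}h$; if $\tau\in\partial\mathbb D$, $h(0)=0$ and $h\circ\phi_t=h+t$ (equivalently $h'G\equiv1$). For $\sigma\in\partial\mathbb D$, $\phi_t(\sigma)$ and $h(\sigma)$ denote the angular (non-tangential) limits, which always exist (the latter in $\mathbb C\cup\{\infty\}$). A point $x\in\partial\mathbb D$ is a contact point of a holomorphic $f:\mathbb D\to\mathbb D$ if $\angle\lim_{z\to x}f(z)$ exists and lies in $\partial\mathbb D$, and a boundary fixed point of $f$ if this limit equals $x$; $x$ is a boundary fixed point of $(\phi_t)$ if it is one for every $\phi_t$. For $\alpha\in\mathbb R\setminus\{0\}$, $G$ has a regular singularity of order $\alpha$ at $x\in\partial\mathbb D$ if $\lim_{r\to1^-}G(rx)/(1-r)^\alpha$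 exists and belongs to $\mathbb C^*$. Powers $(1-\overline{x}z)^\beta$ use the principal branch (note $\mathrm{Re}(1-\overline xz)>0$). *)

theory Defs
  imports "HOL-Analysis.Analysis"
begin

abbreviation unit_disc :: "complex set" where "unit_disc \<equiv> ball 0 1"

definition stolz :: "complex \<Rightarrow> real \<Rightarrow> complex set" where
  "stolz x M = {z. norm z < 1 \<and> norm (x - z) < M * (1 - norm z)}"

definition angular_limit :: "(complex \<Rightarrow> complex) \<Rightarrow> complex \<Rightarrow> complex \<Rightarrow> bool" where
  "angular_limit f x L \<longleftrightarrow> (\<forall>M>1. (f \<longlongrightarrow> L) (at x within stolz x M))"

definition semigroup_disc :: "(real \<Rightarrow> complex \<Rightarrow> complex) \<Rightarrow> bool" where
  "semigroup_disc \<phi> \<longleftrightarrow>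
     (\<forall>t\<ge>0. \<phi> t holomorphic_on unit_disc \<and> \<phi> t ` unit_disc \<subseteq> unit_disc) \<and>
     (\<forall>z\<in>unit_disc. \<phi> 0 z = z) \<and>
     (\<forall>s\<ge>0. \<forall>t\<ge>0. \<forall>z\<in>unit_disc. \<phi> (s + t) z = \<phi> s (\<phi> t z)) \<and>
     (\<forall>t0\<ge>0. \<forall>K. compact K \<and> K \<subseteq> unit_disc \<longrightarrow>
         uniform_limit K \<phi> (\<phi> t0) (at t0 within {0..}))"

definition no_automorphism :: "(real \<Rightarrow> complex \<Rightarrow> complex) \<Rightarrow> bool" where
  "no_automorphism \<phi> \<longleftrightarrow> (\<forall>t>0. \<not> bij_betw (\<phi> t) unit_disc unit_disc)"

definition is_generator :: "(real \<Rightarrow> complex \<Rightarrow> complex) \<Rightarrow> (complex \<Rightarrow> complex) \<Rightarrow> bool" where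
  "is_generator \<phi> G \<longleftrightarrow> G holomorphic_on unit_disc \<and>
     (\<forall>t\<ge>0. \<forall>z\<in>unit_disc.
        ((\<lambda>s. \<phi> s z) has_vector_derivative G (\<phi> t z)) (at t within {0..}))"

definition dw_point :: "(real \<Rightarrow> complex \<Rightarrow> complex) \<Rightarrow> complex \<Rightarrow> bool" where
  "dw_point \<phi> \<tau> \<longleftrightarrow> norm \<tau> \<le> 1 \<and>
     (\<forall>K. compact K \<and> K \<subseteq> unit_disc \<longrightarrow> uniform_limit K \<phi> (\<lambda>_. \<tau>) at_top)"

definition koenigs :: "(real \<Rightarrow> complex \<Rightarrow> complex) \<Rightarrow> (complex \<Rightarrow> complex) \<Rightarrow> complex
    \<Rightarrow> (complex \<Rightarrow> complex) \<Rightarrow> bool" where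
  "koenigs \<phi> G \<tau> h \<longleftrightarrow> h holomorphic_on unit_disc \<and> inj_on h unit_disc \<and>
     (if \<tau> \<in> unit_disc then
        h \<tau> = 0 \<and> deriv h \<tau> = 1 \<and>
        (\<forall>t\<ge>0. \<forall>z\<in>unit_disc. h (\<phi> t z) = exp (deriv G \<tau> * of_real t) * h z)
      else
        h 0 = 0 \<and> (\<forall>t\<ge>0. \<forall>z\<in>unit_disc. h (\<phi> t z) = h z + of_real t))"

definition regular_singularity :: "(complex \<Rightarrow> complex) \<Rightarrow> real \<Rightarrow> complex \<Rightarrow> bool" where
  "regular_singularity G \<alpha> x \<longleftrightarrow>
     (\<exists>L. L \<noteq> 0 \<and>
        ((\<lambda>r::real. G (of_real r * x) / of_real ((1 - r) powr \<alpha>)) \<longlongrightarrow> L) (at_left 1))"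

definition contact_point :: "(complex \<Rightarrow> complex) \<Rightarrow> complex \<Rightarrow> bool" where
  "contact_point f x \<longleftrightarrow> (\<exists>L. angular_limit f x L \<and> norm L = 1)"

definition boundary_fixed_point :: "(complex \<Rightarrow> complex) \<Rightarrow> complex \<Rightarrow> bool" where
  "boundary_fixed_point f x \<longleftrightarrow> angular_limit f x x"

definition sg_boundary_fixed_point :: "(real \<Rightarrow> complex \<Rightarrow> complex) \<Rightarrow> complex \<Rightarrow> bool" where
  "sg_boundary_fixed_point \<phi> x \<longleftrightarrow> (\<forall>t>0. boundary_fixed_point (\<phi> t) x)"

definition wpow :: "complex \<Rightarrow> real \<Rightarrow> complex \<Rightarrow> complex" where
  "wpow x \<beta> z = (1 - cnj x * z) powr (of_real \<beta>)"

end

theory Submission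
  imports Defs "HOL-Complex_Analysis.Complex_Analysis" "HOL-Real_Asymp.Real_Asymp"
begin

text \<open>
  Near x everything is written in the coordinate u = 1 - cnj x * z of the right half-plane.
  By Wolff's lemma G factors as (\<tau> - z)(1 - cnj \<tau> z) p(z) with Re p nonnegative, so the Lindelof
  theorem turns radial limits of G into angular ones, and h' G = 1 (or \<lambda> h) relates G to h.

  For (iii) implies (i): if \<phi>_t(x) is interior, then \<phi>_t' G = G o \<phi>_t gives the order of G at once, and
  the Schwarz lemma forces this when \<alpha> < 0. If \<phi>_t(x) is a boundary point for both times, the
  approach is nontangential, and Fatou's lemma yields an intermediate time t0 at which Re p vanishes to
  first order along a sequence tending to \<phi>_t0(x). The Julia-Wolff-Caratheodory theorem then gives p a
  nonzero imaginary boundary value there, and G is recovered from \<phi>_t0' G = G o \<phi>_t0.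

  For (i) implies (ii): in the Koenigs coordinate the semigroup is the translation by t, and the image of a
  neighbourhood of x is asymptotically a sector of opening (1 - \<alpha>)\<pi> at 0. Either it meets the real axis,
  and then all \<phi>_t(x) are interior points; or it lies on one side, and for a point m strictly inside
  the boundary slit the inverse Koenigs map has a nonzero angular derivative at m, by comparison with a
  harmonic barrier and the Julia-Wolff-Caratheodory theorem. Only the end point of the slit escapes.
\<close>



section \<open>Angular limits\<close>

text \<open>The obstacle is \<open>\<alpha> > 0\<close>. There \<open>\<phi> t\<close> may send x to
  the boundary, and the relation between \<open>\<phi> t'\<close> and G only compares G at x with G
  at an unknown contact point. A second time helps because \<open>Q\<close> does not decrease along
  orbits and, for orbits starting at \<open>x * (1 - s)\<close>, is comparable to
  \<open>s powr (1 - \<alpha>)\<close> at both times. The integral of \<open>2 * m\<close>, the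
  derivative of \<open>ln Q\<close>, between the two times is therefore bounded uniformly in s,
  which is what Fatou's lemma needs. Two degenerate cases remain: the contact point could be \<tau>,
  or the boundary value of p could be 0. In both, G would be of order \<open>norm (b - z)\<close>
  nontangentially at the contact point b, and the hyperbolic speed \<open>v\<close> would stay
  bounded there. But moving from boundary distance s to one of order
  \<open>s powr (1 - \<alpha>)\<close> in a fixed time forces \<open>v\<close> to infinity. For
  \<open>\<alpha> < 0\<close> the sector at 0 in the Koenigs coordinate has opening greater than pi
  and must meet the real axis, so no boundary slit and no exceptional time occur.\<close>

definition sector :: "real \<Rightarrow> complex set" where
  "sector M = {u. norm u < M * Re u}"

text \<open>The filter of nontangential approach to 0 from the right half-plane; points of the disc
  near the boundary point x are written x * (1 - u), so that u = 1 - cnj x * z.\<close>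

definition ang :: "complex filter" where
  "ang = (SUP M\<in>{1<..}. at 0 within sector M)"

text \<open>The part of the disc within \<rho> of x, in the coordinate u:
  \<open>norm (1 - u) < 1\<close> expresses that \<open>x * (1 - u)\<close> lies in the disc,
  whatever x on the circle is.\<close>

definition cap :: "real \<Rightarrow> complex set" where
  "cap \<rho> = ball 1 1 \<inter> ball 0 \<rho>"

lemma eventually_ang: "eventually P ang \<longleftrightarrow> (\<forall>M>1. eventually P (at 0 within sector M))"
  unfolding ang_def by (auto simp: eventually_Sup)

lemma filterlim_ang_iff: "filterlim f F ang \<longleftrightarrow> (\<forall>M>1. filterlim f F (at 0 within sector M))"
  unfolding filterlim_iff eventually_ang by blast

lemma at_within_sector_le_ang: "M > 1 \<Longrightarrow> at 0 within sector M \<le> ang"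
  unfolding ang_def by (rule SUP_upper) simp

lemma sector_Re_pos: "u \<in> sector M \<Longrightarrow> M > 0 \<Longrightarrow> Re u > 0"
proof -
  assume "u \<in> sector M" "M > 0"
  then have "0 \<le> norm u" "norm u < M * Re u" by (auto simp: sector_def)
  with \<open>M > 0\<close> show "Re u > 0" by (smt (verit) zero_less_mult_iff)
qed

lemma sector_mono: "M \<le> N \<Longrightarrow> M > 0 \<Longrightarrow> sector M \<subseteq> sector N"
proof
  fix u assume a: "M \<le> N" "M > 0" "u \<in> sector M"
  then have "Re u > 0" using sector_Re_pos by blast
  then have "M * Re u \<le> N * Re u" using a by simp
  then show "u \<in> sector N" using a by (auto simp: sector_def)
qed

lemma norm_one_minus_sq: "(norm (1 - u))^2 = 1 - 2 * Re u + (norm u)^2"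
  unfolding cmod_power2 by (simp add: power2_eq_square algebra_simps)

lemma unit_mult_cnj: "norm x = 1 \<Longrightarrow> x * cnj x = 1"
  by (metis complex_norm_square of_real_1 power_one)

lemma cap_Re_pos: "u \<in> cap \<rho> \<Longrightarrow> Re u > 0"
proof -
  assume "u \<in> cap \<rho>"
  then have "norm (1 - u) < 1" by (auto simp: cap_def dist_norm)
  moreover have "Re (1 - u) \<le> norm (1-u)" by (rule complex_Re_le_cmod)
  ultimately show ?thesis by simp
qed

lemma cap_nonzero: "u \<in> cap \<rho> \<Longrightarrow> u \<noteq> 0"
  using cap_Re_pos by fastforce

text \<open>In the coordinate u the disc is \<open>(norm u)^2 < 2 * Re u\<close>. In the sector
  \<open>(norm u)^2 < norm u * (M * Re u)\<close>, and this is below \<open>Re u\<close> once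
  \<open>norm u < 1 / M\<close>.\<close>

lemma sector_subset_cap:
  assumes "M > 0" "norm u < 1 / M" "norm u < \<rho>" "u \<in> sector M"
  shows "u \<in> cap \<rho>"
proof -
  have R: "Re u > 0" using assms sector_Re_pos by blast
  have n: "norm u > 0" using R by auto
  have "norm u * norm u < (1/M) * norm u" using assms(2) n by (intro mult_strict_right_mono) auto
  also have "\<dots> < (1/M) * (M * Re u)" using assms by (intro mult_strict_left_mono) (auto simp: sector_def)
  also have "\<dots> = Re u" using assms by simp
  finally have "(norm (1-u))^2 < 1^2"
    using norm_one_minus_sq[of u] R by (simp add: power2_eq_square)
  then have "norm (1-u) < 1" by (rule power_less_imp_less_base) simp
  then show ?thesis using assms by (auto simp: cap_def dist_norm)
qed

lemma eventually_ang_norm: "r > 0 \<Longrightarrow> eventually (\<lambda>u. norm u < r) ang"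
  unfolding eventually_ang eventually_at by (auto simp: dist_norm)

lemma eventually_ang_cap: "\<rho> > 0 \<Longrightarrow> eventually (\<lambda>u. u \<in> cap \<rho>) ang"
  unfolding eventually_ang
proof safe
  fix M :: real assume "1 < M" "\<rho> > 0"
  then show "\<forall>\<^sub>F u in at 0 within sector M. u \<in> cap \<rho>"
    unfolding eventually_at
    by (intro exI[of _ "min \<rho> (1/M)"]) (auto intro!: sector_subset_cap[of M])
qed

lemma ang_tendsto_0: "((\<lambda>u. u) \<longlongrightarrow> 0) ang"
  unfolding filterlim_ang_iff by (auto intro: tendsto_ident_at)

lemma filterlim_of_real_ang: "filterlim complex_of_real ang (at_right 0)"
proof -
  have "eventually (\<lambda>s::real. s > 0) (at_right 0)"
    by (rule eventually_at_right_less)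
  then have "eventually (\<lambda>s::real. complex_of_real s \<in> sector 2 \<and> complex_of_real s \<noteq> 0) (at_right 0)"
    by eventually_elim (auto simp: sector_def)
  moreover have "(complex_of_real \<longlongrightarrow> of_real 0) (at_right 0)"
    by (intro tendsto_of_real tendsto_ident_at)
  ultimately have "filterlim complex_of_real (at 0 within sector 2) (at_right 0)"
    unfolding filterlim_at of_real_0 by (rule conjI)
  from filterlim_mono[OF this at_within_sector_le_ang order_refl] show ?thesis by simp
qed

lemma ang_neq_bot [simp]: "ang \<noteq> bot"
proof
  assume "ang = bot"
  then have "eventually (\<lambda>s::real. False) (at_right 0)"
    using filterlim_of_real_ang unfolding filterlim_iff by fastforce
  then show False by (simp add: eventually_False)
qed

lemma filterlim_angI:
  assumes "M > 1" "(g \<longlongrightarrow> 0) F" "eventually (\<lambda>x. g x \<in> sector M) F"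
  shows "filterlim g ang F"
proof -
  have "eventually (\<lambda>x. g x \<in> sector M \<and> g x \<noteq> 0) F"
    using assms(3)
  proof eventually_elim
    case (elim x)
    then show ?case using assms(1) sector_Re_pos[of "g x" M] by fastforce
  qed
  then have "filterlim g (at 0 within sector M) F"
    unfolding filterlim_at using assms(2) by blast
  from filterlim_mono[OF this at_within_sector_le_ang[OF assms(1)] order_refl] show ?thesis .
qed

text \<open>Stolz regions and sectors are interleaved: \<open>1 - norm z \<le> Re u\<close> puts
  \<open>stolz x M\<close> into \<open>sector M\<close>, while near 0 the bound
  \<open>Re u \<le> 2 * (1 - norm (1 - u))\<close> puts \<open>sector M\<close> into
  \<open>stolz x (2 * M)\<close>. The change of aperture is harmless, as every aperture is
  considered.\<close>

lemma angular_limit_iff: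
  assumes x: "norm x = 1"
  shows "angular_limit f x L \<longleftrightarrow> ((\<lambda>u. f (x * (1 - u))) \<longlongrightarrow> L) ang"
proof
  assume A: "angular_limit f x L"
  show "((\<lambda>u. f (x * (1 - u))) \<longlongrightarrow> L) ang"
    unfolding filterlim_ang_iff
  proof safe
    fix M :: real assume M: "M > 1"
    have "((\<lambda>u. x * (1 - u)) \<longlongrightarrow> x) (at 0 within sector M)"
      by (auto intro!: tendsto_eq_intros)
    moreover have "eventually (\<lambda>u. x * (1-u) \<in> stolz x (2*M) \<and> x * (1-u) \<noteq> x) (at 0 within sector M)"
      unfolding eventually_at
    proof (intro exI[of _ "1/M"] conjI ballI impI; (elim conjE)?)
      show "1/M > 0" using M by simp
    next
      fix u assume u: "u \<in> sector M" "u \<noteq> 0" "dist u 0 < 1 / M"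
      have R: "Re u > 0" using u M sector_Re_pos[of u M] by simp
      have nM: "norm u < M * Re u" using u by (simp add: sector_def)
      have "norm u * norm u \<le> norm u * (M * Re u)"
        using nM by (intro mult_left_mono) auto
      also have "\<dots> \<le> (1/M) * (M * Re u)" using u M R by (intro mult_right_mono) (auto simp: dist_norm)
      also have "\<dots> = Re u" using M by simp
      finally have 1: "(norm u)^2 \<le> Re u" by (simp add: power2_eq_square)
      have "(1 - norm (1-u))^2 \<ge> 0" by simp
      then have "2 * (1 - norm (1-u)) \<ge> 1 - (norm (1-u))^2"
        by (simp add: power2_eq_square algebra_simps)
      then have 2: "2 * (1 - norm (1-u)) \<ge> Re u" using 1 norm_one_minus_sq[of u] by linarith
      have "M * Re u \<le> M * (2 * (1 - norm (1-u)))" using 2 M by (intro mult_left_mono) auto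
      then have "norm u < 2 * M * (1 - norm (1-u))" using nM by (simp add: mult_ac)
      moreover have "norm (x - x * (1-u)) = norm u" using x by (simp add: algebra_simps norm_mult)
      moreover have "norm (x * (1-u)) = norm (1-u)" using x by (simp add: norm_mult)
      ultimately show "x * (1-u) \<in> stolz x (2*M)"
        using 2 R by (auto simp: stolz_def)
      show "x * (1-u) \<noteq> x" using u x by (auto simp: algebra_simps)
    qed
    ultimately have "filterlim (\<lambda>u. x * (1 - u)) (at x within stolz x (2*M)) (at 0 within sector M)"
      unfolding filterlim_at by simp
    moreover have "(f \<longlongrightarrow> L) (at x within stolz x (2*M))"
      using A M unfolding angular_limit_def by simp
    ultimately show "((\<lambda>u. f (x * (1 - u))) \<longlongrightarrow> L) (at 0 within sector M)"
      by (rule filterlim_compose[rotated])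
  qed
next
  assume A: "((\<lambda>u. f (x * (1 - u))) \<longlongrightarrow> L) ang"
  have xx: "x * cnj x = 1" by (rule unit_mult_cnj[OF x])
  show "angular_limit f x L"
    unfolding angular_limit_def
  proof safe
    fix M :: real assume M: "M > 1"
    have "((\<lambda>z. 1 - cnj x * z) \<longlongrightarrow> 0) (at x within stolz x M)"
      by (auto intro!: tendsto_eq_intros simp: xx mult.commute)
    moreover have "eventually (\<lambda>z. 1 - cnj x * z \<in> sector M \<and> 1 - cnj x * z \<noteq> 0) (at x within stolz x M)"
      unfolding eventually_at
    proof (intro exI[of _ 1] conjI ballI impI; (elim conjE)?)
      show "(1::real) > 0" by simp
    next
      fix z assume z: "z \<in> stolz x M" "z \<noteq> x"
      have "norm (x - z) = norm (x * (1 - cnj x * z))" by (simp add: right_diff_distrib xx flip: mult.assoc)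
      then have n: "norm (x - z) = norm (1 - cnj x * z)" using x by (simp add: norm_mult)
      have "Re (cnj x * z) \<le> norm (cnj x * z)" by (rule complex_Re_le_cmod)
      then have "Re (1 - cnj x * z) \<ge> 1 - norm z" using x by (simp add: norm_mult)
      then have "M * (1 - norm z) \<le> M * Re (1 - cnj x * z)" using M by (intro mult_left_mono) auto
      then show "1 - cnj x * z \<in> sector M" using z n by (auto simp: sector_def stolz_def)
      show "1 - cnj x * z \<noteq> 0" using z n by auto
    qed
    ultimately have "filterlim (\<lambda>z. 1 - cnj x * z) (at 0 within sector M) (at x within stolz x M)"
      unfolding filterlim_at by simp
    from filterlim_compose[OF A filterlim_mono[OF this at_within_sector_le_ang[OF M] order_refl]]
    show "(f \<longlongrightarrow> L) (at x within stolz x M)"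
      by (simp add: xx flip: mult.assoc)
  qed
qed

lemma wpow_at:
  assumes x: "norm x = 1"
  shows "wpow x \<beta> (x * (1 - u)) = u powr of_real \<beta>"
proof -
  have xx: "cnj x * x = 1" using unit_mult_cnj[OF x] by (simp add: mult.commute)
  show ?thesis unfolding wpow_def by (simp add: xx flip: mult.assoc)
qed

lemma powr_of_real_tendsto_0_ang:
  assumes "\<beta> > 0"
  shows "((\<lambda>u. u powr of_real \<beta>) \<longlongrightarrow> 0) ang"
proof (rule tendsto_norm_zero_cancel)
  have "((\<lambda>u::complex. norm u powr \<beta>) \<longlongrightarrow> 0 powr \<beta>) ang"
    using assms by (intro tendsto_powr' tendsto_norm_zero ang_tendsto_0 tendsto_const) auto
  then show "((\<lambda>u::complex. norm (u powr of_real \<beta>)) \<longlongrightarrow> 0) ang"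
    by (simp add: norm_powr_real_powr')
qed

lemma nonpos_Reals_Re_pos: "Re u > 0 \<Longrightarrow> u \<notin> \<real>\<^sub>\<le>\<^sub>0"
  by (auto simp: complex_nonpos_Reals_iff)

lemma cap_open [simp]: "open (cap \<rho>)" and cap_convex [simp]: "convex (cap \<rho>)"
  unfolding cap_def by (auto intro: convex_Int)


section \<open>Derivatives, primitives and bounded functions along the angular filter\<close>

text \<open>Cauchy's estimate for \<open>F - L\<close> on a disc about u of radius comparable to
  \<open>norm u\<close>, which stays in a wider sector; the radius in the denominator cancels the
  factor u.\<close>

lemma tendsto_deriv_times_ang:
  assumes hol: "F holomorphic_on cap \<rho>" and \<rho>: "\<rho> > 0" and lim: "(F \<longlongrightarrow> L) ang"
  shows "((\<lambda>u. deriv F u * u) \<longlongrightarrow> 0) ang"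
  unfolding filterlim_ang_iff
proof (intro allI impI tendstoI)
  fix M e :: real assume M: "M > 1" and e: "e > 0"
  \<comment> \<open>A point v at distance at most \<open>norm u / (2 * M)\<close> from u satisfies
    \<open>norm v \<le> 2 * norm u\<close> and \<open>M * Re v > norm u / 2\<close>, hence
    \<open>norm v < 4 * M * Re v\<close>.\<close>
  define N where "N = 4 * M + 2"
  have N: "N > 1" using M by (simp add: N_def)
  have "(F \<longlongrightarrow> L) (at 0 within sector N)" using lim N unfolding filterlim_ang_iff by blast
  moreover have "e / (4 * M) > 0" using e M by simp
  ultimately have "\<forall>\<^sub>F u in at 0 within sector N. dist (F u) L < e / (4 * M)"
    by (rule tendstoD)
  then obtain d where d: "d > 0"
    and dF: "\<And>u. u \<in> sector N \<Longrightarrow> u \<noteq> 0 \<Longrightarrow> norm u < d \<Longrightarrow> norm (F u - L) < e / (4*M)"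
    unfolding eventually_at by (auto simp: dist_norm)
  show "\<forall>\<^sub>F u in at 0 within sector M. dist (deriv F u * u) 0 < e"
    unfolding eventually_at
  proof (intro exI[of _ "min (d/2) (min (\<rho>/2) (1/(2*N)))"] conjI ballI impI; (elim conjE)?)
    show "0 < min (d/2) (min (\<rho>/2) (1/(2*N)))" using d \<rho> N by simp
  next
    fix u assume u: "u \<in> sector M" "u \<noteq> 0" "dist u 0 < min (d/2) (min (\<rho>/2) (1/(2*N)))"
    define r where "r = norm u / (2*M)"
    have nu: "norm u > 0" using u by simp
    have r: "r > 0" "r \<le> norm u" using nu M by (auto simp: r_def field_simps)
    have sub: "v \<in> sector N \<and> v \<in> cap \<rho> \<and> norm (F v - L) < e / (4*M)" if v: "v \<in> cball u r" for v
    proof -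
      have n1: "norm (u - v) \<le> r" using v by (simp add: dist_norm)
      have n2: "norm v \<le> 2 * norm u"
        using norm_triangle_ineq2[of v u] n1 r by (simp add: norm_minus_commute)
      have "Re (u - v) \<le> norm (u - v)" by (rule complex_Re_le_cmod)
      then have "M * Re v \<ge> M * Re u - M * r" using n1 M by (simp flip: right_diff_distrib)
      moreover have "M * r = norm u / 2" using M by (simp add: r_def)
      moreover have "norm u < M * Re u" using u by (simp add: sector_def)
      ultimately have R: "M * Re v > norm u / 2" by linarith
      then have "M * Re v > 0" using nu by linarith
      then have Rv: "Re v > 0" using M by (simp add: zero_less_mult_iff)
      have "norm v < 4 * (M * Re v)" using n2 R by linarith
      also have "\<dots> \<le> N * Re v" using Rv by (simp add: N_def algebra_simps)
      finally have s: "v \<in> sector N" by (simp add: sector_def)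
      have "norm v < 1/N" "norm v < \<rho>" "norm v < d" using n2 u(3) by (auto simp: dist_norm)
      moreover have "v \<noteq> 0" using Rv by auto
      ultimately show ?thesis using s sector_subset_cap[of N v \<rho>] dF[of v] N by auto
    qed
    have diff: "F field_differentiable at u"
      using sub[of u] r hol holomorphic_on_imp_differentiable_at[OF hol cap_open] by auto
    have "norm ((deriv ^^ 1) (\<lambda>v. F v - L) u) \<le> fact 1 * (e / (4*M)) / r ^ 1"
    proof (rule Cauchy_inequality)
      have h: "(\<lambda>v. F v - L) holomorphic_on cap \<rho>" by (intro holomorphic_intros hol)
      show "(\<lambda>v. F v - L) holomorphic_on ball u r"
        using sub by (intro holomorphic_on_subset[OF h]) (auto simp: dist_norm)
      show "continuous_on (cball u r) (\<lambda>v. F v - L)"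
        using sub by (intro continuous_on_subset[OF holomorphic_on_imp_continuous_on[OF h]]) auto
      show "r > 0" by (rule r)
      show "norm (F v - L) \<le> e / (4*M)" if "norm (u - v) = r" for v
        using sub[of v] that by (auto simp: dist_norm)
    qed
    then have "norm (deriv F u) \<le> e / (4*M) / r"
      using diff by (simp add: deriv_diff)
    then have "norm (deriv F u) * norm u \<le> (e / (4*M) / r) * norm u"
      by (intro mult_right_mono) auto
    also have "\<dots> = e / 2" using M nu by (simp add: r_def field_simps)
    finally show "dist (deriv F u * u) 0 < e" using e by (simp add: norm_mult)
  qed
qed

lemma ang_cong:
  assumes "(f \<longlongrightarrow> l) ang" "\<rho> > 0" "\<And>u. u \<in> cap \<rho> \<Longrightarrow> f u = g u" "l = l'"
  shows "(g \<longlongrightarrow> l') ang"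
  using assms(1) unfolding assms(4)
  by (rule Lim_transform_eventually) (rule eventually_mono[OF eventually_ang_cap[OF assms(2)] assms(3)])

lemma powr_comparable:
  fixes a b M \<alpha> :: real
  assumes "0 < a" "a \<le> b" "b \<le> M * a" "M > 1"
  shows "a powr (-\<alpha>) \<le> M powr \<bar>\<alpha>\<bar> * b powr (-\<alpha>)"
proof (cases "\<alpha> \<le> 0")
  case True
  then have "a powr (-\<alpha>) \<le> 1 * b powr (-\<alpha>)" using assms by (simp add: powr_mono2)
  also have "\<dots> \<le> M powr \<bar>\<alpha>\<bar> * b powr (-\<alpha>)"
    using assms by (intro mult_right_mono) (auto simp: ge_one_powr_ge_zero)
  finally show ?thesis .
next
  case False
  have "b / M \<le> a" using assms by (simp add: field_simps)
  then have "a powr (-\<alpha>) \<le> (b/M) powr (-\<alpha>)"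
    using assms False by (intro powr_mono2') auto
  also have "\<dots> = M powr \<bar>\<alpha>\<bar> * b powr (-\<alpha>)"
    using assms False by (simp add: powr_divide powr_minus field_simps)
  finally show ?thesis .
qed

lemma real_deriv_of_real_arg:
  assumes "F holomorphic_on cap \<rho>" "complex_of_real s \<in> cap \<rho>"
  shows "((\<lambda>s. F (complex_of_real s)) has_vector_derivative deriv F (of_real s)) (at s)"
proof -
  have "(F has_field_derivative deriv F (of_real s)) (at (of_real s))"
    using assms by (intro holomorphic_derivI[OF _ cap_open]) auto
  from has_vector_derivative_real_field[OF this] show ?thesis .
qed

text \<open>A derivative of size \<open>o(norm u powr (-\<alpha>))\<close> is integrable at 0
  because \<open>\<alpha> < 1\<close>. It is integrated twice: along the positive axis, which
  produces c and the estimate there, and then from \<open>norm u\<close> to u inside the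
  sector.\<close>

lemma ang_primitive_0:
  assumes hol: "g holomorphic_on cap \<rho>" and \<rho>: "\<rho> > 0" and \<alpha>: "\<alpha> < 1"
    and lim: "((\<lambda>u. deriv g u * u powr of_real \<alpha>) \<longlongrightarrow> 0) ang"
  shows "\<exists>c. ((\<lambda>u. (g u - c) * u powr of_real (\<alpha> - 1)) \<longlongrightarrow> 0) ang"
proof -
  define \<beta> where "\<beta> = 1 - \<alpha>"
  have \<beta>: "\<beta> > 0" using \<alpha> by (simp add: \<beta>_def)
  have A: "\<exists>d>0. \<forall>u\<in>sector M. norm u < d \<longrightarrow> u \<in> cap \<rho> \<and> norm (deriv g u) \<le> e * norm u powr (-\<alpha>)"
    if M: "M > 1" and e: "e > 0" for M e :: real
  proof -
    have "((\<lambda>u. deriv g u * u powr of_real \<alpha>) \<longlongrightarrow> 0) (at 0 within sector M)"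
      using lim M unfolding filterlim_ang_iff by blast
    from tendstoD[OF this e] obtain d where d: "d > 0"
      and dF: "\<And>u. u \<in> sector M \<Longrightarrow> u \<noteq> 0 \<Longrightarrow> norm u < d \<Longrightarrow> norm (deriv g u * u powr of_real \<alpha>) < e"
      unfolding eventually_at by (auto simp: dist_norm)
    show ?thesis
    proof (intro exI[of _ "min d (min \<rho> (1/M))"] conjI ballI impI)
      show "0 < min d (min \<rho> (1/M))" using d \<rho> M by simp
    next
      fix u assume u: "u \<in> sector M" "norm u < min d (min \<rho> (1/M))"
      then show c: "u \<in> cap \<rho>" using sector_subset_cap[of M u \<rho>] M by auto
      then have u0: "u \<noteq> 0" by (rule cap_nonzero)
      have "norm (deriv g u) * norm u powr \<alpha> < e"
        using dF[of u] u u0 by (simp add: norm_mult norm_powr_real_powr')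
      then show "norm (deriv g u) \<le> e * norm u powr (-\<alpha>)"
        using u0 by (simp add: powr_minus field_simps)
    qed
  qed
  \<comment> \<open>\<open>e * s powr \<beta>\<close> is a primitive of the bound that
    \<open>A\<close> gives on the axis, so the mean value inequality compares the increments of
    both.\<close>
  have B: "\<exists>d>0. \<forall>a b. 0 < a \<and> a \<le> b \<and> b < d \<longrightarrow>
      norm (g (of_real b) - g (of_real a)) \<le> e * (b powr \<beta> - a powr \<beta>)" if e: "e > 0" for e :: real
  proof -
    from A[of 2 "e * \<beta>"] e \<beta> obtain d where d: "d > 0"
      and dg: "\<And>u. u\<in>sector 2 \<Longrightarrow> norm u < d \<Longrightarrow> u \<in> cap \<rho> \<and> norm (deriv g u) \<le> e * \<beta> * norm u powr (-\<alpha>)"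
      by auto
    show ?thesis
    proof (intro exI[of _ d] conjI allI impI, rule d, elim conjE)
      fix a b assume ab: "0 < a" "a \<le> b" "b < d"
      have s2: "complex_of_real s \<in> sector 2" if "s > 0" for s using that by (simp add: sector_def)
      have cp: "complex_of_real s \<in> cap \<rho>" "norm (deriv g (of_real s)) \<le> e * \<beta> * s powr (-\<alpha>)"
        if "a \<le> s" "s \<le> b" for s
        using dg[OF s2[of s]] that ab by auto
      show "norm (g (of_real b) - g (of_real a)) \<le> e * (b powr \<beta> - a powr \<beta>)"
      proof (cases "a = b")
        case False
        have vd: "((\<lambda>s. g (complex_of_real s)) has_vector_derivative deriv g (of_real s)) (at s)"
          if "a \<le> s" "s \<le> b" for s
          using cp that by (intro real_deriv_of_real_arg[OF hol]) auto
        have pd: "((\<lambda>s. e * s powr \<beta>) has_real_derivative (e * \<beta> * s powr (-\<alpha>))) (at s)"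
          if "a \<le> s" for s
          using that ab by (auto intro!: derivative_eq_intros simp: \<beta>_def)
        have "norm (g (of_real b) - g (of_real a)) \<le> e * b powr \<beta> - e * a powr \<beta>"
        proof (rule differentiable_bound_general[where f' = "\<lambda>s. deriv g (of_real s)"
              and \<phi>' = "\<lambda>s. e * \<beta> * s powr (-\<alpha>)"])
          show "a < b" using False ab by simp
          show "continuous_on {a..b} (\<lambda>s. g (complex_of_real s))"
            using vd by (auto intro!: continuous_at_imp_continuous_on has_vector_derivative_continuous)
          show "continuous_on {a..b} (\<lambda>s. e * s powr \<beta>)"
            using ab by (auto intro!: continuous_intros)
        qed (use vd pd cp in \<open>auto simp: has_real_derivative_iff_has_vector_derivative\<close>)
        then show ?thesis by (simp add: algebra_simps)
      qed simp
    qed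
  qed
  define X where "X = (\<lambda>n::nat. g (complex_of_real (1 / (real n + 1))))"
  have "Cauchy X"
  proof (rule metric_CauchyI)
    fix e :: real assume e: "e > 0"
    from B[of "1"] obtain d where d: "d > 0" and dg: "\<And>a b. 0 < a \<Longrightarrow> a \<le> b \<Longrightarrow> b < d \<Longrightarrow>
      norm (g (of_real b) - g (of_real a)) \<le> 1 * (b powr \<beta> - a powr \<beta>)" by auto
    define d' where "d' = min d (e powr (1/\<beta>))"
    have d': "d' > 0" using d e by (simp add: d'_def)
    then obtain N :: nat where N: "1 / (real N + 1) < d'"
      using reals_Archimedean by (metis Suc_eq_plus1 inverse_eq_divide of_nat_1 of_nat_add)
    have key: "dist (X m) (X n) < e" if mn: "N \<le> m" "m \<le> n" for m n
    proof -
      have le: "1 / (real n + 1) \<le> 1 / (real m + 1)" using mn by (intro frac_le) auto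
      have "1 / (real m + 1) \<le> 1 / (real N + 1)" using mn by (intro frac_le) auto
      then have lt: "1 / (real m + 1) < d'" using N by linarith
      have "dist (X m) (X n) \<le> (1 / (real m + 1)) powr \<beta> - (1 / (real n + 1)) powr \<beta>"
        unfolding X_def dist_norm using dg[OF _ le] lt by (simp add: d'_def)
      also have "\<dots> \<le> (1 / (real m + 1)) powr \<beta>" by simp
      also have "\<dots> < (e powr (1/\<beta>)) powr \<beta>"
        using lt \<beta> by (intro powr_less_mono2) (auto simp: d'_def)
      also have "\<dots> = e" using e \<beta> by (simp add: powr_powr)
      finally show ?thesis .
    qed
    show "\<exists>N. \<forall>m\<ge>N. \<forall>n\<ge>N. dist (X m) (X n) < e"
    proof (intro exI[of _ N] allI impI)
      fix m n assume "N \<le> m" "N \<le> n"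
      then show "dist (X m) (X n) < e"
        using key[of m n] key[of n m] by (cases "m \<le> n") (auto simp: dist_commute)
    qed
  qed
  then obtain c where c: "X \<longlonglongrightarrow> c" using Cauchy_convergent convergentD by blast
  have C: "\<exists>d>0. \<forall>b. 0 < b \<and> b < d \<longrightarrow> norm (g (of_real b) - c) \<le> e * b powr \<beta>" if e: "e > 0" for e :: real
  proof -
    from B[OF e] obtain d where d: "d > 0" and dg: "\<And>a b. 0 < a \<Longrightarrow> a \<le> b \<Longrightarrow> b < d \<Longrightarrow>
      norm (g (of_real b) - g (of_real a)) \<le> e * (b powr \<beta> - a powr \<beta>)" by auto
    have "norm (g (of_real b) - c) \<le> e * b powr \<beta>" if b: "0 < b" "b < d" for b
    proof (rule tendsto_upperbound)
      show "(\<lambda>n. norm (g (of_real b) - X n)) \<longlonglongrightarrow> norm (g (of_real b) - c)"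
        by (intro tendsto_intros c)
      obtain N :: nat where N: "1 / (real N + 1) < b"
        using reals_Archimedean[OF b(1)] by (metis Suc_eq_plus1 inverse_eq_divide of_nat_1 of_nat_add)
      show "\<forall>\<^sub>F n in sequentially. norm (g (of_real b) - X n) \<le> e * b powr \<beta>"
        using eventually_ge_at_top[of N]
      proof eventually_elim
        case (elim n)
        have "1 / (real n + 1) \<le> 1 / (real N + 1)" using elim by (intro frac_le) auto
        then have "norm (g (of_real b) - X n) \<le> e * (b powr \<beta> - (1 / (real n + 1)) powr \<beta>)"
          unfolding X_def using N b by (intro dg) auto
        also have "\<dots> \<le> e * b powr \<beta>" using e by (intro mult_left_mono) auto
        finally show ?case .
      qed
    qed auto
    then show ?thesis using d by auto
  qed
  have "((\<lambda>u. (g u - c) * u powr of_real (\<alpha> - 1)) \<longlongrightarrow> 0) ang"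
    unfolding filterlim_ang_iff
  proof (intro allI impI tendstoI)
    fix M e :: real assume M: "M > 1" and e: "e > 0"
    define K where "K = M powr \<bar>\<alpha>\<bar>"
    have K: "K > 0" using M by (simp add: K_def)
    \<comment> \<open>Chosen so that the contributions \<open>2 * e' * K\<close> of the segment and
      \<open>e'\<close> of the axis add up to \<open>e / 2\<close>.\<close>
    define e' where "e' = e / (4 * K + 2)"
    have e': "e' > 0" using e K by (simp add: e'_def)
    from A[OF M e'] obtain d1 where d1: "d1 > 0" and dg1: "\<And>u. u\<in>sector M \<Longrightarrow> norm u < d1 \<Longrightarrow>
      u \<in> cap \<rho> \<and> norm (deriv g u) \<le> e' * norm u powr (-\<alpha>)" by auto
    from C[OF e'] obtain d2 where d2: "d2 > 0" and dg2: "\<And>b. 0 < b \<Longrightarrow> b < d2 \<Longrightarrow>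
      norm (g (of_real b) - c) \<le> e' * b powr \<beta>" by auto
    show "\<forall>\<^sub>F u in at 0 within sector M. dist ((g u - c) * u powr of_real (\<alpha> - 1)) 0 < e"
      unfolding eventually_at
    proof (intro exI[of _ "min d1 d2"] conjI ballI impI; (elim conjE)?)
      show "0 < min d1 d2" using d1 d2 by simp
    next
      fix u assume u: "u \<in> sector M" "u \<noteq> 0" "dist u 0 < min d1 d2"
      define t where "t = norm u"
      have t: "t > 0" "t < d1" "t < d2" using u by (auto simp: t_def dist_norm)
      have Ru: "Re u > 0" "Re u \<le> t" "t < M * Re u"
        using u M sector_Re_pos[of u M] complex_Re_le_cmod[of u] by (auto simp: t_def sector_def)
      \<comment> \<open>The segment stays in the sector and its points have modulus between
        \<open>t / M\<close> and t, so the bound on the derivative is uniform along it for either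
        sign of \<alpha>.\<close>
      have seg: "v \<in> sector M \<and> t / M \<le> norm v \<and> norm v \<le> t" if v: "v \<in> closed_segment (of_real t) u" for v
      proof -
        have conv: "convex {z. Re z \<ge> Re u} "
          using convex_halfspace_Re_ge[of "Re u"] by simp
        have "closed_segment (of_real t) u \<subseteq> {z. Re z \<ge> Re u}"
          using Ru by (intro closed_segment_subset conv) auto
        then have R: "Re v \<ge> Re u" using v by auto
        have "closed_segment (of_real t) u \<subseteq> cball 0 t"
          using t by (intro closed_segment_subset convex_cball) (auto simp: t_def)
        then have n: "norm v \<le> t" using v by auto
        have "M * Re u \<le> M * Re v" using R M by simp
        then have "norm v < M * Re v" using n Ru by linarith
        moreover have "t / M \<le> norm v"
          using Ru R complex_Re_le_cmod[of v] M by (auto simp: field_simps intro: order_trans less_imp_le)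
        ultimately show ?thesis using n by (auto simp: sector_def)
      qed
      have "norm (g u - g (of_real t)) \<le> (e' * (K * t powr (-\<alpha>))) * norm (u - of_real t)"
      proof (rule field_differentiable_bound[of "closed_segment (of_real t) u" _ "deriv g"])
        fix v assume v: "v \<in> closed_segment (of_real t) u"
        have nv: "norm v > 0" using seg[OF v] t M by (metis divide_pos_pos less_le_trans less_trans zero_less_one)
        have cv: "v \<in> cap \<rho>" "norm (deriv g v) \<le> e' * norm v powr (-\<alpha>)"
          using dg1[of v] seg[OF v] t by auto
        show "(g has_field_derivative deriv g v) (at v within closed_segment (of_real t) u)"
          using holomorphic_derivI[OF hol cap_open cv(1)] by (rule has_field_derivative_at_within)
        have "norm v powr (-\<alpha>) \<le> K * t powr (-\<alpha>)"
          unfolding K_def using seg[OF v] nv M by (intro powr_comparable) (auto simp: field_simps)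
        then show "norm (deriv g v) \<le> e' * (K * t powr (-\<alpha>))"
          using cv(2) e' by (meson order_trans mult_left_mono less_imp_le)
      qed auto
      also have "norm (u - of_real t) \<le> 2 * t"
        using norm_triangle_ineq4[of u "of_real t"] t by (simp add: t_def)
      also have "(e' * (K * t powr (-\<alpha>))) * (2 * t) = 2 * e' * K * t powr \<beta>"
        using t by (simp add: \<beta>_def powr_diff powr_minus field_simps)
      finally have 1: "norm (g u - g (of_real t)) \<le> 2 * e' * K * t powr \<beta>"
        using e' K by (simp add: mult_left_mono)
      have 2: "norm (g (of_real t) - c) \<le> e' * t powr \<beta>" using dg2 t by simp
      have "norm (g u - c) \<le> norm (g u - g (of_real t)) + norm (g (of_real t) - c)"
        using norm_triangle_ineq[of "g u - g (of_real t)" "g (of_real t) - c"] by simp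
      also have "\<dots> \<le> (2 * e' * K + e') * t powr \<beta>" using 1 2 by (simp add: algebra_simps)
      also have "2 * e' * K + e' = e / 2" 
      proof -
        have "2 * e' * K + e' = e' * (4 * K + 2) / 2" by (simp add: algebra_simps)
        then show ?thesis using K by (simp add: e'_def)
      qed
      finally have "norm (g u - c) * t powr (\<alpha> - 1) \<le> (e / 2 * t powr \<beta>) * t powr (\<alpha> - 1)"
        by (intro mult_right_mono) auto
      also have "\<dots> = e / 2" using t by (simp add: \<beta>_def mult.assoc flip: powr_add)
      finally have "norm (g u - c) * t powr (\<alpha> - 1) < e" using e by linarith
      then show "dist ((g u - c) * u powr of_real (\<alpha> - 1)) 0 < e"
        by (simp add: norm_mult norm_powr_real_powr' t_def del: of_real_diff)
    qed
  qed
  then show ?thesis by blast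
qed

text \<open>Subtracting \<open>k * u powr (1 - \<alpha>)\<close>, whose derivative is
  \<open>L * u powr (-\<alpha>)\<close>, reduces the claim to limit 0. Convergence of f itself
  follows from the second limit, since \<open>u powr (1 - \<alpha>)\<close> tends to 0.\<close>

lemma ang_primitive:
  assumes hol: "f holomorphic_on cap \<rho>" and \<rho>: "\<rho> > 0" and \<alpha>: "\<alpha> < 1"
    and lim: "((\<lambda>u. deriv f u * u powr of_real \<alpha>) \<longlongrightarrow> L) ang"
  obtains c where "(f \<longlongrightarrow> c) ang"
    "((\<lambda>u. (f u - c) * u powr of_real (\<alpha> - 1)) \<longlongrightarrow> L / of_real (1 - \<alpha>)) ang"
proof -
  define k where "k = L / complex_of_real (1 - \<alpha>)"
  define g where "g = (\<lambda>u. f u - k * u powr of_real (1 - \<alpha>))"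
  have np: "u \<notin> \<real>\<^sub>\<le>\<^sub>0" if "u \<in> cap \<rho>" for u using cap_Re_pos[OF that] by (rule nonpos_Reals_Re_pos)
  have holg: "g holomorphic_on cap \<rho>"
    unfolding g_def using np by (intro holomorphic_intros hol) auto
  have pw: "u powr of_real (-\<alpha>) * u powr of_real \<alpha> = 1" "u powr of_real (1-\<alpha>) * u powr of_real (\<alpha>-1) = 1"
    if "u \<noteq> 0" for u :: complex
    using that by (simp_all flip: powr_add)
  have dg: "deriv g u = deriv f u - L * u powr of_real (-\<alpha>)" if u: "u \<in> cap \<rho>" for u
  proof (rule DERIV_imp_deriv)
    have "(f has_field_derivative deriv f u) (at u)" by (rule holomorphic_derivI[OF hol cap_open u])
    then have "(g has_field_derivative deriv f u - k * (of_real (1-\<alpha>) * u powr (of_real (1-\<alpha>) - 1))) (at u)"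
      unfolding g_def by (intro DERIV_diff DERIV_cmult has_field_derivative_powr np[OF u])
    moreover have "k * of_real (1-\<alpha>) = L" using \<alpha> by (simp add: k_def del: of_real_diff)
    moreover have "of_real (1-\<alpha>) - 1 = complex_of_real (-\<alpha>)" by simp
    ultimately show "(g has_field_derivative deriv f u - L * u powr of_real (-\<alpha>)) (at u)"
      by (simp only: flip: mult.assoc)
  qed
  have "((\<lambda>u. deriv f u * u powr of_real \<alpha> - L) \<longlongrightarrow> L - L) ang"
    by (intro tendsto_intros lim)
  then have "((\<lambda>u. deriv g u * u powr of_real \<alpha>) \<longlongrightarrow> 0) ang"
  proof (rule ang_cong[OF _ \<rho>])
    fix u assume u: "u \<in> cap \<rho>"
    have "deriv g u * u powr of_real \<alpha>
        = deriv f u * u powr of_real \<alpha> - L * (u powr of_real (-\<alpha>) * u powr of_real \<alpha>)"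
      unfolding dg[OF u] by (simp only: left_diff_distrib mult.assoc)
    then show "deriv f u * u powr of_real \<alpha> - L = deriv g u * u powr of_real \<alpha>"
      unfolding pw(1)[OF cap_nonzero[OF u]] by simp
  qed simp
  then obtain c where c: "((\<lambda>u. (g u - c) * u powr of_real (\<alpha> - 1)) \<longlongrightarrow> 0) ang"
    using ang_primitive_0[OF holg \<rho> \<alpha>] by blast
  have "((\<lambda>u. (g u - c) * u powr of_real (\<alpha> - 1) + k) \<longlongrightarrow> 0 + k) ang"
    by (intro tendsto_intros c)
  then have lim2: "((\<lambda>u. (f u - c) * u powr of_real (\<alpha> - 1)) \<longlongrightarrow> k) ang"
  proof (rule ang_cong[OF _ \<rho>])
    fix u assume u: "u \<in> cap \<rho>"
    have "(g u - c) * u powr of_real (\<alpha> - 1) = (f u - c) * u powr of_real (\<alpha> - 1)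
        - k * (u powr of_real (1-\<alpha>) * u powr of_real (\<alpha> - 1))"
      unfolding g_def by (simp add: left_diff_distrib mult.assoc del: of_real_diff)
    then show "(g u - c) * u powr of_real (\<alpha> - 1) + k = (f u - c) * u powr of_real (\<alpha> - 1)"
      unfolding pw(2)[OF cap_nonzero[OF u]] by simp
  qed simp
  have "((\<lambda>u. (f u - c) * u powr of_real (\<alpha> - 1) * u powr of_real (1-\<alpha>)) \<longlongrightarrow> k * 0) ang"
    using \<alpha> by (intro tendsto_mult lim2 powr_of_real_tendsto_0_ang) auto
  then have "((\<lambda>u. f u - c) \<longlongrightarrow> 0) ang"
  proof (rule ang_cong[OF _ \<rho>])
    fix u assume u: "u \<in> cap \<rho>"
    have "(f u - c) * u powr of_real (\<alpha> - 1) * u powr of_real (1-\<alpha>)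
        = (f u - c) * (u powr of_real (1-\<alpha>) * u powr of_real (\<alpha> - 1))"
      by (simp only: ac_simps)
    then show "(f u - c) * u powr of_real (\<alpha> - 1) * u powr of_real (1-\<alpha>) = f u - c"
      unfolding pw(2)[OF cap_nonzero[OF u]] by simp
  qed simp
  then have "(f \<longlongrightarrow> c) ang" using Lim_null by blast
  with lim2 show ?thesis using that unfolding k_def by blast
qed


text \<open>Rescaling: if points \<open>U n\<close> of a sector violate the limit, the functions
  \<open>R (s n * v)\<close> with \<open>s n = norm (U n)\<close> form a normal family on a fixed
  neighbourhood of the arc of unit directions. A subsequential limit equals L on the positive axis,
  hence everywhere by the identity theorem, and uniform convergence on the arc contradicts the
  choice of \<open>U n\<close>.\<close>

lemma Lindelof_ang:
  assumes hol: "R holomorphic_on cap \<rho>" and \<rho>: "\<rho> > 0"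
    and bd: "\<And>u. u \<in> cap \<rho> \<Longrightarrow> norm (R u) \<le> B"
    and lim: "((\<lambda>s. R (complex_of_real s)) \<longlongrightarrow> L) (at_right 0)"
  shows "(R \<longlongrightarrow> L) ang"
proof (rule ccontr)
  assume "\<not> ?thesis"
  then obtain M where M: "M > 1" and "\<not> (R \<longlongrightarrow> L) (at 0 within sector M)"
    unfolding filterlim_ang_iff by blast
  then obtain e where e: "e > 0"
    and ne: "\<not> (\<forall>\<^sub>F u in at 0 within sector M. dist (R u) L < e)"
    unfolding tendsto_iff by blast
  \<comment> \<open>For \<open>norm v < 2\<close> and \<open>Re v > 1 / (2 * M)\<close> the first
    entry gives \<open>s * (norm v)^2 < 2 * Re v\<close>, so that \<open>s * v\<close> stays in the
    disc; the second gives \<open>norm (s * v) < \<rho>\<close>.\<close>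
  define \<delta> where "\<delta> = min (1/(4*M)) (\<rho>/2)"
  have \<delta>: "\<delta> > 0" using M \<rho> by (simp add: \<delta>_def)
  have "\<exists>u. u \<in> sector M \<and> u \<noteq> 0 \<and> norm u < \<delta> / (real n + 1) \<and> \<not> dist (R u) L < e" for n
  proof -
    have "\<delta> / (real n + 1) > 0" using \<delta> by simp
    then show ?thesis using ne unfolding eventually_at dist_norm diff_0_right by blast
  qed
  then obtain U where U: "\<And>n. U n \<in> sector M" "\<And>n. U n \<noteq> 0"
    "\<And>n. norm (U n) < \<delta> / (real n + 1)" "\<And>n. \<not> dist (R (U n)) L < e"
    by metis
  define s where "s = (\<lambda>n. norm (U n))"
  have spos: "s n > 0" for n using U by (simp add: s_def)
  have s\<delta>: "s n < \<delta>" for n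
  proof -
    have "\<delta> / (real n + 1) \<le> \<delta> / 1" using \<delta> by (intro divide_left_mono) auto
    then show ?thesis using U(3)[of n] by (simp add: s_def)
  qed
  have s0: "s \<longlonglongrightarrow> 0"
  proof (rule tendsto_sandwich[of "\<lambda>_. 0" _ _ "\<lambda>n. \<delta> / (real n + 1)"])
    show "(\<lambda>n. \<delta> / (real n + 1)) \<longlonglongrightarrow> 0" by real_asymp
  qed (use U in \<open>auto simp: s_def less_imp_le\<close>)
  define S where "S = {v. Re v > 1/(2*M)} \<inter> ball 0 2"
  have S: "open S" "convex S"
    unfolding S_def by (auto intro: open_Int open_halfspace_Re_gt convex_Int convex_halfspace_Re_gt)
  have cp: "of_real (s n) * v \<in> cap \<rho>" if v: "v \<in> S" for n v
  proof -
    have "(norm v)^2 \<le> 2^2" using v by (intro power_mono) (auto simp: S_def)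
    then have "s n * (norm v)^2 \<le> s n * 4" using spos[of n] by simp
    also have "\<dots> < 1 / M" using s\<delta>[of n] M by (simp add: \<delta>_def)
    also have "\<dots> < 2 * Re v" using v M by (auto simp: S_def field_simps)
    finally have "s n * (s n * (norm v)^2) < s n * (2 * Re v)" using spos[of n] by simp
    moreover have "norm (of_real (s n) * v) = s n * norm v"
      using spos[of n] by (simp add: norm_mult)
    ultimately have "(norm (1 - of_real (s n) * v))^2 < 1^2"
      unfolding norm_one_minus_sq by (simp add: power2_eq_square algebra_simps)
    then have "norm (1 - of_real (s n) * v) < 1" by (rule power_less_imp_less_base) simp
    moreover have "norm (of_real (s n) * v) < \<rho>"
    proof -
      have "s n * norm v \<le> s n * 2" using v spos[of n] by (intro mult_left_mono) (auto simp: S_def)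
      also have "\<dots> < \<rho>" using s\<delta>[of n] by (simp add: \<delta>_def)
      finally show ?thesis using spos[of n] by (simp add: norm_mult)
    qed
    ultimately show ?thesis by (simp add: cap_def dist_norm)
  qed
  define F where "F = (\<lambda>n v. R (of_real (s n) * v))"
  have holF: "F n holomorphic_on S" for n
  proof -
    have "(R \<circ> (\<lambda>v. of_real (s n) * v)) holomorphic_on S"
      using cp by (intro holomorphic_on_compose_gen[OF _ hol] holomorphic_intros) auto
    then show ?thesis by (simp add: F_def o_def)
  qed
  obtain g r where g: "g holomorphic_on S" and r: "strict_mono (r :: nat \<Rightarrow> nat)"
    and pt: "\<And>v. v \<in> S \<Longrightarrow> (\<lambda>n. F (r n) v) \<longlonglongrightarrow> g v"
    and ul: "\<And>K. compact K \<Longrightarrow> K \<subseteq> S \<Longrightarrow> uniform_limit K (F \<circ> r) g sequentially"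
  proof (rule Montel[of S "range F" F])
    show "open S" by (rule S)
    show "h holomorphic_on S" if "h \<in> range F" for h using that holF by auto
    show "\<exists>B. \<forall>h\<in>range F. \<forall>z\<in>K. norm (h z) \<le> B" if "compact K" "K \<subseteq> S" for K
      using that bd cp by (intro exI[of _ B]) (auto simp: F_def)
  qed auto
  have sr0: "(\<lambda>n. s (r n)) \<longlonglongrightarrow> 0"
    using LIMSEQ_subseq_LIMSEQ[OF s0 r] by (simp add: o_def)
  have real: "g (of_real v) = L" if v: "of_real v \<in> S" for v
  proof -
    have v0: "v > 0" using v M by (auto simp: S_def intro: less_trans[of 0 "1/(2*M)"])
    have "(\<lambda>n. s (r n) * v) \<longlonglongrightarrow> 0 * v" by (intro tendsto_intros sr0)
    then have "filterlim (\<lambda>n. s (r n) * v) (at_right 0) sequentially"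
      unfolding filterlim_at using spos v0 less_imp_neq[OF spos]
      by (auto intro!: always_eventually)
    from filterlim_compose[OF lim this] have "(\<lambda>n. F (r n) (of_real v)) \<longlonglongrightarrow> L"
      by (simp add: F_def)
    with pt[OF v] show ?thesis using LIMSEQ_unique by blast
  qed
  have oneS: "complex_of_real v \<in> S" if "v \<in> {1/2..1}" for v
  proof -
    have "1 / (2 * M) < 1/2" using M by (simp add: field_simps)
    then show ?thesis using that by (auto simp: S_def)
  qed
  have gL: "g v = L" if v: "v \<in> S" for v
  proof -
    have "(\<lambda>v. g v - L) v = 0"
    proof (rule analytic_continuation[of "\<lambda>v. g v - L" S "of_real ` {1/2..1}" 1 v])
      show "(\<lambda>v. g v - L) holomorphic_on S" by (intro holomorphic_intros g)
      show "connected S" using S convex_connected by blast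
      show "complex_of_real ` {1/2..1} \<subseteq> S" using oneS by auto
      show "1 \<in> S" using oneS[of 1] by simp
      show "(1::complex) islimpt complex_of_real ` {1/2..1}"
        unfolding islimpt_sequential
      proof (intro exI[of _ "\<lambda>n. complex_of_real (1 - 1 / (real n + 2))"] conjI allI)
        show "complex_of_real (1 - 1 / (real n + 2)) \<in> complex_of_real ` {1/2..1} - {1}" for n
        proof -
          have "1 - 1 / (real n + 2) \<in> {1/2..1}" "1 - 1 / (real n + 2) \<noteq> 1" by (auto simp: field_simps)
          then show ?thesis by (metis DiffI empty_iff image_eqI insertE of_real_eq_1_iff)
        qed
        have "(\<lambda>n. 1 - 1 / (real n + 2)) \<longlonglongrightarrow> 1" by real_asymp
        from tendsto_of_real[OF this] show "(\<lambda>n. complex_of_real (1 - 1 / (real n + 2))) \<longlonglongrightarrow> 1"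
          by (simp only: of_real_1)
      qed
      show "g z - L = 0" if "z \<in> complex_of_real ` {1/2..1}" for z
        using that real oneS by auto
    qed (use S v in auto)
    then show ?thesis by simp
  qed
  define K where "K = {v. Re v \<ge> 1/M} \<inter> sphere (0::complex) 1"
  have K: "compact K" unfolding K_def by (intro closed_Int_compact closed_halfspace_Re_ge) auto
  have KS: "K \<subseteq> S" using M unfolding K_def S_def by (auto simp: field_simps)
  have "\<forall>\<^sub>F n in sequentially. \<forall>v\<in>K. dist ((F \<circ> r) n v) (g v) < e"
    using uniform_limitD[OF ul[OF K KS] e] .
  then obtain n where n: "\<And>v. v \<in> K \<Longrightarrow> dist (F (r n) v) (g v) < e"
    unfolding o_def eventually_sequentially by blast
  define v where "v = U (r n) / of_real (s (r n))"
  have vK: "v \<in> K"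
    using U(1,2)[of "r n"] M by (auto simp: v_def K_def s_def norm_divide sector_def field_simps)
  have "of_real (s (r n)) * v = U (r n)" using spos[of "r n"] by (simp add: v_def)
  then show False using n[OF vK] gL[of v] vK KS U(4)[of "r n"] by (auto simp: F_def)
qed


section \<open>Consequences of the Schwarz lemma\<close>

text \<open>Turns estimates of the pseudohyperbolic distance into estimates of
  \<open>1 - (norm z)^2\<close>, a form in which points can later be sent to the boundary.\<close>

lemma disc_identity:
  "(norm (1 - cnj a * z))\<^sup>2 - (norm (z - a))\<^sup>2 = (1 - (norm a)\<^sup>2) * (1 - (norm z)\<^sup>2)"
  unfolding cmod_power2 by (simp add: power2_eq_square algebra_simps)

lemma one_minus_norm_sq_pos: "norm (z::complex) < 1 \<Longrightarrow> 0 < 1 - (norm z)\<^sup>2"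
  by (simp add: abs_square_less_1)

lemma one_minus_cnj_mult_nz: "norm a < 1 \<Longrightarrow> norm z < 1 \<Longrightarrow> 1 - cnj a * z \<noteq> 0"
proof
  assume a: "norm a < 1" "norm z < 1" "1 - cnj a * z = 0"
  then have "norm (cnj a * z) = 1" by (metis eq_iff_diff_eq_0 norm_one)
  moreover have "norm a * norm z < 1 * 1" using a by (intro mult_strict_mono) auto
  ultimately show False by (simp add: norm_mult)
qed

lemma norm_one_minus_cnj_mult: "norm y = 1 \<Longrightarrow> norm (1 - cnj y * z) = norm (y - z)"
proof -
  assume y: "norm y = 1"
  have "y * (1 - cnj y * z) = y - z"
    using unit_mult_cnj[OF y] by (simp add: right_diff_distrib flip: mult.assoc)
  then show ?thesis using y by (metis mult_1 norm_mult)
qed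

lemma norm_moebius_less_1:
  assumes "norm a < 1" "norm z < 1"
  shows "norm (z - a) < norm (1 - cnj a * z)"
proof -
  have "0 < (1 - (norm a)\<^sup>2) * (1 - (norm z)\<^sup>2)"
    using assms by (intro mult_pos_pos one_minus_norm_sq_pos)
  then have "(norm (z-a))\<^sup>2 < (norm (1 - cnj a * z))\<^sup>2" using disc_identity[of a z] by linarith
  then show ?thesis by (rule power_less_imp_less_base) simp
qed

text \<open>The Schwarz lemma for \<open>T \<circ> m\<close>, where the disc automorphism
  \<open>m\<close> carries 0 to a.\<close>

lemma Schwarz_at:
  assumes hol: "T holomorphic_on ball 0 1" and T1: "\<And>z. norm z < 1 \<Longrightarrow> norm (T z) < 1"
    and a: "norm a < 1" "T a = 0" and z: "norm z < 1"
  shows "norm (T z) * norm (1 - cnj a * z) \<le> norm (z - a)"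
proof -
  define m where "m = (\<lambda>w. (w + a) / (1 + cnj a * w))"
  have nz: "1 + cnj a * w \<noteq> 0" if "norm w < 1" for w
    using one_minus_cnj_mult_nz[of "-a" w] a that by simp
  have m1: "norm (m w) < 1" if "norm w < 1" for w
    using norm_moebius_less_1[of "-a" w] a that nz[OF that] by (simp add: m_def norm_divide)
  have holm: "m holomorphic_on ball 0 1"
    unfolding m_def using nz by (intro holomorphic_intros) auto
  define w where "w = (z - a) / (1 - cnj a * z)"
  have nz2: "1 - cnj a * z \<noteq> 0" using one_minus_cnj_mult_nz a z by blast
  have w1: "norm w < 1" using norm_moebius_less_1[OF a(1) z] nz2 by (simp add: w_def norm_divide)
  have "m w = z"
  proof -
    have "1 + cnj a * w \<noteq> 0" by (rule nz[OF w1])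
    moreover have "w * (1 - cnj a * z) = z - a" using nz2 by (simp add: w_def)
    ultimately show ?thesis unfolding m_def by (simp add: divide_eq_eq algebra_simps)
  qed
  moreover have "norm ((T \<circ> m) w) \<le> norm w"
  proof (rule Schwarz_Lemma(1))
    show "(T \<circ> m) holomorphic_on ball 0 1"
      using m1 by (intro holomorphic_on_compose_gen[OF holm hol]) auto
    show "(T \<circ> m) 0 = 0" using a by (simp add: m_def)
    show "norm ((T \<circ> m) z) < 1" if "norm z < 1" for z using T1 m1 that by simp
  qed (rule w1)
  ultimately have "norm (T z) \<le> norm w" by simp
  then show ?thesis using nz2 by (simp add: w_def norm_divide pos_le_divide_eq)
qed

locale disc_self_map =
  fixes f :: "complex \<Rightarrow> complex"
  assumes hol: "f holomorphic_on ball 0 1" and self: "norm z < 1 \<Longrightarrow> norm (f z) < 1"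
begin

lemma schwarz_pick:
  assumes a: "norm a < 1" and z: "norm z < 1"
  shows "norm (f z - f a) * norm (1 - cnj a * z) \<le> norm (z - a) * norm (1 - cnj (f a) * f z)"
proof -
  define T where "T = (\<lambda>z. (f z - f a) / (1 - cnj (f a) * f z))"
  have nz: "1 - cnj (f a) * f w \<noteq> 0" if "norm w < 1" for w
    using one_minus_cnj_mult_nz self a that by blast
  have "norm (T z) * norm (1 - cnj a * z) \<le> norm (z - a)"
  proof (rule Schwarz_at[OF _ _ a _ z])
    show "T holomorphic_on ball 0 1"
      unfolding T_def using nz by (intro holomorphic_intros hol) auto
    show "norm (T w) < 1" if "norm w < 1" for w
      using norm_moebius_less_1[of "f a" "f w"] self a that nz[OF that] by (simp add: T_def norm_divide)
  qed (simp add: T_def)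
  then show ?thesis using nz[OF z] by (simp add: T_def norm_divide field_simps)
qed

text \<open>The boundary distances of a and of \<open>f a\<close> appear as explicit factors. Their
  quotient can be bounded before a tends to the circle, which is how Julia's inequality and the
  boundary case of Wolff's lemma are obtained.\<close>

lemma schwarz_pick_sq:
  assumes a: "norm a < 1" and z: "norm z < 1"
  shows "(1 - (norm a)\<^sup>2) * (1 - (norm z)\<^sup>2) * (norm (1 - cnj (f a) * f z))\<^sup>2
    \<le> (1 - (norm (f a))\<^sup>2) * (1 - (norm (f z))\<^sup>2) * (norm (1 - cnj a * z))\<^sup>2"
proof -
  have "(norm (f z - f a) * norm (1 - cnj a * z))\<^sup>2 \<le> (norm (z - a) * norm (1 - cnj (f a) * f z))\<^sup>2"
    using schwarz_pick[OF assms] by (intro power_mono) auto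
  then have "(norm (f z - f a))\<^sup>2 * (norm (1 - cnj a * z))\<^sup>2
      \<le> (norm (z - a))\<^sup>2 * (norm (1 - cnj (f a) * f z))\<^sup>2" by (simp add: power_mult_distrib)
  then show ?thesis unfolding disc_identity[symmetric] by (simp add: algebra_simps)
qed

text \<open>Schwarz-Pick divided by \<open>norm (z - a)\<close>, in the limit as z tends to
  a.\<close>

lemma schwarz_pick_deriv:
  assumes a: "norm a < 1"
  shows "norm (deriv f a) * (1 - (norm a)\<^sup>2) \<le> 1 - (norm (f a))\<^sup>2"
proof -
  have fd: "(f has_field_derivative deriv f a) (at a)"
    using a by (intro holomorphic_derivI[OF hol]) auto
  have cf: "(f \<longlongrightarrow> f a) (at a)" using fd DERIV_isCont isCont_def by blast
  have "((\<lambda>z. norm ((f z - f a) / (z - a)) * norm (1 - cnj a * z)) \<longlongrightarrow> norm (deriv f a) * norm (1 - cnj a * a)) (at a)"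
    using fd unfolding has_field_derivative_iff by (intro tendsto_intros) auto
  moreover have "((\<lambda>z. norm (1 - cnj (f a) * f z)) \<longlongrightarrow> norm (1 - cnj (f a) * f a)) (at a)"
    by (intro tendsto_intros cf)
  moreover have "\<forall>\<^sub>F z in at a. norm z < 1"
    using a by (intro eventually_at_in_open'[of "ball 0 1" a, simplified])
  then have "\<forall>\<^sub>F z in at a. norm ((f z - f a) / (z - a)) * norm (1 - cnj a * z) \<le> norm (1 - cnj (f a) * f z)"
    using eventually_neq_at_within[of a a UNIV]
  proof eventually_elim
    case (elim z)
    then show ?case using schwarz_pick[OF a, of z] by (simp add: norm_divide field_simps)
  qed
  ultimately have "norm (deriv f a) * norm (1 - cnj a * a) \<le> norm (1 - cnj (f a) * f a)"
    by (intro tendsto_le[OF _ _ _ ]) auto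
  moreover have "norm (1 - cnj w * w) = 1 - (norm w)\<^sup>2" if "norm w < 1" for w
  proof -
    have "1 - cnj w * w = of_real (1 - (norm w)\<^sup>2)"
      by (metis complex_norm_square mult.commute of_real_1 of_real_diff)
    then show ?thesis using one_minus_norm_sq_pos[OF that] by (simp only: norm_of_real)
  qed
  ultimately show ?thesis using a self by simp
qed

end

text \<open>Schwarz-Pick for maps into the right half-plane, via the Cayley transform
  \<open>T\<close> centred at \<open>p a\<close>. In the squared inequality \<open>Re (p z)\<close>
  is at most \<open>norm (p z + cnj (p a))\<close>, so one such factor cancels. The result is linear
  in \<open>Re (p a)\<close>, which lets a approach the boundary.\<close>

lemma Herglotz_pick:
  assumes hol: "p holomorphic_on ball 0 1" and re: "\<And>z. norm z < 1 \<Longrightarrow> Re (p z) \<ge> 0"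
    and a: "norm a < 1" and z: "norm z < 1"
  shows "norm (p a + cnj (p z)) * ((1 - (norm a)\<^sup>2) * (1 - (norm z)\<^sup>2)) \<le> 4 * Re (p a) * (norm (1 - cnj a * z))\<^sup>2"
proof -
  have strict: "norm (p a + cnj (p z)) * ((1 - (norm a)\<^sup>2) * (1 - (norm z)\<^sup>2)) \<le> 4 * Re (p a) * (norm (1 - cnj a * z))\<^sup>2"
    if hol: "p holomorphic_on ball 0 1" and re: "\<And>z. norm z < 1 \<Longrightarrow> Re (p z) > 0" for p
  proof -
    define T where "T = (\<lambda>z. (p z - p a) / (p z + cnj (p a)))"
    have nz: "p w + cnj (p a) \<noteq> 0" if "norm w < 1" for w
    proof -
      have "Re (p w + cnj (p a)) > 0" using re[OF that] re[OF a] by simp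
      then show ?thesis by (metis less_irrefl zero_complex.sel(1))
    qed
    have id: "(norm (p w + cnj (p a)))\<^sup>2 - (norm (p w - p a))\<^sup>2 = 4 * Re (p a) * Re (p w)" for w
      unfolding cmod_power2 by (simp add: power2_eq_square algebra_simps)
    have "norm (T z) * norm (1 - cnj a * z) \<le> norm (z - a)"
    proof (rule Schwarz_at[OF _ _ a _ z])
      show "T holomorphic_on ball 0 1"
        unfolding T_def using nz by (intro holomorphic_intros hol) auto
      show "norm (T w) < 1" if w: "norm w < 1" for w
      proof -
        have "0 < 4 * Re (p a) * Re (p w)" using re[OF a] re[OF w] by simp
        then have "(norm (p w - p a))\<^sup>2 < (norm (p w + cnj (p a)))\<^sup>2" using id[of w] by linarith
        then have "norm (p w - p a) < norm (p w + cnj (p a))" by (rule power_less_imp_less_base) simp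
        then show ?thesis using nz[OF w] by (simp add: T_def norm_divide)
      qed
    qed (simp add: T_def)
    then have "norm (p z - p a) * norm (1 - cnj a * z) \<le> norm (z - a) * norm (p z + cnj (p a))"
      using nz[OF z] by (simp add: T_def norm_divide field_simps)
    then have "(norm (p z - p a) * norm (1 - cnj a * z))\<^sup>2 \<le> (norm (z - a) * norm (p z + cnj (p a)))\<^sup>2"
      by (intro power_mono) auto
    then have "(norm (p z - p a))\<^sup>2 * (norm (1 - cnj a * z))\<^sup>2 \<le> (norm (z - a))\<^sup>2 * (norm (p z + cnj (p a)))\<^sup>2"
      by (simp add: power_mult_distrib)
    moreover have "(norm (p z - p a))\<^sup>2 = (norm (p z + cnj (p a)))\<^sup>2 - 4 * Re (p a) * Re (p z)"
      using id[of z] by simp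
    ultimately have le: "(norm (p z + cnj (p a)))\<^sup>2 * ((1 - (norm a)\<^sup>2) * (1 - (norm z)\<^sup>2))
        \<le> 4 * Re (p a) * Re (p z) * (norm (1 - cnj a * z))\<^sup>2"
      unfolding disc_identity[symmetric] by (simp add: algebra_simps)
    have sym: "norm (p a + cnj (p z)) = norm (p z + cnj (p a))"
      by (metis add.commute complex_cnj_add complex_cnj_cnj complex_mod_cnj)
    define X where "X = norm (p z + cnj (p a))"
    have X: "X > 0" using nz[OF z] by (simp add: X_def)
    have "Re (p z) \<le> X"
      using complex_Re_le_cmod[of "p z + cnj (p a)"] re[OF a] by (simp add: X_def)
    then have "4 * Re (p a) * Re (p z) * (norm (1 - cnj a * z))\<^sup>2 \<le> 4 * Re (p a) * X * (norm (1 - cnj a * z))\<^sup>2"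
      using re[OF a] by (intro mult_right_mono mult_left_mono) auto
    then have "X * (X * ((1 - (norm a)\<^sup>2) * (1 - (norm z)\<^sup>2))) \<le> X * (4 * Re (p a) * (norm (1 - cnj a * z))\<^sup>2)"
      using le unfolding X_def[symmetric] by (simp add: power2_eq_square algebra_simps)
    then show ?thesis using X unfolding sym X_def[symmetric] by simp
  qed
  \<comment> \<open>The Cayley transform needs a strictly positive real part; \<open>p + e\<close>
    has one, and then e tends to 0.\<close>
  have "norm (p a + of_real e + cnj (p z + of_real e)) * ((1 - (norm a)\<^sup>2) * (1 - (norm z)\<^sup>2))
      \<le> 4 * Re (p a + of_real e) * (norm (1 - cnj a * z))\<^sup>2" if "e > 0" for e :: real
    using re that by (intro strict[of "\<lambda>z. p z + of_real e"] holomorphic_intros hol) (auto simp: add_nonneg_pos)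
  then have ev: "\<forall>\<^sub>F e in at_right (0::real). norm (p a + of_real e + cnj (p z + of_real e)) * ((1 - (norm a)\<^sup>2) * (1 - (norm z)\<^sup>2))
      \<le> 4 * Re (p a + of_real e) * (norm (1 - cnj a * z))\<^sup>2"
    by (intro eventually_mono[OF eventually_at_right_less[of "0::real"]])
  have "norm (p a + of_real 0 + cnj (p z + of_real 0)) * ((1 - (norm a)\<^sup>2) * (1 - (norm z)\<^sup>2))
      \<le> 4 * Re (p a + of_real 0) * (norm (1 - cnj a * z))\<^sup>2"
    by (rule tendsto_le[OF _ _ _ ev]) (auto intro!: tendsto_eq_intros)
  then show ?thesis by simp
qed

text \<open>\<open>Herglotz_pick\<close> at \<open>s n\<close>, divided by
  \<open>1 - (norm (s n))^2\<close>, survives the limit. The value q is a cluster point of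
  \<open>p (s n)\<close>; its real part is squeezed to 0, so \<open>norm (q + cnj (p z))\<close>
  equals \<open>norm (p z - q)\<close>. In nontangential regions the conclusion says that
  \<open>p z - q\<close> is of order \<open>norm (b - z)\<close>.\<close>

lemma Herglotz_boundary_value:
  assumes hol: "p holomorphic_on ball 0 1" and re: "\<And>z. norm z < 1 \<Longrightarrow> Re (p z) \<ge> 0"
    and s: "\<And>n. norm (s n) < 1" "s \<longlonglongrightarrow> b" "norm b = 1"
    and C: "\<And>n. Re (p (s n)) \<le> C * (1 - (norm (s n))\<^sup>2)"
  obtains q where "\<And>z. norm z < 1 \<Longrightarrow> norm (p z - q) * (1 - (norm z)\<^sup>2) \<le> 4 * C * (norm (b - z))\<^sup>2"
proof -
  have key: "norm (p (s n) + cnj (p z)) * (1 - (norm z)\<^sup>2) \<le> 4 * C * (norm (1 - cnj (s n) * z))\<^sup>2"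
    if z: "norm z < 1" for n z
  proof -
    define A where "A = 1 - (norm (s n))\<^sup>2"
    have A: "A > 0" using one_minus_norm_sq_pos[OF s(1)] by (simp add: A_def)
    have "norm (p (s n) + cnj (p z)) * (A * (1 - (norm z)\<^sup>2)) \<le> 4 * Re (p (s n)) * (norm (1 - cnj (s n) * z))\<^sup>2"
      unfolding A_def by (rule Herglotz_pick[OF hol re s(1) z])
    also have "\<dots> \<le> 4 * (C * A) * (norm (1 - cnj (s n) * z))\<^sup>2"
      using C[of n] by (intro mult_right_mono mult_left_mono) (auto simp: A_def)
    finally have "A * (norm (p (s n) + cnj (p z)) * (1 - (norm z)\<^sup>2)) \<le> A * (4 * C * (norm (1 - cnj (s n) * z))\<^sup>2)"
      by (simp add: algebra_simps)
    then show ?thesis using A by simp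
  qed
  have "norm (p (s n)) \<le> 4 * C + norm (p 0)" for n
    using key[of 0 n] norm_triangle_ineq4[of "p (s n) + cnj (p 0)" "cnj (p 0)"] by simp
  then have "bounded (range (\<lambda>n. p (s n)))" by (auto simp: bounded_iff)
  then obtain q r where r: "strict_mono (r :: nat \<Rightarrow> nat)" and q: "(\<lambda>n. p (s (r n))) \<longlonglongrightarrow> q"
    using bounded_imp_convergent_subsequence[of "\<lambda>n. p (s n)"] by (auto simp: o_def)
  have sr: "(\<lambda>n. s (r n)) \<longlonglongrightarrow> b" using LIMSEQ_subseq_LIMSEQ[OF s(2) r] by (simp add: o_def)
  have "Re q \<le> C * (1 - (norm b)\<^sup>2)"
    by (rule tendsto_le[of sequentially "\<lambda>n. C * (1 - (norm (s (r n)))\<^sup>2)", OF _ _ tendsto_Re[OF q]])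
       (auto intro!: tendsto_intros sr simp: C)
  moreover have "Re q \<ge> 0"
    by (rule tendsto_lowerbound[OF tendsto_Re[OF q]]) (auto intro: always_eventually re s)
  ultimately have q0: "Re q = 0" using s by simp
  have "norm (p z - q) * (1 - (norm z)\<^sup>2) \<le> 4 * C * (norm (b - z))\<^sup>2" if z: "norm z < 1" for z
  proof -
    have "norm (q + cnj (p z)) * (1 - (norm z)\<^sup>2) \<le> 4 * C * (norm (1 - cnj b * z))\<^sup>2"
      by (rule tendsto_le[of sequentially, OF _ _ _ always_eventually[OF allI, OF key[OF z]]])
         (auto intro!: tendsto_intros sr q)
    moreover have "norm (q + cnj (p z)) = norm (p z - q)"
    proof -
      have "q = - cnj q" using q0 by (simp add: complex_eq_iff)
      then have "norm (p z - q) = norm (cnj (cnj (p z) + q))" by (metis complex_cnj_add complex_cnj_cnj complex_cnj_minus diff_conv_add_uminus minus_minus)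
      then show ?thesis by (simp only: complex_mod_cnj add.commute)
    qed
    ultimately show ?thesis using norm_one_minus_cnj_mult[OF s(3)] by simp
  qed
  then show ?thesis by (rule that)
qed


section \<open>The Julia-Wolff-Caratheodory theorem\<close>

lemma Re_cayley:
  assumes "norm b = 1" "w \<noteq> b"
  shows "Re ((b + w) / (b - w)) = (1 - (norm w)\<^sup>2) / (norm (b - w))\<^sup>2"
proof -
  have "b * cnj b = 1" by (rule unit_mult_cnj[OF assms(1)])
  then have b: "Re b * Re b + Im b * Im b = 1" by (simp add: complex_eq_iff)
  have "Re ((b + w) / (b - w)) = Re ((b + w) * cnj (b - w)) / (norm (b - w))\<^sup>2"
    by (subst complex_div_cnj) (simp only: Re_divide_of_real flip: of_real_power)
  also have "Re ((b + w) * cnj (b - w)) = 1 - (norm w)\<^sup>2"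
    unfolding cmod_power2 using b by (simp add: power2_eq_square algebra_simps)
  finally show ?thesis .
qed

context disc_self_map
begin

text \<open>\<open>Re U\<close> and \<open>Re E\<close> are the Poisson kernels at b of
  \<open>f z\<close> and at y of z, and Julia's inequality reads \<open>Re E \<le> C * Re U\<close>.
  With c the infimum of \<open>Re U / Re E\<close>, the function \<open>g = U - c * E\<close> still
  has nonnegative real part, and near-optimal points for the infimum force \<open>u * g\<close> to
  0. Hence \<open>u * U\<close> tends to \<open>2 * c\<close>; solving for f gives the angular
  derivative, with \<open>\<kappa> = 1 / c\<close>.\<close>

theorem julia_wolff_caratheodory:
  assumes y: "norm y = 1" and a: "\<And>n. norm (a n) < 1" "a \<longlonglongrightarrow> y"
    and C: "\<And>n. 1 - (norm (f (a n)))\<^sup>2 \<le> C * (1 - (norm (a n))\<^sup>2)"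
  obtains b \<kappa> where "norm b = 1" "\<kappa> > 0" "((\<lambda>u. f (y * (1 - u))) \<longlongrightarrow> b) ang"
    "((\<lambda>u. (b - f (y * (1 - u))) / u) \<longlongrightarrow> b * of_real \<kappa>) ang"
    "((\<lambda>u. deriv f (y * (1 - u))) \<longlongrightarrow> b * of_real \<kappa> / y) ang"
proof -
  have "bounded (range (\<lambda>n. f (a n)))"
    using self a by (auto simp: bounded_iff intro!: exI[of _ 1] less_imp_le)
  then obtain b r where r: "strict_mono (r :: nat \<Rightarrow> nat)" and b: "(\<lambda>n. f (a (r n))) \<longlonglongrightarrow> b"
    using bounded_imp_convergent_subsequence[of "\<lambda>n. f (a n)"] by (auto simp: o_def)
  have ar: "(\<lambda>n. a (r n)) \<longlonglongrightarrow> y" using LIMSEQ_subseq_LIMSEQ[OF a(2) r] by (simp add: o_def)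
  have "1 - (norm b)\<^sup>2 \<le> C * (1 - (norm y)\<^sup>2)"
    by (rule tendsto_le[of sequentially "\<lambda>n. C * (1 - (norm (a (r n)))\<^sup>2)" _ "\<lambda>n. 1 - (norm (f (a (r n))))\<^sup>2"])
       (auto intro!: tendsto_intros ar b always_eventually[OF allI, OF C])
  then have "1\<^sup>2 \<le> (norm b)\<^sup>2" using y by simp
  then have "norm b \<ge> 1" by (rule power2_le_imp_le) simp
  moreover have "norm b \<le> 1"
    by (rule tendsto_upperbound[OF tendsto_norm[OF b]]) (auto intro!: always_eventually less_imp_le self a)
  ultimately have nb: "norm b = 1" by simp
  \<comment> \<open>Schwarz-Pick at \<open>a n\<close>: the hypothesis \<open>C\<close> allows the
    factor \<open>1 - (norm (a n))^2\<close> to be cancelled before n tends to infinity.\<close>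
  have julia: "(1 - (norm z)\<^sup>2) * (norm (b - f z))\<^sup>2 \<le> C * ((1 - (norm (f z))\<^sup>2) * (norm (y - z))\<^sup>2)"
    if z: "norm z < 1" for z
  proof -
    have "(1 - (norm z)\<^sup>2) * (norm (1 - cnj (f (a n)) * f z))\<^sup>2
        \<le> C * ((1 - (norm (f z))\<^sup>2) * (norm (1 - cnj (a n) * z))\<^sup>2)" for n
    proof -
      define A where "A = 1 - (norm (a n))\<^sup>2"
      have A: "A > 0" using one_minus_norm_sq_pos[OF a(1)] by (simp add: A_def)
      have "A * ((1 - (norm z)\<^sup>2) * (norm (1 - cnj (f (a n)) * f z))\<^sup>2)
          \<le> (1 - (norm (f (a n)))\<^sup>2) * ((1 - (norm (f z))\<^sup>2) * (norm (1 - cnj (a n) * z))\<^sup>2)"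
        using schwarz_pick_sq[OF a(1) z, of n] unfolding A_def by (simp only: mult.assoc)
      also have "\<dots> \<le> C * A * ((1 - (norm (f z))\<^sup>2) * (norm (1 - cnj (a n) * z))\<^sup>2)"
        using C[of n] one_minus_norm_sq_pos[OF self[OF z]] unfolding A_def by (intro mult_right_mono) auto
      also have "\<dots> = A * (C * ((1 - (norm (f z))\<^sup>2) * (norm (1 - cnj (a n) * z))\<^sup>2))" by simp
      finally show ?thesis using A by simp
    qed
    then have "(1 - (norm z)\<^sup>2) * (norm (1 - cnj b * f z))\<^sup>2
        \<le> C * ((1 - (norm (f z))\<^sup>2) * (norm (1 - cnj y * z))\<^sup>2)"
      by (intro tendsto_le[of sequentially "\<lambda>n. C * ((1 - (norm (f z))\<^sup>2) * (norm (1 - cnj (a (r n)) * z))\<^sup>2)" _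
            "\<lambda>n. (1 - (norm z)\<^sup>2) * (norm (1 - cnj (f (a (r n))) * f z))\<^sup>2"])
         (auto intro!: tendsto_intros ar b)
    then show ?thesis by (simp only: norm_one_minus_cnj_mult y nb)
  qed
  define U where "U = (\<lambda>z. (b + f z) / (b - f z))"
  define E where "E = (\<lambda>z. (y + z) / (y - z))"
  have bf: "f z \<noteq> b" if "norm z < 1" for z using self[OF that] nb by auto
  have yz: "z \<noteq> y" if "norm z < 1" for z using that y by auto
  have ReU: "Re (U z) = (1 - (norm (f z))\<^sup>2) / (norm (b - f z))\<^sup>2" if "norm z < 1" for z
    unfolding U_def by (rule Re_cayley[OF nb bf[OF that]])
  have ReE: "Re (E z) = (1 - (norm z)\<^sup>2) / (norm (y - z))\<^sup>2" if "norm z < 1" for z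
    unfolding E_def by (rule Re_cayley[OF y yz[OF that]])
  have Epos: "Re (E z) > 0" if "norm z < 1" for z
    unfolding ReE[OF that] using one_minus_norm_sq_pos[OF that] yz[OF that] by (intro divide_pos_pos) auto
  have Upos: "Re (U z) > 0" if "norm z < 1" for z
    unfolding ReU[OF that] using one_minus_norm_sq_pos[OF self[OF that]] bf[OF that]
    by (intro divide_pos_pos) auto
  have UE: "Re (E z) \<le> C * Re (U z)" if z: "norm z < 1" for z
    unfolding ReU[OF z] ReE[OF z] using julia[OF z] yz[OF z] bf[OF z] by (simp add: field_simps)
  have C0: "C > 0"
  proof -
    have "0 < C * Re (U 0)" using Epos[of 0] UE[of 0] by simp
    then show ?thesis using Upos[of 0] by (simp add: zero_less_mult_iff)
  qed
  define Q where "Q = (\<lambda>z. Re (U z) / Re (E z))"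
  define c where "c = (INF z\<in>ball 0 1. Q z)"
  have QC: "1 / C \<le> Q z" if "norm z < 1" for z
    unfolding Q_def using UE[OF that] Epos[OF that] C0 by (simp add: field_simps)
  have bdd: "bdd_below (Q ` ball 0 1)" using QC by (auto intro!: bdd_belowI[of _ "1/C"])
  have "1 / C \<le> c" unfolding c_def using QC by (intro cINF_greatest) auto
  then have c0: "c > 0" using C0 by (meson less_le_trans zero_less_divide_1_iff)
  have cQ: "c \<le> Q z" if "norm z < 1" for z
    unfolding c_def using that by (intro cINF_lower bdd) auto
  define g where "g = (\<lambda>z. U z - of_real c * E z)"
  have holg: "g holomorphic_on ball 0 1"
    unfolding g_def U_def E_def using bf yz by (intro holomorphic_intros hol) auto
  have Reg: "Re (g z) = Re (U z) - c * Re (E z)" for z by (simp add: g_def)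
  have reg: "Re (g z) \<ge> 0" if "norm z < 1" for z
    using cQ[OF that] Epos[OF that] unfolding Reg Q_def by (simp add: field_simps)
  have ug: "((\<lambda>u. u * g (y * (1 - u))) \<longlongrightarrow> 0) ang"
    unfolding filterlim_ang_iff
  proof (intro allI impI tendstoI)
    fix M e :: real assume M: "M > 1" and e: "e > 0"
    \<comment> \<open>A point w whose quotient exceeds the infimum by less than \<epsilon> has
      \<open>Re (g w) \<le> \<epsilon> * Re (E w)\<close>. The constant makes
      \<open>M * (4 * \<epsilon> * 2)\<close> equal to \<open>e / 2\<close>, where 2 bounds
      \<open>k u\<close> near 0.\<close>
    define \<epsilon> where "\<epsilon> = e / (16 * M)"
    have \<epsilon>: "\<epsilon> > 0" using e M by (simp add: \<epsilon>_def)
    have "\<exists>z\<in>ball 0 1. Q z < c + \<epsilon>"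
      using cINF_less_iff[OF _ bdd, of "c + \<epsilon>"] \<epsilon> unfolding c_def by auto
    then obtain w where w: "norm w < 1" and Qw: "Q w < c + \<epsilon>" by auto
    have gw: "Re (g w) \<le> \<epsilon> * Re (E w)"
      using Qw Epos[OF w] unfolding Reg Q_def by (simp add: field_simps)
    define k where "k = (\<lambda>u. (norm (1 - cnj w * (y * (1 - u))))\<^sup>2 / (norm (y - w))\<^sup>2)"
    have X: "norm (g w + cnj (g z)) * (1 - (norm z)\<^sup>2) \<le> 4 * \<epsilon> * ((norm (1 - cnj w * z))\<^sup>2 / (norm (y - w))\<^sup>2)"
      if z: "norm z < 1" for z
    proof -
      define A where "A = 1 - (norm w)\<^sup>2"
      have A: "A > 0" using one_minus_norm_sq_pos[OF w] by (simp add: A_def)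
      have "norm (g w + cnj (g z)) * (A * (1 - (norm z)\<^sup>2)) \<le> 4 * Re (g w) * (norm (1 - cnj w * z))\<^sup>2"
        unfolding A_def by (rule Herglotz_pick[OF holg reg w z])
      also have "\<dots> \<le> 4 * (\<epsilon> * Re (E w)) * (norm (1 - cnj w * z))\<^sup>2"
        using gw by (intro mult_right_mono mult_left_mono) auto
      also have "\<dots> = A * (4 * \<epsilon> * ((norm (1 - cnj w * z))\<^sup>2 / (norm (y - w))\<^sup>2))"
        unfolding ReE[OF w] A_def by simp
      finally have "A * (norm (g w + cnj (g z)) * (1 - (norm z)\<^sup>2))
          \<le> A * (4 * \<epsilon> * ((norm (1 - cnj w * z))\<^sup>2 / (norm (y - w))\<^sup>2))" by (simp only: ac_simps)
      then show ?thesis by (rule mult_left_le_imp_le[OF _ A])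
    qed
    have wy: "norm (1 - cnj w * y) = norm (y - w)"
    proof -
      have "norm (1 - cnj w * y) = norm (cnj (1 - cnj y * w))" by (simp add: mult.commute)
      also have "\<dots> = norm (y - w)" unfolding complex_mod_cnj by (rule norm_one_minus_cnj_mult[OF y])
      finally show ?thesis .
    qed
    have "((\<lambda>u. k u) \<longlongrightarrow> (norm (1 - cnj w * (y * (1 - 0))))\<^sup>2 / (norm (y - w))\<^sup>2) ang"
      unfolding k_def using yz[OF w] by (intro tendsto_intros ang_tendsto_0) auto
    then have "(k \<longlongrightarrow> 1) ang" using wy yz[OF w] by simp
    then have k2: "eventually (\<lambda>u. k u < 2) ang" by (rule order_tendstoD) simp
    have "((\<lambda>u. norm u * norm (g w)) \<longlongrightarrow> norm (0::complex) * norm (g w)) ang"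
      by (intro tendsto_intros ang_tendsto_0)
    then have small: "eventually (\<lambda>u. norm u * norm (g w) < e / 2) ang"
      by (rule order_tendstoD) (use e in simp)
    have "eventually (\<lambda>u. (k u < 2 \<and> norm u * norm (g w) < e / 2) \<and> (norm u < 1/M \<and> u \<in> cap 1)) ang"
      by (intro eventually_conj k2 small eventually_ang_norm eventually_ang_cap) (use M in auto)
    then have "eventually (\<lambda>u. (k u < 2 \<and> norm u * norm (g w) < e / 2) \<and> (norm u < 1/M \<and> u \<in> cap 1)) (at 0 within sector M)"
      using M unfolding eventually_ang by blast
    moreover have "eventually (\<lambda>u. u \<in> sector M) (at 0 within sector M)"
      unfolding eventually_at by (auto intro: exI[of _ 1])
    ultimately show "eventually (\<lambda>u. dist (u * g (y * (1 - u))) 0 < e) (at 0 within sector M)"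
    proof eventually_elim
      case (elim u)
      define z where "z = y * (1 - u)"
      have z: "norm z < 1" using elim y by (auto simp: z_def norm_mult cap_def dist_norm)
      have nu: "norm u < M * Re u" using elim by (simp add: sector_def)
      have "norm u * norm u \<le> (1/M) * (M * Re u)"
        using nu elim M by (intro mult_mono) auto
      then have "(norm u)\<^sup>2 \<le> Re u" using M by (simp add: power2_eq_square)
      moreover have "(norm z)\<^sup>2 = 1 - 2 * Re u + (norm u)\<^sup>2"
        using y by (simp add: z_def norm_mult norm_one_minus_sq)
      ultimately have "Re u \<le> 1 - (norm z)\<^sup>2" by linarith
      then have "M * Re u \<le> M * (1 - (norm z)\<^sup>2)" using M by simp
      then have 1: "norm u \<le> M * (1 - (norm z)\<^sup>2)" using nu by linarith
      define X where "X = norm (g w + cnj (g z))"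
      have "norm u * X \<le> M * (1 - (norm z)\<^sup>2) * X" using 1 by (intro mult_right_mono) (auto simp: X_def)
      also have "\<dots> = M * (X * (1 - (norm z)\<^sup>2))" by simp
      also have "\<dots> \<le> M * (4 * \<epsilon> * k u)"
        using X[OF z] M unfolding X_def k_def z_def by (intro mult_left_mono) auto
      also have "\<dots> \<le> M * (4 * \<epsilon> * 2)" using elim \<epsilon> M by (intro mult_left_mono) auto
      also have "\<dots> = e / 2" using M by (simp add: \<epsilon>_def)
      finally have 2: "norm u * X \<le> e / 2" .
      have "norm (g z) \<le> X + norm (g w)"
        using norm_triangle_ineq4[of "g w + cnj (g z)" "g w"] by (simp add: X_def)
      then have "norm u * norm (g z) \<le> norm u * (X + norm (g w))" by (intro mult_left_mono) auto
      also have "\<dots> < e" using 2 elim by (simp add: distrib_left)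
      finally show ?case by (simp add: norm_mult z_def)
    qed
  qed
  have zin: "norm (y * (1 - u)) < 1" if "u \<in> cap 1" for u
    using that y by (auto simp: norm_mult cap_def dist_norm)
  have y0: "y \<noteq> 0" using y by auto
  have "((\<lambda>u. of_real c * (2 - u) + u * g (y * (1 - u))) \<longlongrightarrow> of_real c * (2 - 0) + 0) ang"
    by (intro tendsto_intros ug ang_tendsto_0)
  then have uU: "((\<lambda>u. u * U (y * (1 - u))) \<longlongrightarrow> of_real (2 * c)) ang"
  proof (rule ang_cong[where \<rho> = 1])
    fix u :: complex assume u: "u \<in> cap 1"
    have "u \<noteq> 0" by (rule cap_nonzero[OF u])
    then have "u * E (y * (1 - u)) = 2 - u" using y0 by (simp add: E_def field_simps)
    moreover have "u * U (y * (1 - u)) = of_real c * (u * E (y * (1 - u))) + u * g (y * (1 - u))"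
      by (simp add: g_def algebra_simps)
    ultimately show "of_real c * (2 - u) + u * g (y * (1 - u)) = u * U (y * (1 - u))" by simp
  qed auto
  \<comment> \<open>Solves \<open>U = (b + f) / (b - f)\<close> for \<open>b - f\<close>.\<close>
  have eqb: "(b - f (y * (1 - u))) / u = (b + f (y * (1 - u))) / (u * U (y * (1 - u)))"
    if u: "u \<in> cap 1" for u
  proof -
    have "b - f (y * (1-u)) \<noteq> 0" using bf[OF zin[OF u]] by simp
    moreover have "U (y * (1-u)) \<noteq> 0" using Upos[OF zin[OF u]] by (metis less_irrefl zero_complex.sel(1))
    moreover have "u \<noteq> 0" by (rule cap_nonzero[OF u])
    moreover have "d / u = n / (u * (n / d))" if "d \<noteq> 0" "n / d \<noteq> 0" "u \<noteq> 0" for d n :: complex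
      using that by (simp add: field_simps)
    ultimately show ?thesis unfolding U_def by blast
  qed
  have f_b: "((\<lambda>u. f (y * (1 - u))) \<longlongrightarrow> b) ang"
  proof -
    have "((\<lambda>u. 2 * norm u / norm (u * U (y * (1 - u)))) \<longlongrightarrow> 2 * norm (0::complex) / norm (complex_of_real (2 * c))) ang"
      using c0 by (intro tendsto_intros ang_tendsto_0 uU) auto
    then have l: "((\<lambda>u. 2 * norm u / norm (u * U (y * (1 - u)))) \<longlongrightarrow> 0) ang" by simp
    have "((\<lambda>u. b - f (y * (1 - u))) \<longlongrightarrow> 0) ang"
    proof (rule Lim_null_comparison[OF _ l], rule eventually_mono[OF eventually_ang_cap[of 1]])
      fix u assume u: "u \<in> cap 1"
      have "norm (b - f (y * (1 - u))) = norm (u * ((b - f (y * (1 - u))) / u))"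
        using cap_nonzero[OF u] by simp
      also have "\<dots> = norm u * norm (b + f (y * (1 - u))) / norm (u * U (y * (1 - u)))"
        unfolding eqb[OF u] by (simp add: norm_mult norm_divide)
      also have "\<dots> \<le> norm u * 2 / norm (u * U (y * (1 - u)))"
        using norm_triangle_ineq[of b "f (y * (1-u))"] self[OF zin[OF u]] nb
        by (intro divide_right_mono mult_left_mono) auto
      finally show "norm (b - f (y * (1 - u))) \<le> 2 * norm u / norm (u * U (y * (1 - u)))"
        by (simp add: mult.commute)
    qed simp
    from tendsto_diff[OF tendsto_const[of b] this] show ?thesis by simp
  qed
  have "((\<lambda>u. (b + f (y * (1 - u))) / (u * U (y * (1 - u)))) \<longlongrightarrow> (b + b) / of_real (2 * c)) ang"
    using c0 by (intro tendsto_intros f_b uU) auto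
  then have q: "((\<lambda>u. (b - f (y * (1 - u))) / u) \<longlongrightarrow> b / of_real c) ang"
    by (rule ang_cong[where \<rho> = 1]) (auto simp: eqb)
  define q where "q = (\<lambda>u. (b - f (y * (1 - u))) / u)"
  have fc: "(\<lambda>u. f (y * (1 - u))) holomorphic_on cap 1"
  proof -
    have "(f \<circ> (\<lambda>u. y * (1 - u))) holomorphic_on cap 1"
      using zin by (intro holomorphic_on_compose_gen[OF _ hol] holomorphic_intros) auto
    then show ?thesis by (simp add: o_def)
  qed
  have holq: "q holomorphic_on cap 1"
    unfolding q_def using cap_nonzero by (intro holomorphic_intros fc) auto
  have dq: "((\<lambda>u. deriv q u * u) \<longlongrightarrow> 0) ang"
    by (rule tendsto_deriv_times_ang[OF holq _ q[folded q_def]]) simp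
  \<comment> \<open>Writing \<open>f = b - u * q\<close> expresses the derivative of f through
    \<open>q + u * q'\<close>, and \<open>u * q'\<close> tends to 0 by the Cauchy estimate.\<close>
  have "((\<lambda>u. (q u + deriv q u * u) / y) \<longlongrightarrow> (b / of_real c + 0) / y) ang"
    by (intro tendsto_intros q[folded q_def] dq) (use y0 in auto)
  then have df: "((\<lambda>u. deriv f (y * (1 - u))) \<longlongrightarrow> (b / of_real c) / y) ang"
  proof (rule ang_cong[where \<rho> = 1])
    fix u :: complex assume u: "u \<in> cap 1"
    have 1: "((\<lambda>u. f (y * (1 - u))) has_field_derivative deriv f (y * (1-u)) * (- y)) (at u)"
      by (rule DERIV_chain2[where f = f and g = "\<lambda>u. y * (1 - u)"])
        (use zin[OF u] in \<open>auto intro!: holomorphic_derivI[OF hol] derivative_eq_intros\<close>)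
    have "((\<lambda>u. b - u * q u) has_field_derivative - (q u + deriv q u * u)) (at u)"
      using holomorphic_derivI[OF holq cap_open u] by (auto intro!: derivative_eq_intros)
    then have "((\<lambda>u. f (y * (1 - u))) has_field_derivative - (q u + deriv q u * u)) (at u)"
      by (rule has_field_derivative_transform_within_open[OF _ cap_open u])
         (use cap_nonzero in \<open>auto simp: q_def\<close>)
    from DERIV_unique[OF 1 this] show "(q u + deriv q u * u) / y = deriv f (y * (1 - u))"
      using y0 by (simp add: field_simps)
  qed auto
  have "b / of_real c = b * of_real (1 / c)" by (simp add: divide_inverse)
  then show ?thesis using that[OF nb _ f_b, of "1 / c"] q df c0 by simp
qed

end


section \<open>Semigroups and their generators\<close>

text \<open>One formula for two uses: \<open>a = 1\<close>, \<open>b = -1\<close> gives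
  \<open>ln (1 - (norm w)^2)\<close>, and \<open>a = 0\<close>, \<open>b = 1\<close> the logarithm
  of a squared modulus.\<close>

lemma DERIV_ln_sum_squares:
  fixes X Y :: "real \<Rightarrow> real"
  assumes "(X has_real_derivative X') (at t within S)" "(Y has_real_derivative Y') (at t within S)"
    and "a + b * ((X t)\<^sup>2 + (Y t)\<^sup>2) > 0"
  shows "((\<lambda>s. ln (a + b * ((X s)\<^sup>2 + (Y s)\<^sup>2))) has_real_derivative
    (b * (2 * X t * X' + 2 * Y t * Y')) / (a + b * ((X t)\<^sup>2 + (Y t)\<^sup>2))) (at t within S)"
  using assms(3) by (auto intro!: derivative_eq_intros assms(1,2) simp: field_simps)

locale disc_semigroup =
  fixes \<phi> :: "real \<Rightarrow> complex \<Rightarrow> complex" and G h :: "complex \<Rightarrow> complex" and \<tau> :: complex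
  assumes sg: "semigroup_disc \<phi>" and noaut: "no_automorphism \<phi>"
    and gen: "is_generator \<phi> G" and dw: "dw_point \<phi> \<tau>" and kh: "koenigs \<phi> G \<tau> h"
begin

lemma self_map: "t \<ge> 0 \<Longrightarrow> disc_self_map (\<phi> t)"
  using sg unfolding semigroup_disc_def disc_self_map_def by (auto simp: image_subset_iff)

lemma phi_norm: "t \<ge> 0 \<Longrightarrow> norm z < 1 \<Longrightarrow> norm (\<phi> t z) < 1"
  using disc_self_map.self[OF self_map] .

lemma phi_hol: "t \<ge> 0 \<Longrightarrow> \<phi> t holomorphic_on ball 0 1"
  using disc_self_map.hol[OF self_map] .

lemma phi_0: "norm z < 1 \<Longrightarrow> \<phi> 0 z = z"
  using sg by (auto simp: semigroup_disc_def)

lemma phi_add: "s \<ge> 0 \<Longrightarrow> t \<ge> 0 \<Longrightarrow> norm z < 1 \<Longrightarrow> \<phi> (s + t) z = \<phi> s (\<phi> t z)"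
  using sg by (auto simp: semigroup_disc_def)

lemma G_hol: "G holomorphic_on ball 0 1"
  using gen by (auto simp: is_generator_def)

lemma phi_vderiv:
  "t \<ge> 0 \<Longrightarrow> norm z < 1 \<Longrightarrow> ((\<lambda>s. \<phi> s z) has_vector_derivative G (\<phi> t z)) (at t within {0..})"
  using gen by (auto simp: is_generator_def)

lemma h_hol: "h holomorphic_on ball 0 1" and h_inj: "inj_on h (ball 0 1)"
  using kh by (auto simp: koenigs_def)

lemma h_phi_elliptic: "norm \<tau> < 1 \<Longrightarrow> t \<ge> 0 \<Longrightarrow> norm z < 1 \<Longrightarrow> h (\<phi> t z) = exp (deriv G \<tau> * of_real t) * h z"
  and h_tau: "norm \<tau> < 1 \<Longrightarrow> h \<tau> = 0"
  using kh by (auto simp: koenigs_def)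

lemma h_phi_nonelliptic: "\<not> norm \<tau> < 1 \<Longrightarrow> t \<ge> 0 \<Longrightarrow> norm z < 1 \<Longrightarrow> h (\<phi> t z) = h z + of_real t"
  using kh by (auto simp: koenigs_def)

lemma norm_tau: "norm \<tau> \<le> 1"
  using dw by (auto simp: dw_point_def)

lemma curve_deriv:
  assumes "f holomorphic_on ball 0 1" "norm z < 1"
  shows "((\<lambda>s. f (\<phi> s z)) has_vector_derivative deriv f z * G z) (at 0 within {0..})"
proof -
  have "(f has_field_derivative deriv f z) (at (\<phi> 0 z))"
    using assms phi_0 by (auto intro: holomorphic_derivI)
  then have "(f has_field_derivative deriv f z) (at (\<phi> 0 z) within (\<lambda>s. \<phi> s z) ` {0..})"
    by (rule has_field_derivative_at_within)
  from field_vector_diff_chain_within[OF phi_vderiv[OF order_refl assms(2)] this]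
  show ?thesis using phi_0[OF assms(2)] by (simp add: o_def mult.commute)
qed

lemma curve_deriv_unique:
  "(f has_vector_derivative (a::complex)) (at 0 within {0::real..}) \<Longrightarrow>
   (f has_vector_derivative b) (at 0 within {0..}) \<Longrightarrow> a = b"
  by (rule vector_derivative_unique_within[of 0 "{0..}"])
     (simp_all add: at_within_Ici_at_right)

text \<open>The identity between \<open>\<phi> t \<circ> \<phi> s\<close> and
  \<open>\<phi> s \<circ> \<phi> t\<close>, differentiated in s at 0.\<close>

lemma G_phi:
  assumes "t \<ge> 0" "norm z < 1"
  shows "deriv (\<phi> t) z * G z = G (\<phi> t z)"
proof (rule curve_deriv_unique)
  show "((\<lambda>s. \<phi> t (\<phi> s z)) has_vector_derivative deriv (\<phi> t) z * G z) (at 0 within {0..})"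
    by (rule curve_deriv[OF phi_hol[OF assms(1)] assms(2)])
  have "((\<lambda>s. \<phi> s (\<phi> t z)) has_vector_derivative G (\<phi> t z)) (at 0 within {0..})"
    using phi_vderiv[of 0 "\<phi> t z"] phi_0 phi_norm assms by simp
  then show "((\<lambda>s. \<phi> t (\<phi> s z)) has_vector_derivative G (\<phi> t z)) (at 0 within {0..})"
    by (rule has_vector_derivative_transform[rotated 2])
       (use phi_add[of _ t z] phi_add[of t _ z] assms in \<open>auto simp: add.commute\<close>)
qed

lemma h_G_nonelliptic:
  assumes "\<not> norm \<tau> < 1" "norm z < 1"
  shows "deriv h z * G z = 1"
proof (rule curve_deriv_unique)
  show "((\<lambda>s. h (\<phi> s z)) has_vector_derivative deriv h z * G z) (at 0 within {0..})"
    by (rule curve_deriv[OF h_hol assms(2)])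
  have "((\<lambda>s. h z + s) has_field_derivative 1) (at (complex_of_real 0))"
    by (auto intro!: derivative_eq_intros)
  from has_vector_derivative_real_field[OF this]
  have "((\<lambda>s. h z + complex_of_real s) has_vector_derivative 1) (at 0 within {0..})" .
  then show "((\<lambda>s. h (\<phi> s z)) has_vector_derivative 1) (at 0 within {0..})"
    by (rule has_vector_derivative_transform[rotated 2]) (use h_phi_nonelliptic assms in auto)
qed

lemma h_G_elliptic:
  assumes "norm \<tau> < 1" "norm z < 1"
  shows "deriv h z * G z = deriv G \<tau> * h z"
proof (rule curve_deriv_unique)
  show "((\<lambda>s. h (\<phi> s z)) has_vector_derivative deriv h z * G z) (at 0 within {0..})"
    by (rule curve_deriv[OF h_hol assms(2)])
  have "((\<lambda>s. exp (deriv G \<tau> * s) * h z) has_field_derivative deriv G \<tau> * h z) (at (complex_of_real 0))"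
    by (auto intro!: derivative_eq_intros)
  from has_vector_derivative_real_field[OF this]
  have "((\<lambda>s. exp (deriv G \<tau> * complex_of_real s) * h z) has_vector_derivative deriv G \<tau> * h z) (at 0 within {0..})" .
  then show "((\<lambda>s. h (\<phi> s z)) has_vector_derivative deriv G \<tau> * h z) (at 0 within {0..})"
    by (rule has_vector_derivative_transform[rotated 2]) (use h_phi_elliptic assms in auto)
qed

text \<open>With multiplier \<open>exp 0 = 1\<close>, injectivity of h would make
  \<open>\<phi> 1\<close> the identity, which is an automorphism.\<close>

lemma lambda_nz: "norm \<tau> < 1 \<Longrightarrow> deriv G \<tau> \<noteq> 0"
proof
  assume a: "norm \<tau> < 1" "deriv G \<tau> = 0"
  have "\<phi> 1 z = z" if z: "norm z < 1" for z
    by (rule inj_onD[OF h_inj]) (use h_phi_elliptic[OF a(1), of 1 z] a(2) z phi_norm[of 1 z] in simp_all)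
  then have "bij_betw (\<phi> 1) (ball 0 1) (ball 0 1)"
    by (intro bij_betwI[of _ _ _ id]) auto
  then show False using noaut by (auto simp: no_automorphism_def)
qed

lemma h_deriv_nz: "norm z < 1 \<Longrightarrow> deriv h z \<noteq> 0"
  by (rule holomorphic_injective_imp_regular[OF h_hol _ h_inj]) auto

lemma phi_inj: "t \<ge> 0 \<Longrightarrow> inj_on (\<phi> t) (ball 0 1)"
proof (rule inj_onI)
  fix z w assume a: "t \<ge> 0" "z \<in> ball 0 1" "w \<in> ball 0 1" "\<phi> t z = \<phi> t w"
  have "h z = h w"
  proof (cases "norm \<tau> < 1")
    case True
    then show ?thesis using h_phi_elliptic[OF True a(1), of z] h_phi_elliptic[OF True a(1), of w] a by simp
  next
    case False
    then show ?thesis using h_phi_nonelliptic[OF False a(1), of z] h_phi_nonelliptic[OF False a(1), of w] a by simp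
  qed
  then show "z = w" using inj_onD[OF h_inj] a by blast
qed

lemma phi_tau: "norm \<tau> < 1 \<Longrightarrow> t \<ge> 0 \<Longrightarrow> \<phi> t \<tau> = \<tau>"
  by (rule inj_onD[OF h_inj]) (use h_phi_elliptic[of t \<tau>] h_tau phi_norm[of t \<tau>] in simp_all)

lemma G_nz: "norm z < 1 \<Longrightarrow> z \<noteq> \<tau> \<Longrightarrow> G z \<noteq> 0"
proof
  assume a: "norm z < 1" "z \<noteq> \<tau>" "G z = 0"
  show False
  proof (cases "norm \<tau> < 1")
    case True
    then have "h z = h \<tau>" using h_G_elliptic[OF True a(1)] lambda_nz h_tau a by simp
    then show False using inj_onD[OF h_inj] a True by auto
  qed (use h_G_nonelliptic[of z] a in simp)
qed

lemma G_tau: "norm \<tau> < 1 \<Longrightarrow> G \<tau> = 0"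
  using h_G_elliptic[of \<tau>] h_deriv_nz[of \<tau>] h_tau by simp

subsection \<open>Wolff's lemma and the Berkson-Porta representation\<close>

text \<open>For \<tau> on the unit circle the level sets of Q are the horocycles at \<tau>; otherwise they are
  hyperbolic circles around \<tau>.\<close>

definition Q :: "complex \<Rightarrow> real" where "Q z = (1 - (norm z)\<^sup>2) / (norm (1 - cnj \<tau> * z))\<^sup>2"

lemma tau_factor_nz: "norm z < 1 \<Longrightarrow> 1 - cnj \<tau> * z \<noteq> 0"
proof
  assume a: "norm z < 1" "1 - cnj \<tau> * z = 0"
  then have "norm (cnj \<tau> * z) = 1" by (metis eq_iff_diff_eq_0 norm_one)
  moreover have "norm \<tau> * norm z \<le> 1 * norm z" using norm_tau by (intro mult_right_mono) auto
  ultimately show False using a by (simp add: norm_mult)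
qed

lemma Q_pos: "norm z < 1 \<Longrightarrow> Q z > 0"
  unfolding Q_def using tau_factor_nz one_minus_norm_sq_pos by simp

text \<open>Wolff's lemma. For \<tau> in the disc it is Schwarz-Pick at the fixed point \<tau>. For
  \<tau> on the circle, Schwarz-Pick is applied at points of an orbit of 0, which tends to \<tau>,
  along indices where one step does not increase the boundary distance.\<close>

lemma Q_mono:
  assumes t: "t \<ge> 0" and z: "norm z < 1"
  shows "Q z \<le> Q (\<phi> t z)"
proof -
  interpret disc_self_map "\<phi> t" by (rule self_map[OF t])
  have key: "(1 - (norm z)\<^sup>2) * (norm (1 - cnj \<tau> * \<phi> t z))\<^sup>2 \<le> (1 - (norm (\<phi> t z))\<^sup>2) * (norm (1 - cnj \<tau> * z))\<^sup>2"
  proof (cases "norm \<tau> < 1")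
    case True
    have pos: "1 - (norm \<tau>)\<^sup>2 > 0" by (rule one_minus_norm_sq_pos[OF True])
    have "(1 - (norm \<tau>)\<^sup>2) * ((1 - (norm z)\<^sup>2) * (norm (1 - cnj \<tau> * \<phi> t z))\<^sup>2)
        \<le> (1 - (norm \<tau>)\<^sup>2) * ((1 - (norm (\<phi> t z))\<^sup>2) * (norm (1 - cnj \<tau> * z))\<^sup>2)"
      using schwarz_pick_sq[OF True z] phi_tau[OF True t] by (simp only: mult.assoc)
    then show ?thesis by (rule mult_left_le_imp_le[OF _ pos])
  next
    case False
    then have nt: "norm \<tau> = 1" using norm_tau by simp
    show ?thesis
    proof (cases "t = 0")
      case True
      then show ?thesis using phi_0 z by simp
    next
      case False
      then have t0: "t > 0" using t by simp
      define a where "a = (\<lambda>n::nat. \<phi> (real n * t) 0)"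
      have a1: "norm (a n) < 1" for n unfolding a_def using t by (intro phi_norm) auto
      have aS: "a (Suc n) = \<phi> t (a n)" for n
        unfolding a_def using t phi_add[of t "real n * t" 0] by (simp add: algebra_simps)
      have "uniform_limit {0} \<phi> (\<lambda>_. \<tau>) at_top"
        by (rule dw[unfolded dw_point_def, THEN conjunct2, rule_format]) simp
      then have "((\<lambda>s. \<phi> s 0) \<longlongrightarrow> \<tau>) at_top" by (rule tendsto_uniform_limitI) simp
      moreover have "filterlim (\<lambda>n::nat. real n * t) at_top sequentially"
        using filterlim_tendsto_pos_mult_at_top[OF tendsto_const[of t] t0 filterlim_real_sequentially]
        by (simp add: mult.commute)
      ultimately have at: "a \<longlonglongrightarrow> \<tau>" unfolding a_def by (rule filterlim_compose)
      define d where "d = (\<lambda>n. 1 - (norm (a n))\<^sup>2)"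
      have d0: "d n > 0" for n unfolding d_def by (rule one_minus_norm_sq_pos[OF a1])
      have dl: "d \<longlonglongrightarrow> 0"
      proof -
        have "(\<lambda>n. 1 - (norm (a n))\<^sup>2) \<longlonglongrightarrow> 1 - (norm \<tau>)\<^sup>2" by (intro tendsto_intros at)
        then show ?thesis using nt by (simp add: d_def)
      qed
      \<comment> \<open>A positive sequence that tends to 0 cannot increase from some index
        on.\<close>
      have "\<exists>n\<ge>N. d (Suc n) \<le> d n" for N
      proof (rule ccontr)
        assume "\<not> ?thesis"
        then have inc: "d n \<le> d (Suc n)" if "n \<ge> N" for n using that by force
        have "d N \<le> d n" if "N \<le> n" for n
          using that
        proof (induction rule: dec_induct)
          case (step n)
          then show ?case using inc[of n] by simp
        qed simp
        then have "d N \<le> 0" by (intro tendsto_lowerbound[OF dl]) (auto simp: eventually_sequentially)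
        then show False using d0[of N] by simp
      qed
      then obtain k where k: "\<And>N. k N \<ge> N" "\<And>N. d (Suc (k N)) \<le> d (k N)" by metis
      have kt: "filterlim k at_top sequentially"
        by (rule filterlim_at_top_mono[OF filterlim_ident]) (use k in auto)
      have l1: "(\<lambda>N. a (k N)) \<longlonglongrightarrow> \<tau>" by (rule filterlim_compose[OF at kt])
      have l2: "(\<lambda>N. a (Suc (k N))) \<longlonglongrightarrow> \<tau>"
        by (rule filterlim_compose[OF at filterlim_compose[OF filterlim_Suc kt]])
      have ineq: "(1 - (norm z)\<^sup>2) * (norm (1 - cnj (a (Suc (k N))) * \<phi> t z))\<^sup>2
          \<le> (1 - (norm (\<phi> t z))\<^sup>2) * (norm (1 - cnj (a (k N)) * z))\<^sup>2" for N
      proof -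
        have "d (k N) * ((1 - (norm z)\<^sup>2) * (norm (1 - cnj (a (Suc (k N))) * \<phi> t z))\<^sup>2)
            \<le> d (Suc (k N)) * ((1 - (norm (\<phi> t z))\<^sup>2) * (norm (1 - cnj (a (k N)) * z))\<^sup>2)"
          using schwarz_pick_sq[OF a1[of "k N"] z] unfolding d_def aS by (simp only: mult.assoc)
        also have "\<dots> \<le> d (k N) * ((1 - (norm (\<phi> t z))\<^sup>2) * (norm (1 - cnj (a (k N)) * z))\<^sup>2)"
          using k(2)[of N] one_minus_norm_sq_pos[OF self[OF z]] by (intro mult_right_mono) auto
        finally show ?thesis by (rule mult_left_le_imp_le[OF _ d0])
      qed
      show ?thesis
        by (rule tendsto_le[of sequentially "\<lambda>N. (1 - (norm (\<phi> t z))\<^sup>2) * (norm (1 - cnj (a (k N)) * z))\<^sup>2" _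
              "\<lambda>N. (1 - (norm z)\<^sup>2) * (norm (1 - cnj (a (Suc (k N))) * \<phi> t z))\<^sup>2"])
           (auto intro!: tendsto_intros l1 l2 always_eventually[OF allI, OF ineq])
    qed
  qed
  then show ?thesis
    unfolding Q_def using tau_factor_nz[OF z] tau_factor_nz[OF self[OF z]] by (simp add: field_simps)
qed

text \<open>Half the logarithmic derivative of Q along the semigroup, see ln_Q_deriv.\<close>

definition m :: "complex \<Rightarrow> real" where
  "m z = Re (G z * cnj (\<tau> - z) / (of_real (1 - (norm z)\<^sup>2) * (1 - cnj \<tau> * z)))"

lemma Re_Im_deriv:
  assumes "t \<ge> 0" "norm z < 1"
  shows "((\<lambda>s. Re (\<phi> s z)) has_real_derivative Re (G (\<phi> t z))) (at t within {0..})"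
    "((\<lambda>s. Im (\<phi> s z)) has_real_derivative Im (G (\<phi> t z))) (at t within {0..})"
  unfolding has_real_derivative_iff_has_vector_derivative
  using bounded_linear.has_vector_derivative[OF bounded_linear_Re phi_vderiv[OF assms]]
    bounded_linear.has_vector_derivative[OF bounded_linear_Im phi_vderiv[OF assms]] by auto

lemma ln_one_minus_deriv:
  assumes "t \<ge> 0" "norm z < 1"
  shows "((\<lambda>s. ln (1 - (norm (\<phi> s z))\<^sup>2)) has_real_derivative
     - 2 * Re (cnj (\<phi> t z) * G (\<phi> t z)) / (1 - (norm (\<phi> t z))\<^sup>2)) (at t within {0..})"
proof -
  have pos: "1 + (-1) * ((Re (\<phi> t z))\<^sup>2 + (Im (\<phi> t z))\<^sup>2) > 0"
    using one_minus_norm_sq_pos[OF phi_norm[OF assms]] by (simp add: cmod_power2)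
  show ?thesis
    using DERIV_ln_sum_squares[OF Re_Im_deriv[OF assms] pos]
    unfolding cmod_power2 by (simp add: algebra_simps)
qed

lemma ln_Q_deriv:
  assumes "t \<ge> 0" "norm z < 1"
  shows "((\<lambda>s. ln (Q (\<phi> s z))) has_real_derivative 2 * m (\<phi> t z)) (at t within {0..})"
proof -
  define w where "w = \<phi> t z"
  define g where "g = G w"
  define A where "A = 1 - (norm w)\<^sup>2"
  define B where "B = (norm (1 - cnj \<tau> * w))\<^sup>2"
  have w1: "norm w < 1" unfolding w_def by (rule phi_norm[OF assms])
  have A: "A > 0" unfolding A_def by (rule one_minus_norm_sq_pos[OF w1])
  have B: "B > 0" unfolding B_def using tau_factor_nz[OF w1] by simp
  \<comment> \<open>Splits \<open>1 - cnj \<tau> * w\<close> into real and imaginary part. Both are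
    real-affine in w, so the formula for logarithms of sums of squares applies.\<close>
  have B': "(1 - (Re \<tau> * Re w + Im \<tau> * Im w))\<^sup>2 + (Re \<tau> * Im w - Im \<tau> * Re w)\<^sup>2 = B"
    unfolding B_def cmod_power2 by (simp add: power2_eq_square algebra_simps)
  have "((\<lambda>s. ln (1 - (norm (\<phi> s z))\<^sup>2) - ln ((1 - (Re \<tau> * Re (\<phi> s z) + Im \<tau> * Im (\<phi> s z)))\<^sup>2
      + (Re \<tau> * Im (\<phi> s z) - Im \<tau> * Re (\<phi> s z))\<^sup>2)) has_real_derivative
     - 2 * Re (cnj w * g) / A - 2 * Re (cnj (1 - cnj \<tau> * w) * (- cnj \<tau> * g)) / B) (at t within {0..})"
    unfolding A_def w_def g_def
  proof (rule DERIV_diff[OF ln_one_minus_deriv[OF assms]])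
    show "((\<lambda>s. ln ((1 - (Re \<tau> * Re (\<phi> s z) + Im \<tau> * Im (\<phi> s z)))\<^sup>2
        + (Re \<tau> * Im (\<phi> s z) - Im \<tau> * Re (\<phi> s z))\<^sup>2)) has_real_derivative
       2 * Re (cnj (1 - cnj \<tau> * \<phi> t z) * (- cnj \<tau> * G (\<phi> t z))) / B) (at t within {0..})"
    proof -
      have 1: "((\<lambda>s. 1 - (Re \<tau> * Re (\<phi> s z) + Im \<tau> * Im (\<phi> s z))) has_real_derivative
          0 - (Re \<tau> * Re g + Im \<tau> * Im g)) (at t within {0..})"
        unfolding g_def w_def by (intro DERIV_diff DERIV_add DERIV_cmult Re_Im_deriv assms DERIV_const)
      have 2: "((\<lambda>s. Re \<tau> * Im (\<phi> s z) - Im \<tau> * Re (\<phi> s z)) has_real_derivative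
          Re \<tau> * Im g - Im \<tau> * Re g) (at t within {0..})"
        unfolding g_def w_def by (intro DERIV_diff DERIV_add DERIV_cmult Re_Im_deriv assms)
      have 3: "0 + 1 * ((1 - (Re \<tau> * Re (\<phi> t z) + Im \<tau> * Im (\<phi> t z)))\<^sup>2
          + (Re \<tau> * Im (\<phi> t z) - Im \<tau> * Re (\<phi> t z))\<^sup>2) > 0"
        using B B' by (simp add: w_def)
      have 4: "1 * (2 * (1 - (Re \<tau> * Re w + Im \<tau> * Im w)) * (0 - (Re \<tau> * Re g + Im \<tau> * Im g))
          + 2 * (Re \<tau> * Im w - Im \<tau> * Re w) * (Re \<tau> * Im g - Im \<tau> * Re g))
          = 2 * Re (cnj (1 - cnj \<tau> * w) * (- cnj \<tau> * g))"
        by (simp add: algebra_simps)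
      show ?thesis
        using DERIV_ln_sum_squares[OF 1 2 3] B' 4 unfolding w_def[symmetric] g_def[symmetric]
        by (simp only: add_0_left mult_1)
    qed
  qed
  moreover have "- 2 * Re (cnj w * g) / A - 2 * Re (cnj (1 - cnj \<tau> * w) * (- cnj \<tau> * g)) / B = 2 * m w"
  proof -
    have B2: "complex_of_real B = (1 - cnj \<tau> * w) * cnj (1 - cnj \<tau> * w)"
      unfolding B_def by (rule complex_norm_square)
    have "g * cnj (\<tau> - w) / (of_real A * (1 - cnj \<tau> * w)) = g * cnj (\<tau> - w) * cnj (1 - cnj \<tau> * w) / of_real (A * B)"
    proof -
      have "x / (A' * w) = x * cnj w / (A' * (w * cnj w))" if "w \<noteq> 0" for x A' w :: complex
        using that by simp
      from this[OF tau_factor_nz[OF w1]] show ?thesis unfolding of_real_mult B2 .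
    qed
    then have "m w = Re (g * cnj (\<tau> - w) * cnj (1 - cnj \<tau> * w)) / (A * B)"
      unfolding m_def A_def[symmetric] g_def[symmetric] by (simp only: Re_divide_of_real)
    moreover have "- Re (cnj w * g) * B - Re (cnj (1 - cnj \<tau> * w) * (- cnj \<tau> * g)) * A
        = Re (g * cnj (\<tau> - w) * cnj (1 - cnj \<tau> * w))"
      unfolding A_def B_def cmod_power2 by (simp add: power2_eq_square algebra_simps)
    ultimately show ?thesis using A B by (simp add: field_simps)
  qed
  ultimately have "((\<lambda>s. ln (1 - (norm (\<phi> s z))\<^sup>2) - ln ((1 - (Re \<tau> * Re (\<phi> s z) + Im \<tau> * Im (\<phi> s z)))\<^sup>2
      + (Re \<tau> * Im (\<phi> s z) - Im \<tau> * Re (\<phi> s z))\<^sup>2)) has_real_derivative 2 * m w) (at t within {0..})" by simp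
  moreover have "ln (Q (\<phi> s z)) = ln (1 - (norm (\<phi> s z))\<^sup>2) - ln ((1 - (Re \<tau> * Re (\<phi> s z) + Im \<tau> * Im (\<phi> s z)))\<^sup>2
      + (Re \<tau> * Im (\<phi> s z) - Im \<tau> * Re (\<phi> s z))\<^sup>2)" if "s \<ge> 0" for s
  proof -
    have n: "norm (\<phi> s z) < 1" using phi_norm that assms by blast
    have "(norm (1 - cnj \<tau> * \<phi> s z))\<^sup>2 = (1 - (Re \<tau> * Re (\<phi> s z) + Im \<tau> * Im (\<phi> s z)))\<^sup>2
      + (Re \<tau> * Im (\<phi> s z) - Im \<tau> * Re (\<phi> s z))\<^sup>2"
      unfolding cmod_power2 by (simp add: power2_eq_square algebra_simps)
    then show ?thesis unfolding Q_def using tau_factor_nz[OF n] one_minus_norm_sq_pos[OF n]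
      by (subst ln_div) auto
  qed
  ultimately show ?thesis unfolding w_def
    using assms(1) by (auto intro: has_field_derivative_transform_within[where d = 1])
qed

lemma m_nonneg:
  assumes z: "norm z < 1"
  shows "m z \<ge> 0"
proof -
  have "((\<lambda>s. ln (Q (\<phi> s z))) has_real_derivative 2 * m z) (at 0 within {0..})"
    using ln_Q_deriv[OF order_refl z] phi_0[OF z] by simp
  then have "((\<lambda>s. (ln (Q (\<phi> s z)) - ln (Q (\<phi> 0 z))) / (s - 0)) \<longlongrightarrow> 2 * m z) (at 0 within {0..})"
    by (simp add: has_field_derivative_iff)
  moreover have "\<forall>\<^sub>F s in at 0 within {0..}. 0 \<le> (ln (Q (\<phi> s z)) - ln (Q (\<phi> 0 z))) / (s - 0)"
    unfolding eventually_at
  proof (intro exI[of _ 1] conjI ballI impI)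
    fix s :: real assume "s \<in> {0..}"
    then have s: "s \<ge> 0" by simp
    have "ln (Q z) \<le> ln (Q (\<phi> s z))" using Q_mono[OF s z] Q_pos[OF z] by simp
    then show "0 \<le> (ln (Q (\<phi> s z)) - ln (Q (\<phi> 0 z))) / (s - 0)"
      using s phi_0[OF z] by simp
  qed simp
  moreover have "at (0::real) within {0..} \<noteq> bot"
    by (simp add: at_within_Ici_at_right)
  ultimately have "0 \<le> 2 * m z" by (rule tendsto_lowerbound)
  then show ?thesis by simp
qed

text \<open>Away from \<tau> the quotient of G by \<open>(\<tau> - z) * (1 - cnj \<tau> * z)\<close>
  has as real part a positive multiple of \<open>m\<close>, which is nonnegative by Wolff's lemma.
  For \<tau> in the disc the singularity at \<tau> is removable since \<open>G \<tau> = 0\<close>.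
  The formula for \<open>m\<close> belongs to the conclusion because a bound on \<open>m\<close> is
  later read as a bound on \<open>Re p\<close>.\<close>

lemma Berkson_Porta:
  obtains p where "p holomorphic_on ball 0 1" "\<And>z. norm z < 1 \<Longrightarrow> Re (p z) \<ge> 0"
    "\<And>z. norm z < 1 \<Longrightarrow> G z = (\<tau> - z) * (1 - cnj \<tau> * z) * p z"
    "\<And>z. norm z < 1 \<Longrightarrow> m z = (norm (\<tau> - z))\<^sup>2 * Re (p z) / (1 - (norm z)\<^sup>2)"
proof -
  define p0 where "p0 = (\<lambda>z. G z / ((\<tau> - z) * (1 - cnj \<tau> * z)))"
  have m0: "m z = (norm (\<tau> - z))\<^sup>2 * Re (p0 z) / (1 - (norm z)\<^sup>2)" if z: "norm z < 1" "z \<noteq> \<tau>" for z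
  proof -
    have "G z = p0 z * ((\<tau> - z) * (1 - cnj \<tau> * z))"
      unfolding p0_def using z tau_factor_nz[of z] by simp
    then have "G z * cnj (\<tau> - z) / (of_real (1 - (norm z)\<^sup>2) * (1 - cnj \<tau> * z))
        = p0 z * ((\<tau> - z) * cnj (\<tau> - z)) / of_real (1 - (norm z)\<^sup>2)"
      using tau_factor_nz[OF z(1)] by simp
    also have "(\<tau> - z) * cnj (\<tau> - z) = of_real ((norm (\<tau> - z))\<^sup>2)" by (rule complex_norm_square[symmetric])
    finally have "m z = Re (p0 z * of_real ((norm (\<tau> - z))\<^sup>2)) / (1 - (norm z)\<^sup>2)"
      unfolding m_def by (simp only: Re_divide_of_real)
    then show ?thesis by (simp add: mult.commute)
  qed
  have re0: "Re (p0 z) \<ge> 0" if z: "norm z < 1" "z \<noteq> \<tau>" for z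
  proof -
    have "(norm (\<tau> - z))\<^sup>2 > 0" "1 - (norm z)\<^sup>2 > 0" using z one_minus_norm_sq_pos by auto
    then show ?thesis using m_nonneg[OF z(1)] unfolding m0[OF z] by (simp add: zero_le_divide_iff zero_le_mult_iff)
  qed
  show ?thesis
  proof (cases "norm \<tau> < 1")
    case False
    then have ne: "z \<noteq> \<tau>" if "norm z < 1" for z using that by auto
    show ?thesis
    proof (rule that[of p0])
      show "p0 holomorphic_on ball 0 1"
        unfolding p0_def using ne tau_factor_nz by (intro holomorphic_intros G_hol) auto
      show "G z = (\<tau> - z) * (1 - cnj \<tau> * z) * p0 z" if "norm z < 1" for z
        unfolding p0_def using ne[OF that] tau_factor_nz[OF that] by simp
    qed (use re0 m0 ne in auto)
  next
    case True
    define g where "g = (\<lambda>z. - G z / (1 - cnj \<tau> * z))"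
    have g0: "g \<tau> = 0" by (simp add: g_def G_tau[OF True])
    define p where "p = (\<lambda>z. if z = \<tau> then deriv g \<tau> else p0 z - g \<tau> / (z - \<tau>))"
    have holp: "p holomorphic_on ball 0 1"
      unfolding p_def
    proof (rule pole_theorem_open)
      show "g holomorphic_on ball 0 1"
        unfolding g_def using tau_factor_nz by (intro holomorphic_intros G_hol) auto
      show "g z = (z - \<tau>) * p0 z" if "z \<in> ball 0 1 - {\<tau>}" for z
      proof -
        have "- g / b = - a * (g / (a * b))" if "a \<noteq> 0" for a b g :: complex
          using that by simp
        moreover have "\<tau> - z \<noteq> 0" using that by auto
        ultimately have "- G z / (1 - cnj \<tau> * z) = - (\<tau> - z) * (G z / ((\<tau> - z) * (1 - cnj \<tau> * z)))"
          by blast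
        then show ?thesis unfolding g_def p0_def minus_diff_eq .
      qed
    qed simp
    have pp: "p z = p0 z" if "z \<noteq> \<tau>" for z using that by (simp add: p_def g0)
    have "isCont p \<tau>"
      using holp True by (intro holomorphic_on_imp_continuous_on[THEN continuous_on_interior]) auto
    then have "((\<lambda>z. Re (p z)) \<longlongrightarrow> Re (p \<tau>)) (at \<tau>)" by (intro tendsto_Re) (simp add: isCont_def)
    moreover have "\<forall>\<^sub>F z in at \<tau>. norm z < 1"
      using True by (intro eventually_at_in_open'[of "ball 0 1" \<tau>, simplified])
    then have "\<forall>\<^sub>F z in at \<tau>. 0 \<le> Re (p z)"
      using eventually_neq_at_within[of \<tau> \<tau> UNIV] by eventually_elim (use pp re0 in auto)
    ultimately have pt: "Re (p \<tau>) \<ge> 0" by (intro tendsto_lowerbound[of _ _ "at \<tau>"]) auto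
    show ?thesis
    proof (rule that[OF holp])
      show "Re (p z) \<ge> 0" if "norm z < 1" for z using pt pp re0 that by (cases "z = \<tau>") auto
      show "G z = (\<tau> - z) * (1 - cnj \<tau> * z) * p z" if "norm z < 1" for z
        using G_tau[OF True] pp tau_factor_nz[OF that] by (cases "z = \<tau>") (auto simp: p0_def)
      show "m z = (norm (\<tau> - z))\<^sup>2 * Re (p z) / (1 - (norm z)\<^sup>2)" if "norm z < 1" for z
        using pp m0[OF that] by (cases "z = \<tau>") (auto simp: m_def)
    qed
  qed
qed

subsection \<open>Hyperbolic speed\<close>

definition v :: "complex \<Rightarrow> real" where "v z = norm (G z) / (1 - (norm z)\<^sup>2)"

text \<open>By Schwarz-Pick \<open>\<phi> t\<close> contracts the hyperbolic metric, and by
  \<open>G_phi\<close> it carries the vector of G at z to the vector of G at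
  \<open>\<phi> t z\<close>.\<close>

lemma v_mono:
  assumes t: "t \<ge> 0" and z: "norm z < 1"
  shows "v (\<phi> t z) \<le> v z"
proof -
  interpret disc_self_map "\<phi> t" by (rule self_map[OF t])
  have A: "1 - (norm z)\<^sup>2 > 0" "1 - (norm (\<phi> t z))\<^sup>2 > 0"
    using one_minus_norm_sq_pos z self by auto
  have "norm (G (\<phi> t z)) * (1 - (norm z)\<^sup>2) = norm (G z) * (norm (deriv (\<phi> t) z) * (1 - (norm z)\<^sup>2))"
    unfolding G_phi[OF assms, symmetric] by (simp add: norm_mult)
  also have "\<dots> \<le> norm (G z) * (1 - (norm (\<phi> t z))\<^sup>2)"
    by (intro mult_left_mono schwarz_pick_deriv z) auto
  finally show ?thesis unfolding v_def using A by (simp add: field_simps)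
qed

text \<open>Along the orbit \<open>ln (1 - (norm z)^2)\<close> grows at most at twice the hyperbolic
  speed. The speed does not increase along orbits, so its value at the starting point controls the
  whole time interval.\<close>

lemma boundary_distance_growth:
  assumes t: "t \<ge> 0" and z: "norm z < 1"
  shows "ln (1 - (norm (\<phi> t z))\<^sup>2) - ln (1 - (norm z)\<^sup>2) \<le> 2 * v z * t"
proof (cases "t = 0")
  case True
  then show ?thesis using phi_0[OF z] by simp
next
  case False
  then have t0: "t > 0" using t by simp
  define F where "F = (\<lambda>s. ln (1 - (norm (\<phi> s z))\<^sup>2))"
  define F' where "F' = (\<lambda>s. - 2 * Re (cnj (\<phi> s z) * G (\<phi> s z)) / (1 - (norm (\<phi> s z))\<^sup>2))"
  have d: "(F has_real_derivative F' s) (at s within {0..})" if "s \<ge> 0" for s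
    unfolding F_def F'_def by (rule ln_one_minus_deriv[OF that z])
  have bound: "F' s \<le> 2 * v z" if s: "s \<ge> 0" for s
  proof -
    have n: "norm (\<phi> s z) < 1" by (rule phi_norm[OF s z])
    have A: "1 - (norm (\<phi> s z))\<^sup>2 > 0" by (rule one_minus_norm_sq_pos[OF n])
    have "- Re (cnj (\<phi> s z) * G (\<phi> s z)) \<le> norm (cnj (\<phi> s z) * G (\<phi> s z))"
      using complex_Re_le_cmod[of "- (cnj (\<phi> s z) * G (\<phi> s z))"] by simp
    also have "\<dots> \<le> 1 * norm (G (\<phi> s z))" unfolding norm_mult using n by (intro mult_right_mono) auto
    finally have "- 2 * Re (cnj (\<phi> s z) * G (\<phi> s z)) / (1 - (norm (\<phi> s z))\<^sup>2) \<le> 2 * norm (G (\<phi> s z)) / (1 - (norm (\<phi> s z))\<^sup>2)"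
      using A by (intro divide_right_mono) auto
    then have "F' s \<le> 2 * v (\<phi> s z)" unfolding F'_def v_def by simp
    then show ?thesis using v_mono[OF s z] by linarith
  qed
  have dat: "(F has_real_derivative F' s) (at s)" if "s > 0" for s
  proof -
    have "(F has_real_derivative F' s) (at s within {0<..})"
      using that by (intro DERIV_subset[OF d[of s]]) auto
    then show ?thesis using at_within_open[of s "{0<..}"] that by simp
  qed
  have "continuous_on {0..t} F"
    using d by (intro DERIV_continuous_on[of _ _ F'] DERIV_subset[OF d]) auto
  then obtain l \<xi> where "0 < \<xi>" "DERIV F \<xi> :> l" "F t - F 0 = (t - 0) * l"
    using MVT[of 0 t F] t0 dat real_differentiable_def by (metis)
  moreover have "l = F' \<xi>" by (rule DERIV_unique[OF calculation(2) dat[OF calculation(1)]])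
  ultimately have "\<xi> > 0" "F t - F 0 = t * F' \<xi>" by auto
  then have "F t - F 0 \<le> t * (2 * v z)" using bound[of \<xi>] t0 by simp
  then show ?thesis using phi_0[OF z] by (simp add: F_def mult_ac)
qed

end


section \<open>Singularities of the generator and of the Koenigs function\<close>

lemma cap_point_in_disc: "norm x = 1 \<Longrightarrow> u \<in> cap \<rho> \<Longrightarrow> norm (x * (1 - u)) < 1"
  by (simp add: norm_mult cap_def dist_norm)

lemma holomorphic_on_cap:
  assumes "f holomorphic_on ball 0 1" "norm x = 1"
  shows "(\<lambda>u. f (x * (1 - u))) holomorphic_on cap \<rho>"
proof -
  have "(f \<circ> (\<lambda>u. x * (1 - u))) holomorphic_on cap \<rho>"
    using cap_point_in_disc[OF assms(2)]
    by (intro holomorphic_on_compose_gen[OF _ assms(1)] holomorphic_intros) auto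
  then show ?thesis by (simp add: o_def)
qed

lemma deriv_on_cap:
  assumes "f holomorphic_on ball 0 1" "norm x = 1" "u \<in> cap \<rho>"
  shows "deriv (\<lambda>u. f (x * (1 - u))) u = - x * deriv f (x * (1 - u))"
proof (rule DERIV_imp_deriv)
  have "(f has_field_derivative deriv f (x * (1 - u))) (at (x * (1 - u)))"
    using assms cap_point_in_disc by (intro holomorphic_derivI) auto
  moreover have "((\<lambda>u. x * (1 - u)) has_field_derivative - x) (at u)"
    by (auto intro!: derivative_eq_intros)
  ultimately have "((\<lambda>u. f (x * (1 - u))) has_field_derivative deriv f (x * (1 - u)) * - x) (at u)"
    by (rule DERIV_chain2[where f = f and g = "\<lambda>u. x * (1 - u)"])
  then show "((\<lambda>u. f (x * (1 - u))) has_field_derivative - x * deriv f (x * (1 - u))) (at u)"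
    by (simp only: mult.commute)
qed

lemma pt_tendsto_ang: "((\<lambda>u. x * (1 - u)) \<longlongrightarrow> x) ang"
proof -
  have "((\<lambda>u. x * (1 - u)) \<longlongrightarrow> x * (1 - 0)) ang" by (intro tendsto_intros ang_tendsto_0)
  then show ?thesis by simp
qed

text \<open>By the open mapping theorem all values near c are taken near w. Injectivity would then
  force points close to the circle into a small disc about w.\<close>

lemma injective_boundary_value_not_attained:
  assumes hol: "f holomorphic_on ball 0 1" and inj: "inj_on f (ball 0 1)" and x: "norm x = 1"
    and lim: "((\<lambda>u. f (x * (1 - u))) \<longlongrightarrow> c) ang" and w: "norm w < 1"
  shows "f w \<noteq> c"
proof
  assume c: "f w = c"
  define r where "r = (1 - norm w) / 2"
  have r: "r > 0" using w by (simp add: r_def)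
  have sub: "ball w r \<subseteq> ball 0 1"
  proof
    fix z assume "z \<in> ball w r"
    then show "z \<in> ball 0 1" using norm_triangle_ineq2[of z w] w
      by (simp add: r_def dist_norm norm_minus_commute field_simps)
  qed
  have "open (f ` ball w r)"
    by (rule open_mapping_thm3) (use hol inj sub in \<open>auto intro: holomorphic_on_subset inj_on_subset\<close>)
  moreover have "c \<in> f ` ball w r" using c r by auto
  ultimately have 1: "\<forall>\<^sub>F u in ang. f (x * (1 - u)) \<in> f ` ball w r" using lim topological_tendstoD by blast
  have 2: "\<forall>\<^sub>F u in ang. u \<in> cap 1" by (rule eventually_ang_cap) simp
  have "((\<lambda>u. norm (x * (1 - u))) \<longlongrightarrow> norm x) ang" by (intro tendsto_norm pt_tendsto_ang)
  then have 3: "\<forall>\<^sub>F u in ang. norm w + r < norm (x * (1 - u))"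
    by (rule order_tendstoD) (use x w in \<open>simp add: r_def field_simps\<close>)
  have "\<forall>\<^sub>F u in ang. False"
    using 1 2 3
  proof eventually_elim
    case (elim u)
    then obtain z where z: "z \<in> ball w r" "f (x * (1 - u)) = f z" by auto
    then have "x * (1 - u) = z"
      using inj_onD[OF inj z(2)] sub cap_point_in_disc[OF x elim(2)] by auto
    then show False using z elim(3) norm_triangle_ineq2[of z w] by (simp add: dist_norm norm_minus_commute)
  qed
  then show False by (simp add: eventually_False)
qed

lemma Re_exp_pos:
  assumes "\<bar>Im w\<bar> < pi / 2" shows "Re (exp w) > 0"
proof -
  have "cos (Im w) > 0" using assms by (intro cos_gt_zero_pi) auto
  then show ?thesis by (simp add: Re_exp)
qed

locale boundary_regularity = disc_semigroup \<phi> G h \<tau> for \<phi> G h \<tau> +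
  fixes x :: complex and \<alpha> :: real
  assumes x: "norm x = 1" and alpha: "- 1 \<le> \<alpha>" "\<alpha> < 1" "\<alpha> \<noteq> 0"
begin

abbreviation pt :: "complex \<Rightarrow> complex" where "pt u \<equiv> x * (1 - u)"

lemma x_nz: "x \<noteq> 0" using x by auto

lemma pt_in: "u \<in> cap \<rho> \<Longrightarrow> norm (pt u) < 1" by (rule cap_point_in_disc[OF x])

lemma pt_neq_tau:
  assumes "u \<in> cap (norm (x - \<tau>))"
  shows "pt u \<noteq> \<tau>"
proof
  assume "pt u = \<tau>"
  then have "x - \<tau> = x * u" by (simp add: algebra_simps)
  then have "norm (x - \<tau>) = norm u" by (simp add: norm_mult x)
  then show False using assms by (simp add: cap_def)
qed

definition G_regular where
  "G_regular \<longleftrightarrow> (\<exists>L. L \<noteq> 0 \<and> ((\<lambda>u. G (pt u) * u powr of_real (-\<alpha>)) \<longlongrightarrow> L) ang)"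

definition phi_regular where
  "phi_regular t \<longleftrightarrow> (\<exists>L. L \<noteq> 0 \<and> ((\<lambda>u. deriv (\<phi> t) (pt u) * u powr of_real \<alpha>) \<longlongrightarrow> L) ang)"

lemma powr_mult_inverse [simp]: "u \<noteq> 0 \<Longrightarrow> u powr (- of_real a) * u powr of_real a = (1::complex)"
  "u \<noteq> 0 \<Longrightarrow> u powr of_real a * u powr (- of_real a) = (1::complex)"
  by (simp_all flip: powr_add)

lemma radial_form:
  "regular_singularity G \<alpha> x \<longleftrightarrow>
   (\<exists>L. L \<noteq> 0 \<and> ((\<lambda>s. G (pt (of_real s)) * of_real s powr of_real (-\<alpha>)) \<longlongrightarrow> L) (at_right 0))"
proof -
  have 1: "filterlim (\<lambda>s::real. 1 - s) (at_left 1) (at_right 0)"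
    unfolding filterlim_at by (auto intro!: tendsto_eq_intros eventually_mono[OF eventually_at_right_less[of "0::real"]])
  have 2: "filterlim (\<lambda>s::real. 1 - s) (at_right 0) (at_left 1)"
    unfolding filterlim_at by (auto intro!: tendsto_eq_intros eventually_mono[OF eventually_at_left_real[of 0 1]])
  have eq: "G (pt (of_real s)) * of_real s powr of_real (-\<alpha>) = G (of_real (1 - s) * x) / of_real (s powr \<alpha>)"
    if "s > 0" for s
  proof -
    have "pt (of_real s) = of_real (1 - s) * x" by (simp add: algebra_simps)
    moreover have "complex_of_real s powr of_real (-\<alpha>) = of_real (inverse (s powr \<alpha>))"
      using that by (simp add: powr_of_real powr_minus del: of_real_minus)
    ultimately show ?thesis by (simp only: divide_inverse of_real_inverse)
  qed
  have "((\<lambda>r::real. G (of_real r * x) / of_real ((1 - r) powr \<alpha>)) \<longlongrightarrow> L) (at_left 1) \<longleftrightarrow>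
    ((\<lambda>s. G (pt (of_real s)) * of_real s powr of_real (-\<alpha>)) \<longlongrightarrow> L) (at_right 0)" (is "?A \<longleftrightarrow> ?B") for L
  proof
    assume ?A
    from filterlim_compose[OF this 1]
    show ?B by (rule Lim_transform_eventually) (rule eventually_mono[OF eventually_at_right_less[of "0::real"]], simp only: eq diff_diff_eq2 add_diff_cancel_left')
  next
    assume ?B
    from filterlim_compose[OF this 2]
    show ?A by (rule Lim_transform_eventually)
      (rule eventually_mono[OF eventually_at_left_real[of 0 1]], use eq[of "1 - _"] in auto)
  qed
  then show ?thesis unfolding regular_singularity_def by blast
qed

text \<open>The case \<open>a = 0\<close> of \<open>Herglotz_pick\<close>.\<close>

lemma Herglotz_growth:
  assumes "p holomorphic_on ball 0 1" and re: "\<And>z. norm z < 1 \<Longrightarrow> Re (p z) \<ge> 0"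
  obtains K where "K > 0" "\<And>z. norm z < 1 \<Longrightarrow> norm (p z) * (1 - (norm z)\<^sup>2) \<le> K"
proof (rule that[of "norm (p 0) + 4 * Re (p 0) + 1"])
  show "norm (p 0) + 4 * Re (p 0) + 1 > 0" using re[of 0] by (simp add: add_nonneg_pos)
  fix z :: complex assume z: "norm z < 1"
  have A: "1 - (norm z)\<^sup>2 > 0" by (rule one_minus_norm_sq_pos[OF z])
  have "norm (p 0 + cnj (p z)) * (1 - (norm z)\<^sup>2) \<le> 4 * Re (p 0)"
    using Herglotz_pick[OF assms, of 0 z] z by simp
  moreover have "norm (p z) \<le> norm (p 0 + cnj (p z)) + norm (p 0)"
    using norm_triangle_ineq4[of "p 0 + cnj (p z)" "p 0"] by simp
  then have "norm (p z) * (1 - (norm z)\<^sup>2) \<le> (norm (p 0 + cnj (p z)) + norm (p 0)) * (1 - (norm z)\<^sup>2)"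
    using A by (intro mult_right_mono) auto
  moreover have "norm (p 0) * (1 - (norm z)\<^sup>2) \<le> norm (p 0) * 1" using A by (intro mult_left_mono) auto
  ultimately show "norm (p z) * (1 - (norm z)\<^sup>2) \<le> norm (p 0) + 4 * Re (p 0) + 1"
    unfolding distrib_right by linarith
qed

text \<open>At \<open>x = \<tau>\<close> the two Berkson-Porta factors contribute
  \<open>s * s\<close> and p at most a constant over s. So G would be of order s, which is
  negligible against \<open>s powr \<alpha>\<close> because \<open>\<alpha> < 1\<close>.\<close>

lemma x_neq_tau:
  assumes L: "L \<noteq> 0" "((\<lambda>s. G (pt (of_real s)) * of_real s powr of_real (-\<alpha>)) \<longlongrightarrow> L) (at_right 0)"
  shows "x \<noteq> \<tau>"
proof
  assume xt: "x = \<tau>"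
  obtain p where p: "p holomorphic_on ball 0 1" "\<And>z. norm z < 1 \<Longrightarrow> Re (p z) \<ge> 0"
    "\<And>z. norm z < 1 \<Longrightarrow> G z = (\<tau> - z) * (1 - cnj \<tau> * z) * p z"
    "\<And>z. norm z < 1 \<Longrightarrow> m z = (norm (\<tau> - z))\<^sup>2 * Re (p z) / (1 - (norm z)\<^sup>2)"
    by (rule Berkson_Porta) (rule that; blast)
  obtain K where K: "K > 0" "\<And>z. norm z < 1 \<Longrightarrow> norm (p z) * (1 - (norm z)\<^sup>2) \<le> K"
    using Herglotz_growth[OF p(1,2)] by metis
  have "((\<lambda>s::real. K * s powr (1 - \<alpha>)) \<longlongrightarrow> K * 0 powr (1 - \<alpha>)) (at_right 0)"
    using alpha eventually_mono[OF eventually_at_right_less[of "0::real"] less_imp_le]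
    by (intro tendsto_intros tendsto_powr' tendsto_ident_at) simp_all
  then have l: "((\<lambda>s::real. K * s powr (1 - \<alpha>)) \<longlongrightarrow> 0) (at_right 0)" by simp
  have "((\<lambda>s. G (pt (of_real s)) * of_real s powr of_real (-\<alpha>)) \<longlongrightarrow> 0) (at_right 0)"
  proof (rule Lim_null_comparison[OF _ l])
    show "\<forall>\<^sub>F s in at_right 0. norm (G (pt (of_real s)) * of_real s powr of_real (-\<alpha>)) \<le> K * s powr (1 - \<alpha>)"
      using eventually_at_right_real[of 0 1]
    proof (rule eventually_mono)
      fix s :: real assume s: "s \<in> {0<..<1}"
      define z where "z = pt (of_real s)"
      have "norm (1 - complex_of_real s) = \<bar>1 - s\<bar>" by (metis norm_of_real of_real_1 of_real_diff)
      then have nz: "norm z = 1 - s" unfolding z_def using s x by (simp add: norm_mult)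
      have z1: "norm z < 1" using nz s by simp
      have "cnj x * x = 1" using unit_mult_cnj[OF x] by (simp add: mult.commute)
      then have "1 - cnj \<tau> * z = of_real s"
        unfolding z_def xt[symmetric] by (simp flip: mult.assoc)
      moreover have "\<tau> - z = x * of_real s" by (simp add: z_def xt algebra_simps)
      ultimately have Gz: "norm (G z) = s * (norm (p z) * s)"
        using p(3)[OF z1] s x by (simp add: norm_mult)
      have "1 - (norm z)\<^sup>2 = s * (2 - s)" unfolding nz by (simp add: power2_eq_square algebra_simps)
      then have 1: "norm (p z) * (s * (2 - s)) \<le> K" using K(2)[OF z1] by simp
      have "s * 1 \<le> s * (2 - s)" using s by (intro mult_left_mono) auto
      then have "norm (p z) * (s * 1) \<le> norm (p z) * (s * (2 - s))" by (rule mult_left_mono) simp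
      then have "norm (p z) * s \<le> K" using 1 by simp
      then have "s * (norm (p z) * s) \<le> s * K" using s by (intro mult_left_mono) auto
      then have "norm (G z) \<le> K * s" using Gz by (simp only: mult.commute)
      then have "norm (G z) * s powr (-\<alpha>) \<le> K * s * s powr (-\<alpha>)" by (intro mult_right_mono) auto
      also have "\<dots> = K * s powr (1 - \<alpha>)" using s by (simp add: powr_diff powr_minus field_simps)
      finally show "norm (G (pt (of_real s)) * of_real s powr of_real (-\<alpha>)) \<le> K * s powr (1 - \<alpha>)"
        using s by (simp add: norm_mult norm_powr_real_powr' z_def del: of_real_minus)
    qed simp
  qed
  with L(2) have "L = 0" using tendsto_unique trivial_limit_at_right_real by blast
  with L show False by simp
qed

text \<open>Since p has nonnegative real part, the fourth root of p * u powr (-\<alpha>) takes values in the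
  right half-plane, so its Cayley transform is bounded and the Lindelof theorem applies.\<close>

lemma regular_singularity_iff: "regular_singularity G \<alpha> x \<longleftrightarrow> G_regular"
proof
  assume G_regular
  then obtain L where "L \<noteq> 0" "((\<lambda>u. G (pt u) * u powr of_real (-\<alpha>)) \<longlongrightarrow> L) ang"
    unfolding G_regular_def by blast
  then show "regular_singularity G \<alpha> x"
    unfolding radial_form using filterlim_compose[OF _ filterlim_of_real_ang] by blast
next
  assume "regular_singularity G \<alpha> x"
  then obtain L where L: "L \<noteq> 0" "((\<lambda>s. G (pt (of_real s)) * of_real s powr of_real (-\<alpha>)) \<longlongrightarrow> L) (at_right 0)"
    unfolding radial_form by blast
  have xt: "x \<noteq> \<tau>" by (rule x_neq_tau[OF L])
  obtain p where p: "p holomorphic_on ball 0 1" "\<And>z. norm z < 1 \<Longrightarrow> Re (p z) \<ge> 0"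
    "\<And>z. norm z < 1 \<Longrightarrow> G z = (\<tau> - z) * (1 - cnj \<tau> * z) * p z"
    "\<And>z. norm z < 1 \<Longrightarrow> m z = (norm (\<tau> - z))\<^sup>2 * Re (p z) / (1 - (norm z)\<^sup>2)"
    by (rule Berkson_Porta) (rule that; blast)
  define B where "B = (\<tau> - x) * (1 - cnj \<tau> * x)"
  have B: "B \<noteq> 0"
  proof -
    have "norm (1 - cnj \<tau> * x) = norm (cnj (1 - cnj x * \<tau>))" by (simp add: mult.commute)
    also have "\<dots> = norm (x - \<tau>)" unfolding complex_mod_cnj by (rule norm_one_minus_cnj_mult[OF x])
    finally show ?thesis using xt by (auto simp: B_def)
  qed
  define k where "k = (\<lambda>u. (\<tau> - pt u) * (1 - cnj \<tau> * pt u))"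
  have kB: "(k \<longlongrightarrow> B) ang" unfolding k_def B_def by (intro tendsto_intros pt_tendsto_ang)
  define \<rho> where "\<rho> = norm (x - \<tau>)"
  have \<rho>: "\<rho> > 0" using xt by (simp add: \<rho>_def)
  have nt: "pt u \<noteq> \<tau>" if "u \<in> cap \<rho>" for u
    using pt_neq_tau that by (simp add: \<rho>_def)
  define P where "P = (\<lambda>u. p (pt u))"
  have GP: "G (pt u) = k u * P u" if "u \<in> cap \<rho>" for u
    unfolding k_def P_def by (rule p(3)[OF pt_in[OF that]])
  have P0: "P u \<noteq> 0" if "u \<in> cap \<rho>" for u
    using GP[OF that] G_nz[OF pt_in[OF that] nt[OF that]] by auto
  have Pre: "Re (P u) \<ge> 0" if "u \<in> cap \<rho>" for u
    unfolding P_def by (rule p(2)[OF pt_in[OF that]])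
  have Pnp: "P u \<notin> \<real>\<^sub>\<le>\<^sub>0" if "u \<in> cap \<rho>" for u
    using P0[OF that] Pre[OF that] by (auto simp: complex_nonpos_Reals_iff complex_eq_iff)
  have unp: "u \<notin> \<real>\<^sub>\<le>\<^sub>0" if "u \<in> cap \<rho>" for u using cap_Re_pos[OF that] by (rule nonpos_Reals_Re_pos)
  have holP: "P holomorphic_on cap \<rho>" unfolding P_def by (rule holomorphic_on_cap[OF p(1) x])
  define l where "l = (\<lambda>u. Ln (P u) - of_real \<alpha> * Ln u)"
  define W where "W = (\<lambda>u. P u * u powr of_real (-\<alpha>))"
  define F where "F = (\<lambda>u. exp (l u / 4))"
  have imP: "\<bar>Im (Ln (P u))\<bar> \<le> pi / 2" if "u \<in> cap \<rho>" for u
    using Re_Ln_pos_le[OF P0[OF that]] Pre[OF that] by simp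
  \<comment> \<open>The argument of P is at most \<open>pi / 2\<close> and, as
    \<open>\<bar>\<alpha>\<bar> \<le> 1\<close>, that of \<open>u powr \<alpha>\<close> is below
    \<open>pi / 2\<close>. Hence \<open>l\<close> is the principal logarithm of
    \<open>W\<close>.\<close>
  have iml: "\<bar>Im (l u)\<bar> < pi" if u: "u \<in> cap \<rho>" for u
  proof -
    have "\<bar>Im (Ln u)\<bar> < pi / 2" by (rule Re_Ln_pos_lt_imp[OF cap_Re_pos[OF u]])
    moreover have "\<bar>\<alpha> * Im (Ln u)\<bar> \<le> 1 * \<bar>Im (Ln u)\<bar>"
      unfolding abs_mult using alpha by (intro mult_right_mono) auto
    ultimately show ?thesis using imP[OF u] by (simp add: l_def)
  qed
  have expl: "exp (l u) = W u" if u: "u \<in> cap \<rho>" for u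
    unfolding l_def W_def exp_diff using P0[OF u] cap_nonzero[OF u]
    by (simp add: powr_def exp_minus field_simps)
  have F4: "F u ^ 4 = W u" if "u \<in> cap \<rho>" for u
    unfolding F_def using expl[OF that] by (simp flip: exp_of_nat_mult)
  have FRe: "Re (F u) > 0" if "u \<in> cap \<rho>" for u
    unfolding F_def using iml[OF that] by (intro Re_exp_pos) (auto simp: abs_if split: if_splits)
  have holF: "F holomorphic_on cap \<rho>"
    unfolding F_def l_def using Pnp unp by (intro holomorphic_intros holP) auto
  have real_cap: "\<forall>\<^sub>F s in at_right 0. complex_of_real s \<in> cap \<rho>"
    using filterlim_of_real_ang eventually_ang_cap[OF \<rho>] unfolding filterlim_iff by blast
  define L1 where "L1 = L / B"
  have L1: "L1 \<noteq> 0" using L B by (simp add: L1_def)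
  have kr: "((\<lambda>s. k (of_real s)) \<longlongrightarrow> B) (at_right 0)" by (rule filterlim_compose[OF kB filterlim_of_real_ang])
  have WL: "((\<lambda>s. W (of_real s)) \<longlongrightarrow> L1) (at_right 0)"
    unfolding L1_def
  proof (rule Lim_transform_eventually[OF tendsto_divide[OF L(2) kr B]])
    show "\<forall>\<^sub>F s in at_right 0. G (pt (of_real s)) * of_real s powr of_real (-\<alpha>) / k (of_real s) = W (of_real s)"
      using real_cap
    proof eventually_elim
      case (elim s)
      have "k (of_real s) \<noteq> 0" using GP[OF elim] G_nz[OF pt_in[OF elim] nt[OF elim]] by auto
      then show ?case unfolding GP[OF elim] W_def by simp
    qed
  qed
  \<comment> \<open>On the positive axis the power of u is a positive real, so \<open>L1\<close>
    lies in the closed right half-plane, off the cut of \<open>Ln\<close>. This determines the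
    branch used in \<open>F0\<close>.\<close>
  have WRe: "Re (W (of_real s)) \<ge> 0" if "complex_of_real s \<in> cap \<rho>" for s
  proof -
    have "s > 0" using cap_Re_pos[OF that] by simp
    then have "complex_of_real s powr of_real (-\<alpha>) = of_real (s powr (-\<alpha>))" by (simp add: powr_of_real del: of_real_minus)
    then show ?thesis unfolding W_def using Pre[OF that] by simp
  qed
  have L1Re: "Re L1 \<ge> 0"
    by (rule tendsto_lowerbound[OF tendsto_Re[OF WL]]) (auto intro: eventually_mono[OF real_cap] WRe)
  have L1np: "L1 \<notin> \<real>\<^sub>\<le>\<^sub>0" using L1 L1Re by (auto simp: complex_nonpos_Reals_iff complex_eq_iff)
  define F0 where "F0 = exp (Ln L1 / 4)"
  have FL: "((\<lambda>s. F (of_real s)) \<longlongrightarrow> F0) (at_right 0)"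
  proof -
    have "((\<lambda>s. exp (Ln (W (of_real s)) / 4)) \<longlongrightarrow> F0) (at_right 0)"
      unfolding F0_def using L1np by (intro tendsto_intros WL) auto
    then show ?thesis
    proof (rule Lim_transform_eventually)
      show "\<forall>\<^sub>F s in at_right 0. exp (Ln (W (of_real s)) / 4) = F (of_real s)"
        using real_cap
      proof eventually_elim
        case (elim s)
        have "Ln (exp (l (of_real s))) = l (of_real s)"
          using iml[OF elim] by (intro Ln_exp) auto
        then show ?case unfolding F_def expl[OF elim] by simp
      qed
    qed
  qed
  have F0Re: "Re F0 \<ge> 0"
    by (rule tendsto_lowerbound[OF tendsto_Re[OF FL]])
       (auto intro: eventually_mono[OF real_cap] less_imp_le FRe)
  have F01: "F0 + 1 \<noteq> 0"
  proof
    assume "F0 + 1 = 0"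
    then have "Re (F0 + 1) = 0" by simp
    then show False using F0Re by simp
  qed
  define R where "R = (\<lambda>u. (F u - 1) / (F u + 1))"
  define R0 where "R0 = (F0 - 1) / (F0 + 1)"
  have Fp1: "F u + 1 \<noteq> 0" if "u \<in> cap \<rho>" for u
  proof
    assume "F u + 1 = 0"
    then have "Re (F u + 1) = 0" by simp
    then show False using FRe[OF that] by simp
  qed
  have "(R \<longlongrightarrow> R0) ang"
  proof (rule Lindelof_ang[OF _ \<rho>])
    show "R holomorphic_on cap \<rho>" unfolding R_def using Fp1 by (intro holomorphic_intros holF) auto
    show "norm (R u) \<le> 1" if u: "u \<in> cap \<rho>" for u
    proof -
      have "(norm (F u - 1))\<^sup>2 \<le> (norm (F u + 1))\<^sup>2"
        unfolding cmod_power2 using FRe[OF u] by (simp add: power2_eq_square algebra_simps)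
      then have "norm (F u - 1) \<le> norm (F u + 1)" by (rule power2_le_imp_le) simp
      then show ?thesis unfolding R_def using Fp1[OF u] by (simp add: norm_divide)
    qed
    show "((\<lambda>s. R (of_real s)) \<longlongrightarrow> R0) (at_right 0)"
      unfolding R_def R0_def using F01 by (intro tendsto_intros FL) auto
  qed
  moreover have R01: "1 - R0 \<noteq> 0"
  proof -
    have "1 - R0 = 2 / (F0 + 1)" unfolding R0_def using F01 by (simp add: field_simps)
    then show ?thesis using F01 by simp
  qed
  ultimately have limR: "((\<lambda>u. (1 + R u) / (1 - R u)) \<longlongrightarrow> (1 + R0) / (1 - R0)) ang"
    by (intro tendsto_intros)
  have inv: "(1 + (f - 1) / (f + 1)) / (1 - (f - 1) / (f + 1)) = f" if "f + 1 \<noteq> 0" for f :: complex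
  proof -
    have "1 + (f - 1) / (f + 1) = 2 * f / (f + 1)" "1 - (f - 1) / (f + 1) = 2 / (f + 1)"
      using that by (simp_all add: field_simps)
    then show ?thesis using that by simp
  qed
  have "(F \<longlongrightarrow> F0) ang"
    by (rule ang_cong[OF limR \<rho>]) (simp_all only: R_def R0_def inv[OF Fp1] inv[OF F01])
  then have kF: "((\<lambda>u. k u * F u ^ 4) \<longlongrightarrow> B * F0 ^ 4) ang" by (intro tendsto_intros kB)
  have "F0 ^ 4 = L1" unfolding F0_def using L1 by (simp flip: exp_of_nat_mult)
  then have BL: "B * F0 ^ 4 = L" using B by (simp add: L1_def)
  have "((\<lambda>u. G (pt u) * u powr of_real (-\<alpha>)) \<longlongrightarrow> L) ang"
    by (rule ang_cong[OF kF \<rho> _ BL]) (simp only: F4 GP W_def mult.assoc)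
  then show G_regular unfolding G_regular_def using L by blast
qed

section \<open>Order of G at x, derivative of h and values of h\<close>

lemma h_regular_nonelliptic:
  assumes "\<not> norm \<tau> < 1"
  shows "G_regular \<longleftrightarrow> (\<exists>L. L \<noteq> 0 \<and> ((\<lambda>u. deriv h (pt u) * u powr of_real \<alpha>) \<longlongrightarrow> L) ang)"
proof -
  have inv: "inverse (G (pt u) * u powr of_real (-\<alpha>)) = deriv h (pt u) * u powr of_real \<alpha>"
    "inverse (deriv h (pt u) * u powr of_real \<alpha>) = G (pt u) * u powr of_real (-\<alpha>)"
    if u: "u \<in> cap 1" for u
  proof -
    have "(deriv h (pt u) * u powr of_real \<alpha>) * (G (pt u) * u powr of_real (-\<alpha>))
        = (deriv h (pt u) * G (pt u)) * (u powr of_real \<alpha> * u powr (- of_real \<alpha>))"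
      by (simp add: mult_ac)
    then have 1: "(deriv h (pt u) * u powr of_real \<alpha>) * (G (pt u) * u powr of_real (-\<alpha>)) = 1"
      using cap_nonzero[OF u] h_G_nonelliptic[OF assms pt_in[OF u]] by simp
    show "inverse (G (pt u) * u powr of_real (-\<alpha>)) = deriv h (pt u) * u powr of_real \<alpha>"
      by (rule inverse_unique) (use 1 in \<open>simp only: mult.commute\<close>)
    show "inverse (deriv h (pt u) * u powr of_real \<alpha>) = G (pt u) * u powr of_real (-\<alpha>)"
      by (rule inverse_unique[OF 1])
  qed
  show ?thesis
  proof
    assume G_regular
    then obtain L where L: "L \<noteq> 0" "((\<lambda>u. G (pt u) * u powr of_real (-\<alpha>)) \<longlongrightarrow> L) ang"
      unfolding G_regular_def by blast
    have "((\<lambda>u. deriv h (pt u) * u powr of_real \<alpha>) \<longlongrightarrow> inverse L) ang"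
      by (rule ang_cong[OF tendsto_inverse[OF L(2,1)] zero_less_one inv(1) refl])
    then show "\<exists>L. L \<noteq> 0 \<and> ((\<lambda>u. deriv h (pt u) * u powr of_real \<alpha>) \<longlongrightarrow> L) ang"
      using L by (intro exI[of _ "inverse L"]) auto
  next
    assume "\<exists>L. L \<noteq> 0 \<and> ((\<lambda>u. deriv h (pt u) * u powr of_real \<alpha>) \<longlongrightarrow> L) ang"
    then obtain L where L: "L \<noteq> 0" "((\<lambda>u. deriv h (pt u) * u powr of_real \<alpha>) \<longlongrightarrow> L) ang" by blast
    have "((\<lambda>u. G (pt u) * u powr of_real (-\<alpha>)) \<longlongrightarrow> inverse L) ang"
      by (rule ang_cong[OF tendsto_inverse[OF L(2,1)] zero_less_one inv(2) refl])
    then show G_regular unfolding G_regular_def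
      using L by (intro exI[of _ "inverse L"]) auto
  qed
qed

text \<open>Since \<open>h' * G = lam * h\<close>, the point is that h has a finite nonzero angular
  limit. Starting from G, the logarithmic derivative \<open>lam / G\<close> of h is integrable at x,
  so a logarithm of h converges. Starting from h, the limit exists by integration and differs from
  \<open>h \<tau> = 0\<close> by injectivity.\<close>

lemma h_regular_elliptic:
  assumes t: "norm \<tau> < 1"
  shows "G_regular \<longleftrightarrow> (\<exists>L. L \<noteq> 0 \<and> ((\<lambda>u. deriv h (pt u) * u powr of_real \<alpha>) \<longlongrightarrow> L) ang)"
proof -
  define lam where "lam = deriv G \<tau>"
  have lam: "lam \<noteq> 0" unfolding lam_def by (rule lambda_nz[OF t])
  have hG: "deriv h z * G z = lam * h z" if "norm z < 1" for z
    unfolding lam_def by (rule h_G_elliptic[OF t that])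
  define H where "H = (\<lambda>u. h (pt u))"
  have holH: "H holomorphic_on cap \<rho>" for \<rho> unfolding H_def by (rule holomorphic_on_cap[OF h_hol x])
  have dH: "deriv H u = - x * deriv h (pt u)" if "u \<in> cap \<rho>" for u \<rho>
    unfolding H_def by (rule deriv_on_cap[OF h_hol x that])
  have key: "(deriv h (pt u) * u powr of_real \<alpha>) * (G (pt u) * u powr of_real (-\<alpha>)) = lam * H u"
    if u: "u \<in> cap 1" for u
  proof -
    have "(deriv h (pt u) * u powr of_real \<alpha>) * (G (pt u) * u powr of_real (-\<alpha>))
        = (deriv h (pt u) * G (pt u)) * (u powr of_real \<alpha> * u powr (- of_real \<alpha>))"
      by (simp add: mult_ac)
    then show ?thesis using cap_nonzero[OF u] hG[OF pt_in[OF u]] by (simp add: H_def)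
  qed
  show ?thesis
  proof
    assume G_regular
    then obtain L where L: "L \<noteq> 0" "((\<lambda>u. G (pt u) * u powr of_real (-\<alpha>)) \<longlongrightarrow> L) ang"
      unfolding G_regular_def by blast
    define \<rho> where "\<rho> = min 1 (norm (x - \<tau>))"
    have \<rho>: "\<rho> > 0" using t x by (auto simp: \<rho>_def)
    have c1: "u \<in> cap 1" if "u \<in> cap \<rho>" for u using that by (auto simp: cap_def \<rho>_def)
    have nt: "pt u \<noteq> \<tau>" if "u \<in> cap \<rho>" for u
      by (rule pt_neq_tau) (use that in \<open>auto simp: cap_def \<rho>_def\<close>)
    have H0: "H u \<noteq> 0" if u: "u \<in> cap \<rho>" for u
      using hG[OF pt_in[OF u]] h_deriv_nz[OF pt_in[OF u]] G_nz[OF pt_in[OF u] nt[OF u]] by (auto simp: H_def)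
    have z0: "complex_of_real (\<rho> / 2) \<in> cap \<rho>"
    proof -
      have "norm (1 - complex_of_real (\<rho> / 2)) = \<bar>1 - \<rho> / 2\<bar>"
        by (metis norm_of_real of_real_1 of_real_diff)
      moreover have "\<rho> \<le> 1" by (simp add: \<rho>_def)
      ultimately show ?thesis using \<rho> by (simp add: cap_def dist_norm)
    qed
    obtain l where l: "l holomorphic_on cap \<rho>" "\<And>u. u \<in> cap \<rho> \<Longrightarrow> exp (l u) = H u"
      by (rule holomorphic_logarithm_exists[OF cap_convex cap_open holH _ z0], erule H0, rule that; blast)
    have dl: "deriv l u = - x * lam / G (pt u)" if u: "u \<in> cap \<rho>" for u
    proof -
      have "((\<lambda>u. exp (l u)) has_field_derivative exp (l u) * deriv l u) (at u)"
        using holomorphic_derivI[OF l(1) cap_open u] by (auto intro!: derivative_eq_intros)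
      then have "(H has_field_derivative exp (l u) * deriv l u) (at u)"
        by (rule has_field_derivative_transform_within_open[OF _ cap_open u]) (use l in auto)
      then have "H u * deriv l u = - x * deriv h (pt u)"
        using DERIV_imp_deriv dH[OF u] l(2)[OF u] by metis
      then have "H u * (deriv l u * G (pt u)) = - x * (deriv h (pt u) * G (pt u))"
        by (simp add: mult.assoc[symmetric])
      also have "\<dots> = H u * (- x * lam)"
        unfolding hG[OF pt_in[OF u]] by (simp add: H_def)
      finally have "deriv l u * G (pt u) = - x * lam"
        using mult_left_cancel[OF H0[OF u]] by blast
      then show ?thesis using G_nz[OF pt_in[OF u] nt[OF u]] by (subst eq_divide_eq) simp
    qed
    have "((\<lambda>u. - x * lam * inverse (G (pt u) * u powr of_real (-\<alpha>))) \<longlongrightarrow> - x * lam * inverse L) ang"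
      by (intro tendsto_intros L)
    then have "((\<lambda>u. deriv l u * u powr of_real \<alpha>) \<longlongrightarrow> - x * lam * inverse L) ang"
      by (rule ang_cong[OF _ \<rho>]) (auto simp: dl cap_nonzero powr_minus divide_inverse)
    then obtain c where c: "(l \<longlongrightarrow> c) ang"
      by (rule ang_primitive[OF l(1) \<rho> alpha(2)]) (rule that)
    have "((\<lambda>u. exp (l u)) \<longlongrightarrow> exp c) ang" by (intro tendsto_intros c)
    then have Hc: "(H \<longlongrightarrow> exp c) ang" by (rule ang_cong[OF _ \<rho>]) (auto simp: l)
    have "((\<lambda>u. lam * H u / (G (pt u) * u powr of_real (-\<alpha>))) \<longlongrightarrow> lam * exp c / L) ang"
      by (intro tendsto_intros Hc L)
    then have "((\<lambda>u. deriv h (pt u) * u powr of_real \<alpha>) \<longlongrightarrow> lam * exp c / L) ang"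
    proof (rule ang_cong[OF _ \<rho>])
      fix u assume u: "u \<in> cap \<rho>"
      have "G (pt u) * u powr of_real (-\<alpha>) \<noteq> 0"
        using G_nz[OF pt_in[OF u] nt[OF u]] cap_nonzero[OF u] by simp
      then show "lam * H u / (G (pt u) * u powr of_real (-\<alpha>)) = deriv h (pt u) * u powr of_real \<alpha>"
        unfolding key[OF c1[OF u], symmetric] by simp
    qed simp
    then show "\<exists>L. L \<noteq> 0 \<and> ((\<lambda>u. deriv h (pt u) * u powr of_real \<alpha>) \<longlongrightarrow> L) ang"
      using L lam by (intro exI[of _ "lam * exp c / L"]) auto
  next
    assume "\<exists>L. L \<noteq> 0 \<and> ((\<lambda>u. deriv h (pt u) * u powr of_real \<alpha>) \<longlongrightarrow> L) ang"
    then obtain L where L: "L \<noteq> 0" "((\<lambda>u. deriv h (pt u) * u powr of_real \<alpha>) \<longlongrightarrow> L) ang" by blast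
    have "((\<lambda>u. - x * (deriv h (pt u) * u powr of_real \<alpha>)) \<longlongrightarrow> - x * L) ang"
      by (intro tendsto_intros L)
    then have "((\<lambda>u. deriv H u * u powr of_real \<alpha>) \<longlongrightarrow> - x * L) ang"
      by (rule ang_cong[where \<rho> = 1]) (auto simp: dH[where \<rho> = 1])
    then obtain c where c: "(H \<longlongrightarrow> c) ang"
      by (rule ang_primitive[OF holH[of 1] zero_less_one alpha(2)]) (rule that)
    have "h \<tau> \<noteq> c"
      by (rule injective_boundary_value_not_attained[OF h_hol h_inj x c[unfolded H_def] t])
    then have c0: "c \<noteq> 0" using h_tau[OF t] by simp
    have "((\<lambda>u. lam * H u / (deriv h (pt u) * u powr of_real \<alpha>)) \<longlongrightarrow> lam * c / L) ang"
      by (intro tendsto_intros c L)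
    then have "((\<lambda>u. G (pt u) * u powr of_real (-\<alpha>)) \<longlongrightarrow> lam * c / L) ang"
    proof (rule ang_cong[where \<rho> = 1])
      fix u :: complex assume u: "u \<in> cap 1"
      have "deriv h (pt u) * u powr of_real \<alpha> \<noteq> 0"
        using h_deriv_nz[OF pt_in[OF u]] cap_nonzero[OF u] by simp
      then show "lam * H u / (deriv h (pt u) * u powr of_real \<alpha>) = G (pt u) * u powr of_real (-\<alpha>)"
        unfolding key[OF u, symmetric] by simp
    qed auto
    then show G_regular unfolding G_regular_def
      using L lam c0 by (intro exI[of _ "lam * c / L"]) auto
  qed
qed

lemma h_regular_iff:
  "G_regular \<longleftrightarrow> (\<exists>L. L \<noteq> 0 \<and> ((\<lambda>u. deriv h (pt u) * u powr of_real \<alpha>) \<longlongrightarrow> L) ang)"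
  using h_regular_elliptic h_regular_nonelliptic by blast

lemma deriv_to_values:
  assumes f: "f holomorphic_on ball 0 1" and lim: "((\<lambda>u. deriv f (pt u) * u powr of_real \<alpha>) \<longlongrightarrow> L) ang"
  obtains c where "((\<lambda>u. f (pt u)) \<longlongrightarrow> c) ang"
    "((\<lambda>u. (f (pt u) - c) * u powr of_real (\<alpha> - 1)) \<longlongrightarrow> - x * L / of_real (1 - \<alpha>)) ang"
proof -
  have "((\<lambda>u. - x * (deriv f (pt u) * u powr of_real \<alpha>)) \<longlongrightarrow> - x * L) ang"
    by (intro tendsto_intros lim)
  then have "((\<lambda>u. deriv (\<lambda>u. f (pt u)) u * u powr of_real \<alpha>) \<longlongrightarrow> - x * L) ang"
    by (rule ang_cong[where \<rho> = 1]) (auto simp: deriv_on_cap[OF f x, where \<rho> = 1])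
  then show ?thesis
    by (rule ang_primitive[OF holomorphic_on_cap[OF f x] zero_less_one alpha(2)]) (rule that)
qed

text \<open>One direction integrates h'. The other differentiates
  \<open>g = (h - c) * u powr (\<alpha> - 1)\<close>: as \<open>u * g'\<close> tends to 0, the
  product rule yields the limit of \<open>h' * u powr \<alpha>\<close> from that of g.\<close>

lemma h_values_iff:
  "G_regular \<longleftrightarrow> (\<exists>c L. ((\<lambda>u. h (pt u)) \<longlongrightarrow> c) ang \<and> L \<noteq> 0 \<and>
      ((\<lambda>u. (h (pt u) - c) * u powr of_real (\<alpha> - 1)) \<longlongrightarrow> L) ang)"
proof
  assume G_regular
  then obtain L where L: "L \<noteq> 0" "((\<lambda>u. deriv h (pt u) * u powr of_real \<alpha>) \<longlongrightarrow> L) ang"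
    unfolding h_regular_iff by blast
  obtain c where "((\<lambda>u. h (pt u)) \<longlongrightarrow> c) ang"
    "((\<lambda>u. (h (pt u) - c) * u powr of_real (\<alpha> - 1)) \<longlongrightarrow> - x * L / of_real (1 - \<alpha>)) ang"
    by (rule deriv_to_values[OF h_hol L(2)])
  moreover have "- x * L / complex_of_real (1 - \<alpha>) \<noteq> 0" using L x_nz alpha by (simp del: of_real_diff)
  ultimately show "\<exists>c L. ((\<lambda>u. h (pt u)) \<longlongrightarrow> c) ang \<and> L \<noteq> 0 \<and>
      ((\<lambda>u. (h (pt u) - c) * u powr of_real (\<alpha> - 1)) \<longlongrightarrow> L) ang" by blast
next
  assume "\<exists>c L. ((\<lambda>u. h (pt u)) \<longlongrightarrow> c) ang \<and> L \<noteq> 0 \<and>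
      ((\<lambda>u. (h (pt u) - c) * u powr of_real (\<alpha> - 1)) \<longlongrightarrow> L) ang"
  then obtain c L where L: "L \<noteq> 0" "((\<lambda>u. (h (pt u) - c) * u powr of_real (\<alpha> - 1)) \<longlongrightarrow> L) ang" by blast
  define g where "g = (\<lambda>u. (h (pt u) - c) * u powr of_real (\<alpha> - 1))"
  have np: "u \<notin> \<real>\<^sub>\<le>\<^sub>0" if "u \<in> cap \<rho>" for u \<rho> using cap_Re_pos[OF that] by (rule nonpos_Reals_Re_pos)
  have hc: "(\<lambda>u. h (pt u)) holomorphic_on cap 1" by (rule holomorphic_on_cap[OF h_hol x])
  have holg: "g holomorphic_on cap 1"
    unfolding g_def using np by (intro holomorphic_intros hc) auto
  have "((\<lambda>u. deriv g u * u) \<longlongrightarrow> 0) ang"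
    by (rule tendsto_deriv_times_ang[OF holg zero_less_one L(2)[folded g_def]])
  then have "((\<lambda>u. (deriv g u * u - of_real (\<alpha> - 1) * g u) / (- x)) \<longlongrightarrow> (0 - of_real (\<alpha> - 1) * L) / (- x)) ang"
    using x_nz by (intro tendsto_intros L(2)[folded g_def]) auto
  then have "((\<lambda>u. deriv h (pt u) * u powr of_real \<alpha>) \<longlongrightarrow> (0 - of_real (\<alpha> - 1) * L) / (- x)) ang"
  proof (rule ang_cong[where \<rho> = 1])
    fix u :: complex assume u: "u \<in> cap 1"
    have u0: "u \<noteq> 0" by (rule cap_nonzero[OF u])
    have "((\<lambda>u. h (pt u)) has_field_derivative - x * deriv h (pt u)) (at u)"
      using holomorphic_derivI[OF hc cap_open u] unfolding deriv_on_cap[OF h_hol x u] .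
    then have "((\<lambda>u. h (pt u) - c) has_field_derivative - x * deriv h (pt u) - 0) (at u)"
      by (intro DERIV_diff DERIV_const)
    from DERIV_mult[OF this has_field_derivative_powr[OF np[OF u], of "of_real (\<alpha> - 1)"]]
    have dgu: "deriv g u = (- x * deriv h (pt u) - 0) * u powr of_real (\<alpha> - 1)
        + of_real (\<alpha> - 1) * u powr (of_real (\<alpha> - 1) - 1) * (h (pt u) - c)"
      unfolding g_def by (rule DERIV_imp_deriv)
    have pw: "u powr (a - 1) * u = u powr a" for a
      using u0 by (simp add: powr_diff)
    have e1: "u powr of_real (\<alpha> - 1) * u = u powr of_real \<alpha>"
      using pw[of "of_real \<alpha>"] by simp
    have "deriv g u * u = - x * deriv h (pt u) * (u powr of_real (\<alpha> - 1) * u)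
        + of_real (\<alpha> - 1) * (u powr (of_real (\<alpha> - 1) - 1) * u) * (h (pt u) - c)"
      unfolding dgu by (simp add: algebra_simps)
    then have "deriv g u * u = - x * deriv h (pt u) * u powr of_real \<alpha>
        + of_real (\<alpha> - 1) * u powr of_real (\<alpha> - 1) * (h (pt u) - c)"
      unfolding e1 pw .
    then have "deriv g u * u - of_real (\<alpha> - 1) * g u = - x * (deriv h (pt u) * u powr of_real \<alpha>)"
      by (simp add: g_def mult_ac del: of_real_diff)
    then show "(deriv g u * u - of_real (\<alpha> - 1) * g u) / (- x) = deriv h (pt u) * u powr of_real \<alpha>"
      using x_nz by simp
  qed auto
  moreover have "(0 - of_real (\<alpha> - 1) * L) / (- x) \<noteq> 0" using L x_nz alpha by (simp del: of_real_diff)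
  ultimately show G_regular unfolding h_regular_iff by blast
qed

end


section \<open>From the derivative of the semigroup to the generator\<close>

text \<open>Otherwise \<open>f n t\<close> tends to infinity at every t of the interval, and Fatou's
  lemma would make an infinite integral at most B, as the integral of \<open>f n\<close> is
  \<open>F n b - F n a\<close>.\<close>

lemma Fatou_selection:
  fixes F f :: "nat \<Rightarrow> real \<Rightarrow> real"
  assumes ab: "a < b" and cont: "\<And>n. continuous_on UNIV (f n)"
    and der: "\<And>n t. a \<le> t \<Longrightarrow> t \<le> b \<Longrightarrow> (F n has_real_derivative f n t) (at t)"
    and nonneg: "\<And>n t. a \<le> t \<Longrightarrow> t \<le> b \<Longrightarrow> f n t \<ge> 0"
    and bound: "\<And>n. F n b - F n a \<le> B"
  obtains t K where "a \<le> t" "t \<le> b" "\<exists>\<^sub>F n in sequentially. f n t \<le> K"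
proof (rule ccontr)
  assume neg: "\<not> thesis"
  note found = that
  have lim: "filterlim (\<lambda>n. f n t) at_top sequentially" if "a \<le> t" "t \<le> b" for t
    unfolding filterlim_at_top
  proof
    fix K :: real
    have "\<not> (\<exists>\<^sub>F n in sequentially. f n t \<le> K)" using neg found that by blast
    then show "\<forall>\<^sub>F n in sequentially. K \<le> f n t"
      unfolding not_frequently by (rule eventually_mono) simp
  qed
  define u where "u = (\<lambda>n t. ennreal (f n t) * indicator {a..b} t)"
  have meas: "u n \<in> borel_measurable lborel" for n
    unfolding u_def using borel_measurable_continuous_onI[OF cont[of n]] by measurable
  have liminf_top: "liminf (\<lambda>n. u n t) = top * indicator {a..b} t" for t
  proof (cases "t \<in> {a..b}")
    case True
    have "((\<lambda>n. ennreal (f n t)) \<longlongrightarrow> top) sequentially"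
      unfolding ennreal_tendsto_top_eq_at_top using lim[of t] True by simp
    then have "liminf (\<lambda>n. ennreal (f n t)) = top" by (rule lim_imp_Liminf[rotated]) simp
    then show ?thesis using True by (simp add: u_def)
  qed (simp add: u_def Liminf_const)
  have int: "(\<integral>\<^sup>+ t. u n t \<partial>lborel) \<le> ennreal B" for n
  proof -
    have "(\<integral>\<^sup>+ t. u n t \<partial>lborel) = ennreal (F n b - F n a)"
      unfolding u_def using borel_measurable_continuous_onI[OF cont[of n]] der nonneg ab
      by (intro nn_integral_FTC_Icc) auto
    then show ?thesis using bound[of n] by (simp add: ennreal_leI)
  qed
  have "(\<integral>\<^sup>+ t. liminf (\<lambda>n. u n t) \<partial>lborel) \<le> liminf (\<lambda>n. \<integral>\<^sup>+ t. u n t \<partial>lborel)"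
    by (rule nn_integral_liminf[OF meas])
  also have "\<dots> \<le> liminf (\<lambda>n::nat. ennreal B)" by (intro Liminf_mono always_eventually allI int)
  also have "\<dots> = ennreal B" by (simp add: Liminf_const)
  finally have "(\<integral>\<^sup>+ t. top * indicator {a..b} t \<partial>lborel) \<le> ennreal B" unfolding liminf_top .
  moreover have "(\<integral>\<^sup>+ t. top * indicator {a..b} t \<partial>lborel) = top"
    by (subst nn_integral_cmult_indicator) (use ab in \<open>auto simp: ennreal_top_mult\<close>)
  ultimately show False by (simp add: top_unique)
qed

lemma powr_of_real_times: "s > 0 \<Longrightarrow> z \<noteq> 0 \<Longrightarrow> (of_real s * z) powr a = of_real s powr a * z powr (a::complex)"
  using Ln_times_of_real[of s z] by (simp add: powr_def Ln_of_real distrib_left exp_add)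

lemma in_some_sector:
  assumes "Re \<zeta> > 0" shows "\<exists>M>1. \<zeta> \<in> sector M"
proof (intro exI[of _ "2 + norm \<zeta> / Re \<zeta>"] conjI)
  have "norm \<zeta> / Re \<zeta> \<ge> 0" using assms by simp
  then show "1 < 2 + norm \<zeta> / Re \<zeta>" by linarith
  show "\<zeta> \<in> sector (2 + norm \<zeta> / Re \<zeta>)" using assms by (simp add: sector_def algebra_simps)
qed

lemma sector_scale: "s > 0 \<Longrightarrow> \<zeta> \<in> sector M \<Longrightarrow> of_real s * \<zeta> \<in> sector M"
  by (simp add: sector_def norm_mult mult.left_commute)

lemma filterlim_ray_ang:
  assumes "Re \<zeta> > 0" shows "filterlim (\<lambda>s. of_real s * \<zeta>) ang (at_right (0::real))"
proof -
  obtain M where M: "M > 1" "\<zeta> \<in> sector M" using in_some_sector[OF assms] by blast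
  show ?thesis
  proof (rule filterlim_angI[OF M(1)])
    have "((\<lambda>s. of_real s * \<zeta>) \<longlongrightarrow> of_real 0 * \<zeta>) (at_right (0::real))" by (intro tendsto_intros)
    then show "((\<lambda>s. of_real s * \<zeta>) \<longlongrightarrow> 0) (at_right (0::real))" by simp
    show "\<forall>\<^sub>F s in at_right (0::real). of_real s * \<zeta> \<in> sector M"
      by (rule eventually_mono[OF eventually_at_right_less]) (use M sector_scale in auto)
  qed
qed

lemma ray_limit:
  fixes g :: "complex \<Rightarrow> complex"
  assumes lim: "((\<lambda>u. g u * u powr of_real (-\<beta>)) \<longlongrightarrow> C) ang" and \<zeta>: "Re \<zeta> > 0"
  shows "((\<lambda>s. g (of_real s * \<zeta>) / of_real (s powr \<beta>)) \<longlongrightarrow> C * \<zeta> powr of_real \<beta>) (at_right 0)"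
proof -
  have "((\<lambda>s. g (of_real s * \<zeta>) * (of_real s * \<zeta>) powr of_real (-\<beta>) * \<zeta> powr of_real \<beta>) \<longlongrightarrow> C * \<zeta> powr of_real \<beta>) (at_right (0::real))"
    by (intro tendsto_mult tendsto_const filterlim_compose[OF lim filterlim_ray_ang[OF \<zeta>]])
  then show ?thesis
  proof (rule Lim_transform_eventually)
    show "\<forall>\<^sub>F s in at_right (0::real). g (of_real s * \<zeta>) * (of_real s * \<zeta>) powr of_real (-\<beta>) * \<zeta> powr of_real \<beta>
        = g (of_real s * \<zeta>) / of_real (s powr \<beta>)"
    proof (rule eventually_mono[OF eventually_at_right_less])
      fix s :: real assume s: "s > 0"
      have z0: "\<zeta> \<noteq> 0" using \<zeta> by auto
      have "\<zeta> powr of_real (-\<beta>) * \<zeta> powr of_real \<beta> = 1" using z0 by (simp flip: powr_add)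
      moreover have "complex_of_real s powr of_real (-\<beta>) = inverse (of_real (s powr \<beta>))"
        using s by (simp add: powr_of_real powr_minus del: of_real_minus)
      ultimately show "g (of_real s * \<zeta>) * (of_real s * \<zeta>) powr of_real (-\<beta>) * \<zeta> powr of_real \<beta>
        = g (of_real s * \<zeta>) / of_real (s powr \<beta>)"
        unfolding powr_of_real_times[OF s z0] by (simp only: mult.assoc mult_1_right divide_inverse)
    qed
  qed
qed

text \<open>Approach to the boundary point b at the exact rate \<open>s powr \<beta>\<close>. C is
  the limiting direction in the coordinate \<open>1 - cnj b * z\<close>, and \<open>Re C > 0\<close>
  makes the approach nontangential.\<close>

definition approaches :: "real \<Rightarrow> (real \<Rightarrow> complex) \<Rightarrow> complex \<Rightarrow> complex \<Rightarrow> bool" where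
  "approaches \<beta> f b C \<longleftrightarrow> norm b = 1 \<and> Re C > 0 \<and>
     ((\<lambda>s. (1 - cnj b * f s) / of_real (s powr \<beta>)) \<longlongrightarrow> C) (at_right 0)"

text \<open>With \<open>g = 1 - cnj b * f\<close> one has
  \<open>1 - (norm f)^2 = 2 * Re g - (norm g)^2\<close>, where the quadratic term is negligible. An
  aperture larger than \<open>norm C / Re C\<close> contains g eventually.\<close>

lemma approaches_facts:
  assumes ap: "approaches \<beta> f b C" and \<beta>: "\<beta> > 0"
  shows "((\<lambda>s. 1 - cnj b * f s) \<longlongrightarrow> 0) (at_right 0)" "(f \<longlongrightarrow> b) (at_right 0)"
    "((\<lambda>s. (1 - (norm (f s))\<^sup>2) / s powr \<beta>) \<longlongrightarrow> 2 * Re C) (at_right 0)"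
    "((\<lambda>s. norm (b - f s) / s powr \<beta>) \<longlongrightarrow> norm C) (at_right 0)"
    "filterlim (\<lambda>s. 1 - cnj b * f s) ang (at_right 0)"
proof -
  define g where "g = (\<lambda>s. 1 - cnj b * f s)"
  define e where "e = (\<lambda>s. g s / of_real (s powr \<beta>))"
  have b: "norm b = 1" and C: "Re C > 0" and e: "(e \<longlongrightarrow> C) (at_right 0)"
    using ap by (auto simp: approaches_def e_def g_def)
  have pos: "\<forall>\<^sub>F s in at_right (0::real). s > 0" by (rule eventually_at_right_less)
  have s0: "((\<lambda>s::real. s powr \<beta>) \<longlongrightarrow> 0) (at_right 0)"
  proof -
    have "((\<lambda>s::real. s powr \<beta>) \<longlongrightarrow> 0 powr \<beta>) (at_right 0)"
      using \<beta> eventually_mono[OF pos less_imp_le] by (intro tendsto_powr' tendsto_ident_at tendsto_const) simp_all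
    then show ?thesis by simp
  qed
  have ge: "g s = e s * of_real (s powr \<beta>)" if "s > 0" for s using that by (simp add: e_def)
  have "((\<lambda>s. e s * of_real (s powr \<beta>)) \<longlongrightarrow> C * of_real 0) (at_right 0)"
    by (intro tendsto_intros e s0)
  then have "((\<lambda>s. e s * of_real (s powr \<beta>)) \<longlongrightarrow> 0) (at_right 0)" by simp
  then have g0: "(g \<longlongrightarrow> 0) (at_right 0)"
    by (rule Lim_transform_eventually) (rule eventually_mono[OF pos], simp add: ge)
  then show "((\<lambda>s. 1 - cnj b * f s) \<longlongrightarrow> 0) (at_right 0)" by (simp add: g_def)
  have fg: "f s = b * (1 - g s)" for s
    using unit_mult_cnj[OF b] by (simp add: g_def flip: mult.assoc)
  have "((\<lambda>s. b * (1 - g s)) \<longlongrightarrow> b * (1 - 0)) (at_right 0)" by (intro tendsto_intros g0)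
  then show "(f \<longlongrightarrow> b) (at_right 0)" by (simp add: fg[abs_def])
  have "((\<lambda>s. 2 * Re (e s) - norm (e s) * norm (g s)) \<longlongrightarrow> 2 * Re C - norm C * norm (0::complex)) (at_right 0)"
    by (intro tendsto_intros e g0)
  then have "((\<lambda>s. 2 * Re (e s) - norm (e s) * norm (g s)) \<longlongrightarrow> 2 * Re C) (at_right 0)" by simp
  then show "((\<lambda>s. (1 - (norm (f s))\<^sup>2) / s powr \<beta>) \<longlongrightarrow> 2 * Re C) (at_right 0)"
  proof (rule Lim_transform_eventually)
    show "\<forall>\<^sub>F s in at_right 0. 2 * Re (e s) - norm (e s) * norm (g s) = (1 - (norm (f s))\<^sup>2) / s powr \<beta>"
      using pos
    proof eventually_elim
      case (elim s)
      have "1 - (norm (f s))\<^sup>2 = 2 * Re (g s) - norm (g s) * norm (g s)"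
        unfolding fg norm_mult b using norm_one_minus_sq[of "g s"] by (simp add: power2_eq_square)
      moreover have "Re (e s) = Re (g s) / s powr \<beta>" unfolding e_def by (rule Re_divide_of_real)
      moreover have "norm (e s) = norm (g s) / s powr \<beta>" by (simp add: e_def norm_divide)
      ultimately show ?case by (simp add: diff_divide_distrib)
    qed
  qed
  have "norm (b - f s) / s powr \<beta> = norm (e s)" for s
    using norm_one_minus_cnj_mult[OF b, of "f s"] by (simp add: e_def g_def norm_divide)
  then show "((\<lambda>s. norm (b - f s) / s powr \<beta>) \<longlongrightarrow> norm C) (at_right 0)"
    using tendsto_norm[OF e] by simp
  define M where "M = 2 + norm C / Re C"
  have M: "M > 1" using C by (simp add: M_def add_pos_nonneg)
  have "((\<lambda>s. M * Re (e s) - norm (e s)) \<longlongrightarrow> M * Re C - norm C) (at_right 0)" by (intro tendsto_intros e)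
  moreover have "M * Re C - norm C > 0" using C by (simp add: M_def field_simps)
  ultimately have "\<forall>\<^sub>F s in at_right 0. 0 < M * Re (e s) - norm (e s)" by (rule order_tendstoD)
  then have "\<forall>\<^sub>F s in at_right 0. g s \<in> sector M"
    using pos
  proof eventually_elim
    case (elim s)
    have "norm (g s) = norm (e s) * s powr \<beta>" unfolding ge[OF elim(2)] by (simp add: norm_mult)
    also have "\<dots> < M * Re (e s) * s powr \<beta>" using elim by (intro mult_strict_right_mono) auto
    also have "\<dots> = M * Re (g s)" unfolding ge[OF elim(2)] by simp
    finally show ?case by (simp add: sector_def)
  qed
  from filterlim_angI[OF M g0 this] show "filterlim (\<lambda>s. 1 - cnj b * f s) ang (at_right 0)"
    by (simp add: g_def)
qed

section \<open>Boundary value of the semigroup at x\<close>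

context boundary_regularity
begin

abbreviation \<beta> where "\<beta> \<equiv> 1 - \<alpha>"

lemma real_cap: "\<rho> > 0 \<Longrightarrow> \<forall>\<^sub>F s in at_right 0. complex_of_real s \<in> cap \<rho>"
  using filterlim_of_real_ang eventually_ang_cap[of \<rho>] unfolding filterlim_iff by blast

lemma of_real_powr: "s > 0 \<Longrightarrow> complex_of_real s powr of_real a = of_real (s powr a)"
  by (simp add: powr_of_real)

lemma norm_pt_real:
  assumes "s < 1" shows "1 - (norm (pt (of_real s)))\<^sup>2 = s * (2 - s)"
proof -
  have "norm (1 - complex_of_real s) = \<bar>1 - s\<bar>" by (metis norm_of_real of_real_1 of_real_diff)
  then have n: "norm (pt (of_real s)) = 1 - s" using x assms by (simp add: norm_mult)
  show ?thesis unfolding n by (simp add: power2_eq_square algebra_simps)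
qed

lemma phi_limit:
  assumes "t \<ge> 0" "phi_regular t"
  obtains y E M where "E \<noteq> 0" "M \<noteq> 0" "((\<lambda>u. deriv (\<phi> t) (pt u) * u powr of_real \<alpha>) \<longlongrightarrow> E) ang"
    "((\<lambda>u. \<phi> t (pt u)) \<longlongrightarrow> y) ang" "((\<lambda>u. (\<phi> t (pt u) - y) * u powr of_real (\<alpha> - 1)) \<longlongrightarrow> M) ang"
    "norm y \<le> 1"
proof -
  obtain E where E: "E \<noteq> 0" "((\<lambda>u. deriv (\<phi> t) (pt u) * u powr of_real \<alpha>) \<longlongrightarrow> E) ang"
    using assms unfolding phi_regular_def by blast
  obtain y where y: "((\<lambda>u. \<phi> t (pt u)) \<longlongrightarrow> y) ang"
    "((\<lambda>u. (\<phi> t (pt u) - y) * u powr of_real (\<alpha> - 1)) \<longlongrightarrow> - x * E / of_real (1 - \<alpha>)) ang"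
    by (rule deriv_to_values[OF phi_hol[OF assms(1)] E(2)])
  have "- x * E / complex_of_real (1 - \<alpha>) \<noteq> 0" using E x_nz alpha by (simp del: of_real_diff)
  moreover have "norm y \<le> 1"
  proof (rule tendsto_upperbound[OF tendsto_norm[OF y(1)]])
    show "\<forall>\<^sub>F u in ang. norm (\<phi> t (pt u)) \<le> 1"
      by (rule eventually_mono[OF eventually_ang_cap[of 1]]) (auto intro: less_imp_le phi_norm assms pt_in)
  qed simp
  ultimately show ?thesis using that E y by blast
qed

text \<open>\<open>deriv (\<phi> t) * G = G \<circ> \<phi> t\<close> tends to \<open>G y\<close>.
  This is not 0: \<tau> is fixed by the injective \<open>\<phi> t\<close> when it is interior, and
  an injective map does not attain its boundary value inside.\<close>

lemma G_regular_of_interior_value: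
  assumes t: "t \<ge> 0" and reg: "phi_regular t" and y: "((\<lambda>u. \<phi> t (pt u)) \<longlongrightarrow> y) ang" "norm y < 1"
  shows G_regular
proof -
  obtain E where E: "E \<noteq> 0" "((\<lambda>u. deriv (\<phi> t) (pt u) * u powr of_real \<alpha>) \<longlongrightarrow> E) ang"
    using reg unfolding phi_regular_def by blast
  have yt: "y \<noteq> \<tau>"
    using injective_boundary_value_not_attained[OF phi_hol[OF t] phi_inj[OF t] x y(1), of \<tau>] phi_tau[OF _ t] y by auto
  have "isCont G y"
    using y(2) by (intro continuous_on_interior[OF holomorphic_on_imp_continuous_on[OF G_hol]]) auto
  then have Gy: "((\<lambda>u. G (\<phi> t (pt u))) \<longlongrightarrow> G y) ang" by (rule isCont_tendsto_compose[OF _ y(1)])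
  have lim: "((\<lambda>u. G (\<phi> t (pt u)) / (deriv (\<phi> t) (pt u) * u powr of_real \<alpha>)) \<longlongrightarrow> G y / E) ang"
    by (intro tendsto_intros Gy E)
  have nz: "deriv (\<phi> t) (pt u) \<noteq> 0" if "u \<in> cap 1" for u
    using pt_in[OF that] by (intro holomorphic_injective_imp_regular[OF phi_hol[OF t] _ phi_inj[OF t]]) auto
  have "((\<lambda>u. G (pt u) * u powr of_real (-\<alpha>)) \<longlongrightarrow> G y / E) ang"
  proof (rule ang_cong[OF lim zero_less_one])
    fix u :: complex assume u: "u \<in> cap 1"
    show "G (\<phi> t (pt u)) / (deriv (\<phi> t) (pt u) * u powr of_real \<alpha>) = G (pt u) * u powr of_real (-\<alpha>)"
      unfolding G_phi[OF t pt_in[OF u], symmetric] using nz[OF u] cap_nonzero[OF u]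
      by (simp add: powr_minus divide_inverse)
  qed simp
  moreover have "G y \<noteq> 0" by (rule G_nz[OF y(2) yt])
  ultimately show ?thesis unfolding G_regular_def using E by (intro exI[of _ "G y / E"]) auto
qed

text \<open>Schwarz-Pick at 0 keeps \<open>1 - (norm (\<phi> t z))^2\<close> above a positive
  multiple of s. A limit y on the circle would be approached with error of order
  \<open>s powr (1 - \<alpha>)\<close>, which is o(s) for negative \<alpha>.\<close>

lemma interior_value_if_negative:
  assumes t: "t \<ge> 0" and neg: "\<alpha> < 0" and lim: "((\<lambda>u. \<phi> t (pt u)) \<longlongrightarrow> y) ang"
    "((\<lambda>u. (\<phi> t (pt u) - y) * u powr of_real (\<alpha> - 1)) \<longlongrightarrow> M) ang"
  shows "norm y \<noteq> 1"
proof
  assume y: "norm y = 1"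
  interpret disc_self_map "\<phi> t" by (rule self_map[OF t])
  define c where "c = (1 - norm (\<phi> t 0))\<^sup>2"
  have c: "c > 0" using self[of 0] by (simp add: c_def)
  have low: "c * (1 - (norm z)\<^sup>2) \<le> 1 - (norm (\<phi> t z))\<^sup>2" if z: "norm z < 1" for z
  proof -
    have A: "1 - (norm z)\<^sup>2 > 0" "1 - (norm (\<phi> t z))\<^sup>2 > 0" using one_minus_norm_sq_pos z self by auto
    have "norm (cnj (\<phi> t 0) * \<phi> t z) \<le> norm (\<phi> t 0) * 1"
      unfolding norm_mult using self[OF z] by (intro mult_mono) auto
    then have "1 - norm (\<phi> t 0) \<le> norm (1 - cnj (\<phi> t 0) * \<phi> t z)"
      using norm_triangle_ineq2[of 1 "cnj (\<phi> t 0) * \<phi> t z"] by simp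
    then have "c \<le> (norm (1 - cnj (\<phi> t 0) * \<phi> t z))\<^sup>2"
      unfolding c_def using self[of 0] by (intro power_mono) auto
    then have "(1 - (norm z)\<^sup>2) * c \<le> (1 - (norm z)\<^sup>2) * (norm (1 - cnj (\<phi> t 0) * \<phi> t z))\<^sup>2"
      using A by (intro mult_left_mono) auto
    also have "\<dots> \<le> (1 - (norm (\<phi> t 0))\<^sup>2) * (1 - (norm (\<phi> t z))\<^sup>2)"
      using schwarz_pick_sq[of 0 z] z by simp
    also have "\<dots> \<le> 1 * (1 - (norm (\<phi> t z))\<^sup>2)" using A by (intro mult_right_mono) auto
    finally show ?thesis by (simp add: mult.commute)
  qed
  have "((\<lambda>u. 2 * norm ((\<phi> t (pt u) - y) * u powr of_real (\<alpha> - 1)) * norm (u powr of_real (-\<alpha>))) \<longlongrightarrow> 2 * norm M * norm (0::complex)) ang"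
    using neg by (intro tendsto_intros lim powr_of_real_tendsto_0_ang) auto
  then have "((\<lambda>u. 2 * norm ((\<phi> t (pt u) - y) * u powr of_real (\<alpha> - 1)) * norm (u powr of_real (-\<alpha>))) \<longlongrightarrow> 0) ang" by simp
  from filterlim_compose[OF this filterlim_of_real_ang]
  have "\<forall>\<^sub>F s in at_right 0. 2 * norm ((\<phi> t (pt (of_real s)) - y) * of_real s powr of_real (\<alpha> - 1))
      * norm (complex_of_real s powr of_real (-\<alpha>)) < c"
    using c by (rule order_tendstoD)
  then have "\<forall>\<^sub>F s in at_right (0::real). False"
    using eventually_at_right_real[of 0 1, OF zero_less_one]
  proof eventually_elim
    case (elim s)
    then have s: "0 < s" "s < 1" by auto
    define z where "z = pt (of_real s)"
    have z2: "1 - (norm z)\<^sup>2 = s * (2 - s)" unfolding z_def by (rule norm_pt_real[OF s(2)])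
    have "s * (2 - s) > 0" using s by simp
    then have "(norm z)\<^sup>2 < 1\<^sup>2" using z2 by simp
    then have z1: "norm z < 1" by (rule power_less_imp_less_base) simp
    have "s * 1 \<le> s * (2 - s)" using s by (intro mult_left_mono) auto
    then have "c * s \<le> c * (1 - (norm z)\<^sup>2)" using c z2 by simp
    also have "\<dots> \<le> 1 - (norm (\<phi> t z))\<^sup>2" by (rule low[OF z1])
    also have "\<dots> = (1 - norm (\<phi> t z)) * (1 + norm (\<phi> t z))" by (simp add: power2_eq_square algebra_simps)
    also have "\<dots> \<le> (1 - norm (\<phi> t z)) * 2" using self[OF z1] by (intro mult_left_mono) auto
    also have "1 - norm (\<phi> t z) \<le> norm (\<phi> t z - y)"
      using norm_triangle_ineq2[of y "\<phi> t z"] y by (simp add: norm_minus_commute)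
    finally have 1: "c * s \<le> 2 * norm (\<phi> t z - y)" by simp
    have "s powr (\<alpha> - 1) * s powr (-\<alpha>) = s powr (- 1)" unfolding powr_add[symmetric] by simp
    also have "\<dots> = 1 / s" using s by (simp add: powr_minus divide_inverse)
    finally have e: "s powr (\<alpha> - 1) * s powr (-\<alpha>) = 1 / s" .
    have "2 * norm (\<phi> t z - y) * (s powr (\<alpha> - 1) * s powr (-\<alpha>)) < c"
      using elim s by (simp add: norm_mult norm_powr_real_powr' z_def mult.assoc del: of_real_diff of_real_minus)
    then have "2 * norm (\<phi> t z - y) / s < c" unfolding e by simp
    then show False using 1 s by (simp add: divide_less_eq)
  qed
  then show False by (simp add: eventually_False)
qed

text \<open>\<open>g = 1 - cnj y * \<phi> t\<close> has nonnegative real part, so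
  \<open>Re (C * \<zeta> powr \<beta>) \<ge> 0\<close> for every direction \<zeta> in the right
  half-plane. Two directions symmetric about the axis already exclude
  \<open>Re C \<le> 0\<close>.\<close>

lemma contact_approaches:
  assumes t: "t \<ge> 0" and pos: "\<alpha> > 0" and M: "M \<noteq> 0" and lim: "((\<lambda>u. \<phi> t (pt u)) \<longlongrightarrow> y) ang"
    "((\<lambda>u. (\<phi> t (pt u) - y) * u powr of_real (\<alpha> - 1)) \<longlongrightarrow> M) ang" and y: "norm y = 1"
  obtains C where "approaches \<beta> (\<lambda>s. \<phi> t (pt (of_real s))) y C"
proof -
  define C where "C = - cnj y * M"
  have C0: "C \<noteq> 0" using M y by (auto simp: C_def)
  define g where "g = (\<lambda>u. 1 - cnj y * \<phi> t (pt u))"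
  have yy: "cnj y * y = 1" by (subst mult.commute) (rule unit_mult_cnj[OF y])
  have gC: "((\<lambda>u. g u * u powr of_real (\<alpha> - 1)) \<longlongrightarrow> C) ang"
  proof -
    have "((\<lambda>u. - cnj y * ((\<phi> t (pt u) - y) * u powr of_real (\<alpha> - 1))) \<longlongrightarrow> - cnj y * M) ang"
      by (intro tendsto_intros lim)
    moreover have "- cnj y * (\<phi> t (pt u) - y) = g u" for u
      by (simp add: g_def algebra_simps unit_mult_cnj[OF y])
    then have "- cnj y * ((\<phi> t (pt u) - y) * u powr of_real (\<alpha> - 1)) = g u * u powr of_real (\<alpha> - 1)" for u
      by (simp only: mult.assoc[symmetric])
    ultimately show ?thesis unfolding C_def by simp
  qed
  have gRe: "Re (g u) \<ge> 0" if "u \<in> cap 1" for u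
  proof -
    have "Re (cnj y * \<phi> t (pt u)) \<le> norm (cnj y * \<phi> t (pt u))" by (rule complex_Re_le_cmod)
    also have "\<dots> < 1" using phi_norm[OF t pt_in[OF that]] y by (simp add: norm_mult)
    finally show ?thesis by (simp add: g_def)
  qed
  \<comment> \<open>As \<open>\<beta> < 1\<close> here, \<beta> times \<open>pi / 3\<close> stays
    below \<open>pi / 2\<close>, which makes its cosine and sine positive. The angle itself is
    chosen for its explicit cosine.\<close>
  have dir: "Re (C * exp (of_real \<beta> * (\<i> * of_real \<theta>))) \<ge> 0" if \<theta>: "\<theta> = pi / 3 \<or> \<theta> = - pi / 3" for \<theta> :: real
  proof -
    define \<zeta> where "\<zeta> = exp (\<i> * of_real \<theta>)"
    have Rz: "Re \<zeta> = 1 / 2" 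
    proof -
      have "cos \<theta> = 1 / 2" using \<theta> cos_60 by (metis cos_minus minus_divide_left)
      then show ?thesis by (simp add: \<zeta>_def Re_exp)
    qed
    have nz: "norm \<zeta> = 1" by (simp add: \<zeta>_def)
    have Lnz: "Ln \<zeta> = \<i> * of_real \<theta>" 
    proof -
      have "- pi < \<theta>" "\<theta> \<le> pi" using \<theta> pi_gt_zero by linarith+
      then show ?thesis unfolding \<zeta>_def by (intro Ln_exp) auto
    qed
    have fl: "filterlim (\<lambda>s. of_real s * \<zeta>) ang (at_right (0::real))"
      by (rule filterlim_ray_ang) (simp add: Rz)
    have "((\<lambda>u. g u * u powr of_real (- \<beta>)) \<longlongrightarrow> C) ang" using gC by simp
    then have "((\<lambda>s. g (of_real s * \<zeta>) / of_real (s powr \<beta>)) \<longlongrightarrow> C * \<zeta> powr of_real \<beta>) (at_right 0)"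
      by (rule ray_limit) (simp add: Rz)
    from tendsto_Re[OF this] have "0 \<le> Re (C * \<zeta> powr of_real \<beta>)"
    proof (rule tendsto_lowerbound)
      have "\<forall>\<^sub>F s in at_right (0::real). of_real s * \<zeta> \<in> cap 1"
        using fl[unfolded filterlim_iff, rule_format, OF eventually_ang_cap[of 1]] by simp
      then show "\<forall>\<^sub>F s in at_right (0::real). 0 \<le> Re (g (of_real s * \<zeta>) / of_real (s powr \<beta>))"
        by (rule eventually_mono) (simp add: gRe Re_divide_of_real del: of_real_diff)
    qed simp
    moreover have "\<zeta> powr of_real \<beta> = exp (of_real \<beta> * (\<i> * of_real \<theta>))"
      using nz by (auto simp: powr_def Lnz simp del: of_real_diff)
    ultimately show ?thesis by simp
  qed
  define b where "b = \<beta> * (pi / 3)"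
  have b: "0 < b" "b < pi / 2" using alpha pos
  proof -
    have "\<beta> * (pi / 3) < 1 * (pi / 3)" using pos by (intro mult_strict_right_mono) auto
    then show "b < pi / 2" unfolding b_def using pi_gt_zero by linarith
  qed (use alpha in \<open>simp add: b_def\<close>)
  have cs: "cos b > 0" "sin b > 0"
    using b by (auto intro!: cos_gt_zero_pi sin_gt_zero)
  have e1: "Re C * cos b - Im C * sin b \<ge> 0"
    using dir[of "pi / 3"] by (simp add: Re_exp Im_exp b_def)
  have e2: "Re C * cos b + Im C * sin b \<ge> 0"
    using dir[of "- pi / 3"] by (simp add: Re_exp Im_exp b_def)
  have "Re C > 0"
  proof (rule ccontr)
    assume "\<not> Re C > 0"
    then have "Re C * cos b \<le> 0" using cs by (simp add: mult_nonpos_nonneg)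
    moreover have "Re C * cos b \<ge> 0" using e1 e2 by linarith
    ultimately have 1: "Re C * cos b = 0" by linarith
    then have "Im C * sin b = 0" using e1 e2 by linarith
    with 1 cs C0 show False by (simp add: complex_eq_iff)
  qed
  moreover have "((\<lambda>s. (1 - cnj y * \<phi> t (pt (of_real s))) / of_real (s powr \<beta>)) \<longlongrightarrow> C) (at_right 0)"
    by (rule Lim_transform_eventually[OF filterlim_compose[OF gC filterlim_of_real_ang]],
        rule eventually_mono[OF eventually_at_right_less[of "0::real"]])
       (simp only: of_real_powr g_def divide_inverse of_real_inverse[symmetric] powr_minus[symmetric] minus_diff_eq)
  ultimately show ?thesis using that[of C] y unfolding approaches_def by blast
qed

end


section \<open>Two contact times for positive \<alpha>\<close>

lemma tendsto_eventually_bounded: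
  fixes f :: "'a \<Rightarrow> real"
  assumes "(f \<longlongrightarrow> l) F"
  shows "\<exists>K. \<forall>\<^sub>F x in F. f x < K"
  using order_tendstoD(2)[OF assms, of "l + 1"] by auto

context boundary_regularity
begin

lemma small_real: "\<forall>\<^sub>F s in at_right (0::real). 0 < s \<and> s < 1 \<and> norm (pt (of_real s)) < 1"
  using eventually_at_right_real[of 0 1, OF zero_less_one] real_cap[of 1, OF zero_less_one]
  by eventually_elim (auto intro: pt_in)

lemma pt_powr_comb: "s > 0 \<Longrightarrow> s powr \<alpha> * s powr (1 - \<alpha>) = (s::real)"
  by (simp flip: powr_add)

text \<open>In time t the orbit goes from boundary distance of order s to order
  \<open>s powr (1 - \<alpha>)\<close>. The logarithm of the ratio grows like
  \<open>- \<alpha> * ln s\<close>, while \<open>boundary_distance_growth\<close> bounds it by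
  \<open>2 * t * v\<close>.\<close>

lemma v_at_infinity:
  assumes t: "t > 0" and pos: "\<alpha> > 0" and ap: "approaches \<beta> (\<lambda>s. \<phi> t (pt (of_real s))) y C"
  shows "filterlim (\<lambda>s. v (pt (of_real s))) at_top (at_right 0)"
proof -
  define D where "D = (\<lambda>s. (1 - (norm (\<phi> t (pt (of_real s))))\<^sup>2) / s powr \<beta>)"
  have \<beta>: "\<beta> > 0" using alpha by simp
  have C: "Re C > 0" using ap by (simp add: approaches_def)
  have D: "(D \<longlongrightarrow> 2 * Re C) (at_right 0)" unfolding D_def by (rule approaches_facts(3)[OF ap \<beta>])
  have "((\<lambda>s. (ln (D s) - ln (2 - s)) / (2 * t)) \<longlongrightarrow> (ln (2 * Re C) - ln (2 - 0)) / (2 * t)) (at_right 0)"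
    using C t by (intro tendsto_intros D tendsto_ident_at) auto
  moreover have "filterlim (\<lambda>s::real. (\<alpha> / (2 * t)) * (- ln s)) at_top (at_right 0)"
    using pos t filterlim_uminus_at_bot[of ln "at_right (0::real)"] ln_at_0
    by (intro filterlim_tendsto_pos_mult_at_top[OF tendsto_const]) auto
  ultimately have "filterlim (\<lambda>s. (ln (D s) - ln (2 - s)) / (2 * t) + (\<alpha> / (2 * t)) * (- ln s)) at_top (at_right 0)"
    by (rule filterlim_tendsto_add_at_top)
  then show ?thesis
  proof (rule filterlim_at_top_mono)
    show "\<forall>\<^sub>F s in at_right 0. (ln (D s) - ln (2 - s)) / (2 * t) + (\<alpha> / (2 * t)) * (- ln s) \<le> v (pt (of_real s))"
      using small_real
    proof eventually_elim
      case (elim s)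
      define z where "z = pt (of_real s)"
      have z: "norm z < 1" using elim by (simp add: z_def)
      have A: "1 - (norm (\<phi> t z))\<^sup>2 > 0" using t by (intro one_minus_norm_sq_pos phi_norm z) auto
      have "ln (D s) = ln (1 - (norm (\<phi> t z))\<^sup>2) - \<beta> * ln s"
        unfolding D_def z_def[symmetric] using A elim by (subst ln_div) (auto simp: ln_powr)
      moreover have "ln (1 - (norm z)\<^sup>2) = ln s + ln (2 - s)"
        unfolding z_def using elim by (simp add: norm_pt_real ln_mult)
      moreover have "ln (1 - (norm (\<phi> t z))\<^sup>2) - ln (1 - (norm z)\<^sup>2) \<le> 2 * v z * t"
        using t by (intro boundary_distance_growth z) auto
      ultimately have "ln (D s) - ln (2 - s) - \<alpha> * ln s \<le> v z * (2 * t)" by (simp add: algebra_simps)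
      then have "(ln (D s) - ln (2 - s) - \<alpha> * ln s) / (2 * t) \<le> v z" using t by (simp add: divide_le_eq)
      then show ?case unfolding z_def by (simp add: diff_divide_distrib)
    qed
  qed
qed

text \<open>The quotient of the speeds at \<open>\<phi> t z\<close> and z is \<open>norm (deriv
  (\<phi> t) z) * (1 - (norm z)^2) / (1 - (norm (\<phi> t z))^2)\<close>. It has a positive limit,
  since \<open>s powr \<alpha> * s powr \<beta> = s\<close>.\<close>

lemma v_phi_at_infinity:
  assumes t: "t \<ge> 0" and v: "filterlim (\<lambda>s. v (pt (of_real s))) at_top (at_right 0)"
    and E: "E \<noteq> 0" "((\<lambda>s. deriv (\<phi> t) (pt (of_real s)) * of_real (s powr \<alpha>)) \<longlongrightarrow> E) (at_right 0)"
    and ap: "approaches \<beta> (\<lambda>s. \<phi> t (pt (of_real s))) y C"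
  shows "filterlim (\<lambda>s. v (\<phi> t (pt (of_real s)))) at_top (at_right 0)"
proof -
  define D where "D = (\<lambda>s. (1 - (norm (\<phi> t (pt (of_real s))))\<^sup>2) / s powr \<beta>)"
  define N where "N = (\<lambda>s. norm (deriv (\<phi> t) (pt (of_real s)) * of_real (s powr \<alpha>)))"
  have \<beta>: "\<beta> > 0" using alpha by simp
  have C: "Re C > 0" using ap by (simp add: approaches_def)
  have D: "(D \<longlongrightarrow> 2 * Re C) (at_right 0)" unfolding D_def by (rule approaches_facts(3)[OF ap \<beta>])
  have "((\<lambda>s. N s * (2 - s) / D s) \<longlongrightarrow> norm E * (2 - 0) / (2 * Re C)) (at_right 0)"
    unfolding N_def using C by (intro tendsto_intros D E tendsto_ident_at) auto
  moreover have "norm E * (2 - 0) / (2 * Re C) > 0" using E C by simp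
  ultimately have "filterlim (\<lambda>s. N s * (2 - s) / D s * v (pt (of_real s))) at_top (at_right 0)"
    by (rule filterlim_tendsto_pos_mult_at_top[OF _ _ v])
  then show ?thesis
  proof (rule filterlim_mono_eventually[OF _ order_refl order_refl])
    show "\<forall>\<^sub>F s in at_right 0. N s * (2 - s) / D s * v (pt (of_real s)) = v (\<phi> t (pt (of_real s)))"
      using small_real
    proof eventually_elim
      case (elim s)
      define z where "z = pt (of_real s)"
      have z: "norm z < 1" using elim by (simp add: z_def)
      have A: "1 - (norm (\<phi> t z))\<^sup>2 > 0" by (intro one_minus_norm_sq_pos phi_norm z t)
      have zz: "1 - (norm z)\<^sup>2 = s * (2 - s)" unfolding z_def using elim by (intro norm_pt_real) auto
      have sp: "s powr \<alpha> > 0" "s powr \<beta> > 0" "s powr \<alpha> * s powr \<beta> = s" using elim pt_powr_comb by auto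
      have N: "N s = norm (deriv (\<phi> t) z) * s powr \<alpha>" unfolding N_def z_def using sp by (simp add: norm_mult)
      have "v (\<phi> t z) = norm (deriv (\<phi> t) z) * norm (G z) / (1 - (norm (\<phi> t z))\<^sup>2)"
        unfolding v_def G_phi[OF t z, symmetric] by (simp add: norm_mult)
      also have "\<dots> = (norm (deriv (\<phi> t) z) * s powr \<alpha>) * (2 - s) * s powr \<beta> / (1 - (norm (\<phi> t z))\<^sup>2) * (norm (G z) / ((s powr \<alpha> * s powr \<beta>) * (2 - s)))"
        using elim sp(1,2) by simp
      also have "\<dots> = N s * (2 - s) / D s * v z"
        unfolding sp(3) N D_def z_def[symmetric] v_def zz by simp
      finally show ?case unfolding z_def by simp
    qed
  qed
qed

text \<open>Under nontangential approach \<open>norm (b - f s)\<close> and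
  \<open>1 - (norm (f s))^2\<close> are comparable, so a bound of this kind would keep
  \<open>v (f s)\<close> bounded.\<close>

lemma no_Julia_bound:
  assumes ap: "approaches \<beta> f b C" and f: "\<forall>\<^sub>F s in at_right 0. norm (f s) < 1"
    and v: "filterlim (\<lambda>s. v (f s)) at_top (at_right 0)"
    and K: "\<And>z. norm z < 1 \<Longrightarrow> norm (G z) * (1 - (norm z)\<^sup>2) \<le> K * (norm (b - z))\<^sup>2"
  shows False
proof -
  have \<beta>: "\<beta> > 0" using alpha by simp
  have C: "Re C > 0" using ap by (simp add: approaches_def)
  define D where "D = (\<lambda>s. (1 - (norm (f s))\<^sup>2) / s powr \<beta>)"
  define N where "N = (\<lambda>s. norm (b - f s) / s powr \<beta>)"
  have D: "(D \<longlongrightarrow> 2 * Re C) (at_right 0)" unfolding D_def by (rule approaches_facts(3)[OF ap \<beta>])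
  have N: "(N \<longlongrightarrow> norm C) (at_right 0)" unfolding N_def by (rule approaches_facts(4)[OF ap \<beta>])
  have "((\<lambda>s. K * (N s)\<^sup>2 / (D s)\<^sup>2) \<longlongrightarrow> K * (norm C)\<^sup>2 / (2 * Re C)\<^sup>2) (at_right 0)"
    using C by (intro tendsto_intros N D) auto
  then have ev1: "\<forall>\<^sub>F s in at_right 0. K * (N s)\<^sup>2 / (D s)\<^sup>2 < K * (norm C)\<^sup>2 / (2 * Re C)\<^sup>2 + 1"
    by (rule order_tendstoD) simp
  have ev2: "\<forall>\<^sub>F s in at_right 0. K * (norm C)\<^sup>2 / (2 * Re C)\<^sup>2 + 1 \<le> v (f s)"
    using v unfolding filterlim_at_top by blast
  have "\<forall>\<^sub>F s in at_right (0::real). False"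
    using ev1 ev2 f eventually_at_right_less[of "0::real"]
  proof eventually_elim
    case (elim s)
    have A: "1 - (norm (f s))\<^sup>2 > 0" using elim one_minus_norm_sq_pos by blast
    have "v (f s) = norm (G (f s)) * (1 - (norm (f s))\<^sup>2) / (1 - (norm (f s))\<^sup>2)\<^sup>2"
      using A by (simp add: v_def power2_eq_square)
    also have "\<dots> \<le> K * (norm (b - f s))\<^sup>2 / (1 - (norm (f s))\<^sup>2)\<^sup>2"
      using K[OF elim(3)] by (intro divide_right_mono) auto
    also have "\<dots> = K * (N s)\<^sup>2 / (D s)\<^sup>2" unfolding N_def D_def using elim(4) by (simp add: power_divide)
    finally show False using elim by linarith
  qed
  then show False by (simp add: eventually_False)
qed

lemma norm_tau_factor_bound: "norm z < 1 \<Longrightarrow> norm (1 - cnj \<tau> * z) \<le> 2"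
proof -
  assume z: "norm z < 1"
  have "norm \<tau> * norm z \<le> 1 * 1" using z norm_tau by (intro mult_mono) auto
  then show ?thesis using norm_triangle_ineq4[of 1 "cnj \<tau> * z"] by (simp add: norm_mult)
qed

text \<open>At \<open>b = \<tau>\<close> both Berkson-Porta factors have modulus
  \<open>norm (b - z)\<close>, and \<open>norm (p z) * (1 - (norm z)^2)\<close> is bounded;
  \<open>no_Julia_bound\<close> excludes exactly this.\<close>

lemma contact_value_neq_tau:
  assumes ap: "approaches \<beta> f b C" and f: "\<forall>\<^sub>F s in at_right 0. norm (f s) < 1"
    and v: "filterlim (\<lambda>s. v (f s)) at_top (at_right 0)"
  shows "b \<noteq> \<tau>"
proof
  assume b: "b = \<tau>"
  have nb: "norm b = 1" using ap by (simp add: approaches_def)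
  obtain p where p: "p holomorphic_on ball 0 1" "\<And>z. norm z < 1 \<Longrightarrow> Re (p z) \<ge> 0"
    "\<And>z. norm z < 1 \<Longrightarrow> G z = (\<tau> - z) * (1 - cnj \<tau> * z) * p z"
    "\<And>z. norm z < 1 \<Longrightarrow> m z = (norm (\<tau> - z))\<^sup>2 * Re (p z) / (1 - (norm z)\<^sup>2)"
    by (rule Berkson_Porta) (rule that; blast)
  obtain K where K: "\<And>z. norm z < 1 \<Longrightarrow> norm (p z) * (1 - (norm z)\<^sup>2) \<le> K"
    using Herglotz_growth[OF p(1,2)] by metis
  show False
  proof (rule no_Julia_bound[OF ap f v])
    fix z :: complex assume z: "norm z < 1"
    have "norm (G z) * (1 - (norm z)\<^sup>2) = (norm (b - z))\<^sup>2 * (norm (p z) * (1 - (norm z)\<^sup>2))"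
      unfolding p(3)[OF z] norm_mult b[symmetric] norm_one_minus_cnj_mult[OF nb]
      by (simp add: power2_eq_square)
    also have "\<dots> \<le> (norm (b - z))\<^sup>2 * K" by (intro mult_left_mono K z) auto
    finally show "norm (G z) * (1 - (norm z)\<^sup>2) \<le> K * (norm (b - z))\<^sup>2" by (simp add: mult.commute)
  qed
qed

lemma tau_factor_boundary: "norm y = 1 \<Longrightarrow> y \<noteq> \<tau> \<Longrightarrow> 1 - cnj \<tau> * y \<noteq> 0"
proof
  assume y: "norm y = 1" "y \<noteq> \<tau>" "1 - cnj \<tau> * y = 0"
  have "norm (1 - cnj \<tau> * y) = norm (cnj (1 - cnj y * \<tau>))" by (simp add: mult.commute)
  also have "\<dots> = norm (y - \<tau>)" unfolding complex_mod_cnj by (rule norm_one_minus_cnj_mult[OF y(1)])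
  finally show False using y by simp
qed

lemma Q_ratio_limit:
  assumes ap: "approaches \<beta> f y C" and yt: "y \<noteq> \<tau>"
  shows "((\<lambda>s. Q (f s) / s powr \<beta>) \<longlongrightarrow> 2 * Re C / (norm (1 - cnj \<tau> * y))\<^sup>2) (at_right 0)"
    "2 * Re C / (norm (1 - cnj \<tau> * y))\<^sup>2 > 0"
proof -
  have \<beta>: "\<beta> > 0" using alpha by simp
  have C: "Re C > 0" "norm y = 1" using ap by (auto simp: approaches_def)
  have nz: "1 - cnj \<tau> * y \<noteq> 0" by (rule tau_factor_boundary[OF C(2) yt])
  have "((\<lambda>s. ((1 - (norm (f s))\<^sup>2) / s powr \<beta>) / (norm (1 - cnj \<tau> * f s))\<^sup>2) \<longlongrightarrow> 2 * Re C / (norm (1 - cnj \<tau> * y))\<^sup>2) (at_right 0)"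
    using nz by (intro tendsto_intros approaches_facts[OF ap \<beta>]) auto
  then show "((\<lambda>s. Q (f s) / s powr \<beta>) \<longlongrightarrow> 2 * Re C / (norm (1 - cnj \<tau> * y))\<^sup>2) (at_right 0)"
    unfolding Q_def by (simp add: mult.commute)
  show "2 * Re C / (norm (1 - cnj \<tau> * y))\<^sup>2 > 0" using C nz by simp
qed

lemma phi_cont: "norm z < 1 \<Longrightarrow> continuous_on {0..} (\<lambda>t. \<phi> t z)"
  using phi_vderiv by (intro continuous_on_vector_derivative) auto

lemma m_cont: "continuous_on (ball 0 1) m"
proof -
  have nz: "complex_of_real (1 - (norm z)\<^sup>2) * (1 - cnj \<tau> * z) \<noteq> 0" if "norm z < 1" for z
    using one_minus_norm_sq_pos[OF that] tau_factor_nz[OF that] by (simp only: mult_eq_0_iff of_real_eq_0_iff) auto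
  show ?thesis unfolding m_def[abs_def] using nz
    by (intro continuous_intros holomorphic_on_imp_continuous_on[OF G_hol]) auto
qed

text \<open>Along orbits \<open>ln Q\<close> has derivative \<open>2 * m \<ge> 0\<close> and gains
  at most \<open>ln K\<close> between the two times, uniformly in the starting point.
  \<open>Fatou_selection\<close> then gives one time that serves infinitely many starting
  points.\<close>

lemma bounded_slope_time:
  fixes s :: "nat \<Rightarrow> real"
  assumes t: "0 < t1" "t1 < t2" and s: "\<And>n. norm (pt (of_real (s n))) < 1"
    and bd: "\<And>n. Q (\<phi> t2 (pt (of_real (s n)))) \<le> K * Q (\<phi> t1 (pt (of_real (s n))))"
  obtains t0 K' r where "t1 \<le> t0" "t0 \<le> t2" "strict_mono (r :: nat \<Rightarrow> nat)"
    "\<And>n. m (\<phi> t0 (pt (of_real (s (r n))))) \<le> K'"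
proof -
  define z where "z = (\<lambda>n. pt (of_real (s n)))"
  have z: "norm (z n) < 1" for n using s by (simp add: z_def)
  \<comment> \<open>\<open>max t 0\<close> extends the integrand continuously to all real t, as
    \<open>Fatou_selection\<close> requires.\<close>
  define f where "f = (\<lambda>n t. 2 * m (\<phi> (max t 0) (z n)))"
  define F where "F = (\<lambda>n t. ln (Q (\<phi> t (z n))))"
  have K0: "K > 0"
  proof -
    have "0 < K * Q (\<phi> t1 (z 0))" using bd[of 0] Q_pos[OF phi_norm[OF _ z], of t2 0] t by (simp add: z_def)
    moreover have "Q (\<phi> t1 (z 0)) > 0" using t by (intro Q_pos phi_norm z) auto
    ultimately show ?thesis by (simp add: zero_less_mult_iff)
  qed
  obtain t0 K' where t0: "t1 \<le> t0" "t0 \<le> t2" and fr: "\<exists>\<^sub>F n in sequentially. f n t0 \<le> K'"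
  proof (rule Fatou_selection[of t1 t2 f F "ln K"])
    show "continuous_on UNIV (f n)" for n
    proof -
      have c: "continuous_on UNIV (\<lambda>t. \<phi> (max t 0) (z n))"
        by (rule continuous_on_compose2[OF phi_cont[OF z]]) (auto intro!: continuous_intros)
      have "continuous_on UNIV (\<lambda>t. m (\<phi> (max t 0) (z n)))"
        by (rule continuous_on_compose2[OF m_cont c]) (auto intro!: phi_norm z)
      then show ?thesis unfolding f_def by (intro continuous_intros)
    qed
    show "(F n has_real_derivative f n t) (at t)" if "t1 \<le> t" "t \<le> t2" for n t
    proof -
      have tp: "t > 0" using that t by simp
      have "(F n has_real_derivative f n t) (at t within {0..})"
        unfolding F_def f_def using ln_Q_deriv[OF _ z, of t n] tp by simp
      then have "(F n has_real_derivative f n t) (at t within {0<..})" by (rule DERIV_subset) auto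
      then show ?thesis using at_within_open[of t "{0<..}"] tp by simp
    qed
    show "0 \<le> f n t" if "t1 \<le> t" "t \<le> t2" for n t
      unfolding f_def by (simp add: m_nonneg phi_norm z)
    show "F n t2 - F n t1 \<le> ln K" for n
    proof -
      have q: "Q (\<phi> t1 (z n)) > 0" "Q (\<phi> t2 (z n)) > 0" using t by (auto intro!: Q_pos phi_norm z)
      have "F n t2 \<le> ln (K * Q (\<phi> t1 (z n)))"
        unfolding F_def using bd[of n] q by (simp add: z_def)
      also have "\<dots> = ln K + F n t1" unfolding F_def using K0 q by (simp add: ln_mult)
      finally show ?thesis by simp
    qed
  qed (use t in auto)
  have inf: "infinite {n. f n t0 \<le> K'}"
    using fr by (simp add: INFM_iff_infinite cofinite_eq_sequentially[symmetric])
  define r where "r = enumerate {n. f n t0 \<le> K'}"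
  have r: "strict_mono r" unfolding r_def using strict_mono_enumerate[OF inf] by simp
  have "f (r n) t0 \<le> K'" for n using enumerate_in_set[OF inf, of n] by (simp add: r_def)
  then have "m (\<phi> t0 (pt (of_real (s (r n))))) \<le> K' / 2" for n
    using t t0 unfolding f_def z_def by (simp add: max_def mult.commute)
  then show ?thesis using that t0 r by blast
qed

text \<open>Once \<open>t0\<close> is found, the information at t1 has to be carried over to it. The
  Julia-Wolff-Caratheodory theorem for \<open>\<phi> (t0 - t1)\<close> at \<open>y1\<close> does
  this: the approach to b and the size of \<open>deriv (\<phi> t0)\<close> keep their rates, and
  only the constants change.\<close>

theorem G_regular_of_two_times:
  assumes pos: "\<alpha> > 0" and t: "0 < t1" "t1 < t2" and reg: "phi_regular t1" "phi_regular t2"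
  shows G_regular
proof -
  have \<beta>: "\<beta> > 0" using alpha by simp
  obtain y1 E1 M1 where 1: "E1 \<noteq> 0" "M1 \<noteq> 0" "((\<lambda>u. deriv (\<phi> t1) (pt u) * u powr of_real \<alpha>) \<longlongrightarrow> E1) ang"
    "((\<lambda>u. \<phi> t1 (pt u)) \<longlongrightarrow> y1) ang" "((\<lambda>u. (\<phi> t1 (pt u) - y1) * u powr of_real (\<alpha> - 1)) \<longlongrightarrow> M1) ang"
    "norm y1 \<le> 1"
    by (rule phi_limit[of t1]) (use t reg in auto)
  obtain y2 E2 M2 where 2: "E2 \<noteq> 0" "M2 \<noteq> 0" "((\<lambda>u. deriv (\<phi> t2) (pt u) * u powr of_real \<alpha>) \<longlongrightarrow> E2) ang"
    "((\<lambda>u. \<phi> t2 (pt u)) \<longlongrightarrow> y2) ang" "((\<lambda>u. (\<phi> t2 (pt u) - y2) * u powr of_real (\<alpha> - 1)) \<longlongrightarrow> M2) ang"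
    "norm y2 \<le> 1"
    by (rule phi_limit[of t2]) (use t reg in auto)
  show ?thesis
  proof (cases "norm y1 < 1 \<or> norm y2 < 1")
    case True
    then show ?thesis
      using G_regular_of_interior_value[OF _ reg(1) 1(4)] G_regular_of_interior_value[OF _ reg(2) 2(4)] t by auto
  next
    case False
    then have ny: "norm y1 = 1" "norm y2 = 1" using 1(6) 2(6) by auto
    define f1 where "f1 = (\<lambda>s. \<phi> t1 (pt (of_real s)))"
    define f2 where "f2 = (\<lambda>s. \<phi> t2 (pt (of_real s)))"
    obtain C1 where ap1: "approaches \<beta> f1 y1 C1" unfolding f1_def
      by (rule contact_approaches[OF _ pos 1(2,4,5) ny(1)]) (use t in auto)
    obtain C2 where ap2: "approaches \<beta> f2 y2 C2" unfolding f2_def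
      by (rule contact_approaches[OF _ pos 2(2,4,5) ny(2)]) (use t in auto)
    have rad: "((\<lambda>s. deriv (\<phi> t) (pt (of_real s)) * of_real (s powr \<alpha>)) \<longlongrightarrow> E) (at_right 0)"
      if "((\<lambda>u. deriv (\<phi> t) (pt u) * u powr of_real \<alpha>) \<longlongrightarrow> E) ang" for t E
      by (rule Lim_transform_eventually[OF filterlim_compose[OF that filterlim_of_real_ang]],
          rule eventually_mono[OF eventually_at_right_less[of "0::real"]]) (simp add: of_real_powr)
    have v0: "filterlim (\<lambda>s. v (pt (of_real s))) at_top (at_right 0)"
      using v_at_infinity[OF t(1) pos ap1[unfolded f1_def]] .
    have v1: "filterlim (\<lambda>s. v (f1 s)) at_top (at_right 0)"
      unfolding f1_def using t by (intro v_phi_at_infinity[OF _ v0 1(1) rad[OF 1(3)] ap1[unfolded f1_def]]) auto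
    have v2: "filterlim (\<lambda>s. v (f2 s)) at_top (at_right 0)"
      unfolding f2_def using t by (intro v_phi_at_infinity[OF _ v0 2(1) rad[OF 2(3)] ap2[unfolded f2_def]]) auto
    have in1: "\<forall>\<^sub>F s in at_right 0. norm (\<phi> t (pt (of_real s))) < 1" if "t \<ge> 0" for t
      using small_real by eventually_elim (use that phi_norm in auto)
    have yt1: "y1 \<noteq> \<tau>" by (rule contact_value_neq_tau[OF ap1 _ v1]) (use in1 t in \<open>simp add: f1_def\<close>)
    have yt2: "y2 \<noteq> \<tau>" by (rule contact_value_neq_tau[OF ap2 _ v2]) (use in1 t in \<open>simp add: f2_def\<close>)
    note q1 = Q_ratio_limit[OF ap1 yt1] and q2 = Q_ratio_limit[OF ap2 yt2]
    have C1: "Re C1 > 0" using ap1 by (simp add: approaches_def)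
    have "((\<lambda>s. (Q (f2 s) / s powr \<beta>) / (Q (f1 s) / s powr \<beta>)) \<longlongrightarrow>
        (2 * Re C2 / (norm (1 - cnj \<tau> * y2))\<^sup>2) / (2 * Re C1 / (norm (1 - cnj \<tau> * y1))\<^sup>2)) (at_right 0)"
      by (rule tendsto_divide[OF q2(1) q1(1) less_imp_neq[OF q1(2), symmetric]])
    then obtain K1 where K1: "\<forall>\<^sub>F s in at_right 0. (Q (f2 s) / s powr \<beta>) / (Q (f1 s) / s powr \<beta>) < K1"
      using tendsto_eventually_bounded by blast
    have "((\<lambda>s. (Q (f2 s) / s powr \<beta>) / ((1 - (norm (f1 s))\<^sup>2) / s powr \<beta>)) \<longlongrightarrow>
        (2 * Re C2 / (norm (1 - cnj \<tau> * y2))\<^sup>2) / (2 * Re C1)) (at_right 0)"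
      by (rule tendsto_divide[OF q2(1) approaches_facts(3)[OF ap1 \<beta>]]) (use C1 in simp)
    then obtain K2 where K2: "\<forall>\<^sub>F s in at_right 0. (Q (f2 s) / s powr \<beta>) / ((1 - (norm (f1 s))\<^sup>2) / s powr \<beta>) < K2"
      using tendsto_eventually_bounded by blast
    have "\<forall>\<^sub>F s in at_right (0::real). (0 < s \<and> s < 1 \<and> norm (pt (of_real s)) < 1) \<and> Q (f2 s) \<le> K1 * Q (f1 s)
        \<and> Q (f2 s) \<le> K2 * (1 - (norm (f1 s))\<^sup>2)"
      using small_real K1 K2
    proof eventually_elim
      case (elim s)
      have n: "norm (f1 s) < 1" unfolding f1_def using elim t phi_norm by auto
      have "Q (f1 s) > 0" "1 - (norm (f1 s))\<^sup>2 > 0" using n Q_pos one_minus_norm_sq_pos by auto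
      moreover have "s powr \<beta> > 0" using elim by simp
      ultimately show ?case using elim by (auto simp: divide_less_eq less_imp_le)
    qed
    then obtain d where d: "d > 0" and dd: "\<And>s. 0 < s \<Longrightarrow> s < d \<Longrightarrow> s < 1 \<and> norm (pt (of_real s)) < 1
        \<and> Q (f2 s) \<le> K1 * Q (f1 s) \<and> Q (f2 s) \<le> K2 * (1 - (norm (f1 s))\<^sup>2)"
      unfolding eventually_at_right_field by auto
    define s where "s = (\<lambda>n::nat. d / (real n + 2))"
    have s: "s n > 0" "s n < d" for n using d by (auto simp: s_def divide_less_eq algebra_simps add_pos_nonneg)
    have s0: "s \<longlonglongrightarrow> 0" unfolding s_def by real_asymp
    have sr: "filterlim s (at_right 0) sequentially"
      unfolding filterlim_at using s0 s less_imp_neq[OF s(1)] by (auto intro!: always_eventually)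
    obtain t0 K r where t0: "t1 \<le> t0" "t0 \<le> t2" and r: "strict_mono (r :: nat \<Rightarrow> nat)"
      and mK: "\<And>n. m (\<phi> t0 (pt (of_real (s (r n))))) \<le> K"
      by (rule bounded_slope_time[OF t, of s K1]) (use dd[OF s] in \<open>auto simp: f1_def f2_def\<close>)
    define f0 where "f0 = (\<lambda>s. \<phi> t0 (pt (of_real s)))"
    have rr: "filterlim (\<lambda>n. s (r n)) (at_right 0) sequentially"
      by (rule filterlim_compose[OF sr filterlim_subseq[OF r]])
    have t00: "t0 \<ge> 0" "t0 - t1 \<ge> 0" "t2 - t0 \<ge> 0" "t1 \<ge> 0" using t t0 by auto
    interpret S: disc_self_map "\<phi> (t0 - t1)" by (rule self_map[OF t00(2)])
    have comp: "\<phi> t0 z = \<phi> (t0 - t1) (\<phi> t1 z)" if "norm z < 1" for z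
      using phi_add[OF t00(2) t00(4) that] by simp
    have comp2: "\<phi> t2 z = \<phi> (t2 - t0) (\<phi> t0 z)" if "norm z < 1" for z
      using phi_add[OF t00(3) t00(1) that] by simp
    define a where "a = (\<lambda>n. f1 (s (r n)))"
    have zin: "norm (pt (of_real (s n))) < 1" for n using dd[OF s] by blast
    have f0a: "f0 (s (r n)) = \<phi> (t0 - t1) (a n)" for n
      unfolding f0_def a_def f1_def by (rule comp[OF zin])
    have a1: "norm (a n) < 1" for n unfolding a_def f1_def by (rule phi_norm[OF t00(4) zin])
    have Q0: "1 - (norm z)\<^sup>2 \<le> 4 * Q z" if z: "norm z < 1" for z
    proof -
      have "(norm (1 - cnj \<tau> * z))\<^sup>2 \<le> 2\<^sup>2" by (intro power_mono norm_tau_factor_bound z) auto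
      then have "(1 - (norm z)\<^sup>2) * (norm (1 - cnj \<tau> * z))\<^sup>2 \<le> (1 - (norm z)\<^sup>2) * 4"
        using one_minus_norm_sq_pos[OF z] by (intro mult_left_mono) auto
      then show ?thesis unfolding Q_def using tau_factor_nz[OF z] by (simp add: field_simps)
    qed
    have Q02: "Q (f0 (s n)) \<le> Q (f2 (s n))" for n
      unfolding f0_def f2_def comp2[OF zin] by (intro Q_mono t00 phi_norm zin)
    \<comment> \<open>The Julia condition for \<open>\<phi> (t0 - t1)\<close> along
      \<open>a\<close>. Monotonicity of \<open>Q\<close> bounds the intermediate time by t2, where
      \<open>Q\<close> is comparable to the boundary distance at t1.\<close>
    have aC: "1 - (norm (\<phi> (t0 - t1) (a n)))\<^sup>2 \<le> (4 * K2) * (1 - (norm (a n))\<^sup>2)" for n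
    proof -
      have "1 - (norm (f0 (s (r n))))\<^sup>2 \<le> 4 * Q (f0 (s (r n)))"
        unfolding f0_def by (intro Q0 phi_norm t00 zin)
      also have "\<dots> \<le> 4 * Q (f2 (s (r n)))" using Q02 by simp
      also have "\<dots> \<le> 4 * (K2 * (1 - (norm (f1 (s (r n))))\<^sup>2))" using dd[OF s] by (intro mult_left_mono) auto
      finally show ?thesis unfolding f0a a_def by simp
    qed
    have al: "a \<longlonglongrightarrow> y1" unfolding a_def by (rule filterlim_compose[OF approaches_facts(2)[OF ap1 \<beta>] rr])
    obtain b \<kappa> where b: "norm b = 1" "\<kappa> > 0" "((\<lambda>u. \<phi> (t0 - t1) (y1 * (1 - u))) \<longlongrightarrow> b) ang"
        "((\<lambda>u. (b - \<phi> (t0 - t1) (y1 * (1 - u))) / u) \<longlongrightarrow> b * of_real \<kappa>) ang"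
        "((\<lambda>u. deriv (\<phi> (t0 - t1)) (y1 * (1 - u))) \<longlongrightarrow> b * of_real \<kappa> / y1) ang"
      by (rule S.julia_wolff_caratheodory[where a = a, OF ny(1) a1 al aC])
    define g1 where "g1 = (\<lambda>s. 1 - cnj y1 * f1 s)"
    have g1: "filterlim g1 ang (at_right 0)" unfolding g1_def by (rule approaches_facts(5)[OF ap1 \<beta>])
    have yg: "y1 * (1 - g1 s) = f1 s" for s
      using unit_mult_cnj[OF ny(1)] by (simp add: g1_def flip: mult.assoc)
    have f0f1: "\<forall>\<^sub>F s in at_right 0. f0 s = \<phi> (t0 - t1) (f1 s)"
      using small_real by eventually_elim (use comp in \<open>auto simp: f0_def f1_def\<close>)
    have bb: "cnj b * b = 1" by (subst mult.commute) (rule unit_mult_cnj[OF b(1)])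
    have ap0: "approaches \<beta> f0 b (of_real \<kappa> * C1)"
      unfolding approaches_def
    proof (intro conjI)
      show "0 < Re (of_real \<kappa> * C1)" using b C1 by simp
      have l1: "((\<lambda>s. cnj b * ((b - \<phi> (t0 - t1) (y1 * (1 - g1 s))) / g1 s) * (g1 s / of_real (s powr \<beta>)))
          \<longlongrightarrow> cnj b * (b * of_real \<kappa>) * C1) (at_right 0)"
        using ap1 unfolding approaches_def g1_def[symmetric]
        by (intro tendsto_intros filterlim_compose[OF b(4) g1]) (simp add: g1_def)
      have l2: "cnj b * (b * of_real \<kappa>) * C1 = of_real \<kappa> * C1" using bb by (simp flip: mult.assoc)
      have ev: "\<forall>\<^sub>F s in at_right 0. cnj b * ((b - \<phi> (t0 - t1) (y1 * (1 - g1 s))) / g1 s) * (g1 s / of_real (s powr \<beta>))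
          = (1 - cnj b * f0 s) / of_real (s powr \<beta>)"
        using f0f1 in1[OF t00(4)]
      proof eventually_elim
        case (elim s)
        have "g1 s \<noteq> 0"
        proof
          assume "g1 s = 0"
          then have "f1 s = y1" using yg[of s] by simp
          then show False using elim(2) ny by (simp add: f1_def)
        qed
        moreover have "cnj b * (b - f0 s) = 1 - cnj b * f0 s" using bb by (simp add: right_diff_distrib)
        ultimately show ?case unfolding yg using elim(1) by simp
      qed
      show "((\<lambda>s. (1 - cnj b * f0 s) / of_real (s powr \<beta>)) \<longlongrightarrow> of_real \<kappa> * C1) (at_right 0)"
        using Lim_transform_eventually[OF l1 ev] unfolding l2 .
    qed (rule b(1))
    define E0 where "E0 = b * of_real \<kappa> / y1 * E1"
    have E0: "E0 \<noteq> 0" unfolding E0_def using b ny 1(1) by auto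
    have dphi0: "((\<lambda>s. deriv (\<phi> t0) (pt (of_real s)) * of_real (s powr \<alpha>)) \<longlongrightarrow> E0) (at_right 0)"
    proof -
      have "((\<lambda>s. deriv (\<phi> (t0 - t1)) (y1 * (1 - g1 s)) * (deriv (\<phi> t1) (pt (of_real s)) * of_real (s powr \<alpha>))) \<longlongrightarrow> E0) (at_right 0)"
        unfolding E0_def by (intro tendsto_mult filterlim_compose[OF b(5) g1] rad[OF 1(3)])
      then show ?thesis
      proof (rule Lim_transform_eventually)
        show "\<forall>\<^sub>F s in at_right 0. deriv (\<phi> (t0 - t1)) (y1 * (1 - g1 s)) * (deriv (\<phi> t1) (pt (of_real s)) * of_real (s powr \<alpha>))
            = deriv (\<phi> t0) (pt (of_real s)) * of_real (s powr \<alpha>)"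
          using small_real
        proof eventually_elim
          case (elim s)
          define z where "z = pt (of_real s)"
          have z: "norm z < 1" using elim by (simp add: z_def)
          have d1: "(\<phi> t1 has_field_derivative deriv (\<phi> t1) z) (at z)"
            using z by (intro holomorphic_derivI[OF phi_hol[OF t00(4)]]) auto
          have d2: "(\<phi> (t0 - t1) has_field_derivative deriv (\<phi> (t0 - t1)) (\<phi> t1 z)) (at (\<phi> t1 z))"
            using phi_norm[OF t00(4) z] by (intro holomorphic_derivI[OF S.hol]) auto
          from DERIV_chain[OF d2 d1]
          have "(\<phi> t0 has_field_derivative deriv (\<phi> (t0 - t1)) (\<phi> t1 z) * deriv (\<phi> t1) z) (at z)"
            by (rule has_field_derivative_transform_within_open[of _ _ _ "ball 0 1"]) (use z comp in auto)
          then show ?case unfolding yg f1_def z_def[symmetric] by (simp add: DERIV_imp_deriv)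
        qed
      qed
    qed
    have v00: "filterlim (\<lambda>s. v (f0 s)) at_top (at_right 0)"
      unfolding f0_def by (rule v_phi_at_infinity[OF t00(1) v0 E0 dphi0 ap0[unfolded f0_def]])
    have in0: "\<forall>\<^sub>F s in at_right 0. norm (f0 s) < 1" unfolding f0_def by (rule in1[OF t00(1)])
    have bt: "b \<noteq> \<tau>" by (rule contact_value_neq_tau[OF ap0 in0 v00])
    obtain p where p: "p holomorphic_on ball 0 1" "\<And>z. norm z < 1 \<Longrightarrow> Re (p z) \<ge> 0"
      "\<And>z. norm z < 1 \<Longrightarrow> G z = (\<tau> - z) * (1 - cnj \<tau> * z) * p z"
      "\<And>z. norm z < 1 \<Longrightarrow> m z = (norm (\<tau> - z))\<^sup>2 * Re (p z) / (1 - (norm z)\<^sup>2)"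
      by (rule Berkson_Porta) (rule that; blast)
    \<comment> \<open>As b is not \<tau>, the factor \<open>norm (\<tau> - z)\<close> in the formula
      for \<open>m\<close> is bounded below near b, and boundedness of \<open>m\<close> becomes
      first-order decay of \<open>Re p\<close>.\<close>
    define \<delta> where "\<delta> = norm (\<tau> - b) / 2"
    have \<delta>: "\<delta> > 0" using bt by (simp add: \<delta>_def)
    have bl: "(\<lambda>n. f0 (s (r n))) \<longlonglongrightarrow> b" by (rule filterlim_compose[OF approaches_facts(2)[OF ap0 \<beta>] rr])
    have "(\<lambda>n. norm (\<tau> - f0 (s (r n)))) \<longlonglongrightarrow> norm (\<tau> - b)" by (intro tendsto_intros bl)
    then have "\<forall>\<^sub>F n in sequentially. \<delta> < norm (\<tau> - f0 (s (r n)))"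
      by (rule order_tendstoD) (use \<delta> in \<open>simp add: \<delta>_def\<close>)
    then obtain N where N: "\<And>n. n \<ge> N \<Longrightarrow> \<delta> < norm (\<tau> - f0 (s (r n)))"
      unfolding eventually_sequentially by blast
    define bs where "bs = (\<lambda>n. f0 (s (r (n + N))))"
    have bs1: "norm (bs n) < 1" for n unfolding bs_def f0_def by (rule phi_norm[OF t00(1) zin])
    have bsl: "bs \<longlonglongrightarrow> b" unfolding bs_def by (rule LIMSEQ_ignore_initial_segment[OF bl])
    have K0: "K \<ge> 0" using mK[of 0] m_nonneg[OF phi_norm[OF t00(1) zin], of "r 0"] by linarith
    have "Re (p (bs n)) \<le> (K / \<delta>\<^sup>2) * (1 - (norm (bs n))\<^sup>2)" for n
    proof -
      have A: "1 - (norm (bs n))\<^sup>2 > 0" by (rule one_minus_norm_sq_pos[OF bs1])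
      have "\<delta>\<^sup>2 * Re (p (bs n)) \<le> (norm (\<tau> - bs n))\<^sup>2 * Re (p (bs n))"
        using N[of "n + N"] \<delta> p(2)[OF bs1] unfolding bs_def by (intro mult_right_mono power_mono) auto
      also have "\<dots> \<le> K * (1 - (norm (bs n))\<^sup>2)"
        using mK[of "n + N"] p(4)[OF bs1, of n] A unfolding f0_def bs_def by (simp add: divide_le_eq)
      finally show ?thesis using \<delta> by (simp add: field_simps)
    qed
    then obtain q where q: "\<And>z. norm z < 1 \<Longrightarrow> norm (p z - q) * (1 - (norm z)\<^sup>2) \<le> 4 * (K / \<delta>\<^sup>2) * (norm (b - z))\<^sup>2"
      using Herglotz_boundary_value[OF p(1,2) bs1 bsl b(1)] by blast
    \<comment> \<open>With q = 0 the bound on p passes to G, and the speed along \<open>f0\<close>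
      would stay bounded.\<close>
    have q0: "q \<noteq> 0"
    proof
      assume q0: "q = 0"
      show False
      proof (rule no_Julia_bound[OF ap0 in0 v00])
        fix z :: complex assume z: "norm z < 1"
        have "norm (\<tau> - z) \<le> 2" using norm_triangle_ineq4[of \<tau> z] norm_tau z by linarith
        then have "norm (\<tau> - z) * norm (1 - cnj \<tau> * z) \<le> 2 * 2"
          using norm_tau_factor_bound[OF z] by (intro mult_mono) auto
        then have "norm (G z) \<le> 4 * norm (p z)"
          unfolding p(3)[OF z] norm_mult by (intro mult_right_mono) auto
        then have "norm (G z) * (1 - (norm z)\<^sup>2) \<le> 4 * norm (p z) * (1 - (norm z)\<^sup>2)"
          using one_minus_norm_sq_pos[OF z] by (intro mult_right_mono) auto
        also have "\<dots> \<le> 4 * (4 * (K / \<delta>\<^sup>2) * (norm (b - z))\<^sup>2)" using q[OF z] q0 by simp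
        finally show "norm (G z) * (1 - (norm z)\<^sup>2) \<le> 16 * (K / \<delta>\<^sup>2) * (norm (b - z))\<^sup>2" by simp
      qed
    qed
    define D where "D = (\<lambda>s. (1 - (norm (f0 s))\<^sup>2) / s powr \<beta>)"
    define N0 where "N0 = (\<lambda>s. norm (b - f0 s) / s powr \<beta>)"
    have D: "(D \<longlongrightarrow> 2 * Re (of_real \<kappa> * C1)) (at_right 0)" unfolding D_def by (rule approaches_facts(3)[OF ap0 \<beta>])
    have N0: "(N0 \<longlongrightarrow> norm (of_real \<kappa> * C1)) (at_right 0)" unfolding N0_def by (rule approaches_facts(4)[OF ap0 \<beta>])
    have sb: "((\<lambda>s::real. s powr \<beta>) \<longlongrightarrow> 0) (at_right 0)"
    proof -
      have "((\<lambda>s::real. s powr \<beta>) \<longlongrightarrow> 0 powr \<beta>) (at_right 0)"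
        using \<beta> eventually_mono[OF eventually_at_right_less[of "0::real"] less_imp_le]
        by (intro tendsto_powr' tendsto_ident_at tendsto_const) simp_all
      then show ?thesis by simp
    qed
    have "((\<lambda>s. 4 * (K / \<delta>\<^sup>2) * (N0 s)\<^sup>2 / D s * s powr \<beta>) \<longlongrightarrow> 4 * (K / \<delta>\<^sup>2) * (norm (of_real \<kappa> * C1))\<^sup>2 / (2 * Re (of_real \<kappa> * C1)) * 0) (at_right 0)"
      using b C1 by (intro tendsto_mult tendsto_divide tendsto_power tendsto_const N0 D sb) auto
    then have l0: "((\<lambda>s. 4 * (K / \<delta>\<^sup>2) * (N0 s)\<^sup>2 / D s * s powr \<beta>) \<longlongrightarrow> 0) (at_right 0)" by simp
    have "((\<lambda>s. p (f0 s) - q) \<longlongrightarrow> 0) (at_right 0)"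
    proof (rule Lim_null_comparison[OF _ l0])
      show "\<forall>\<^sub>F s in at_right 0. norm (p (f0 s) - q) \<le> 4 * (K / \<delta>\<^sup>2) * (N0 s)\<^sup>2 / D s * s powr \<beta>"
        using in0 eventually_at_right_less[of "0::real"]
      proof eventually_elim
        case (elim s)
        have A: "1 - (norm (f0 s))\<^sup>2 > 0" by (rule one_minus_norm_sq_pos[OF elim(1)])
        have "norm (p (f0 s) - q) \<le> 4 * (K / \<delta>\<^sup>2) * (norm (b - f0 s))\<^sup>2 / (1 - (norm (f0 s))\<^sup>2)"
          by (rule iffD2[OF pos_le_divide_eq[OF A] q[OF elim(1)]])
        also have "\<dots> = 4 * (K / \<delta>\<^sup>2) * (N0 s)\<^sup>2 / D s * s powr \<beta>"
          unfolding N0_def D_def using elim(2) by (simp add: power2_eq_square)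
        finally show ?case .
      qed
    qed
    then have pq: "((\<lambda>s. p (f0 s)) \<longlongrightarrow> q) (at_right 0)" by (simp add: LIM_zero_iff)
    have Gf: "((\<lambda>s. (\<tau> - f0 s) * (1 - cnj \<tau> * f0 s) * p (f0 s) / (deriv (\<phi> t0) (pt (of_real s)) * of_real (s powr \<alpha>)))
        \<longlongrightarrow> (\<tau> - b) * (1 - cnj \<tau> * b) * q / E0) (at_right 0)"
      by (intro tendsto_intros approaches_facts(2)[OF ap0 \<beta>] pq dphi0 E0)
    have "((\<lambda>s. G (pt (of_real s)) * of_real s powr of_real (-\<alpha>)) \<longlongrightarrow> (\<tau> - b) * (1 - cnj \<tau> * b) * q / E0) (at_right 0)"
    proof (rule Lim_transform_eventually[OF Gf])
      show "\<forall>\<^sub>F s in at_right 0. (\<tau> - f0 s) * (1 - cnj \<tau> * f0 s) * p (f0 s) / (deriv (\<phi> t0) (pt (of_real s)) * of_real (s powr \<alpha>))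
          = G (pt (of_real s)) * of_real s powr of_real (-\<alpha>)"
        using small_real
      proof eventually_elim
        case (elim s)
        define z where "z = pt (of_real s)"
        have z: "norm z < 1" using elim by (simp add: z_def)
        have nz: "deriv (\<phi> t0) z \<noteq> 0"
          using z by (intro holomorphic_injective_imp_regular[OF phi_hol[OF t00(1)] _ phi_inj[OF t00(1)]]) auto
        have "(\<tau> - f0 s) * (1 - cnj \<tau> * f0 s) * p (f0 s) = deriv (\<phi> t0) z * G z"
          using p(3)[OF phi_norm[OF t00(1) z]] G_phi[OF t00(1) z] by (simp add: f0_def z_def)
        moreover have "complex_of_real s powr of_real (-\<alpha>) = inverse (of_real (s powr \<alpha>))"
          using elim by (simp add: of_real_powr powr_minus del: of_real_minus)
        ultimately show ?case unfolding z_def[symmetric] using nz by (simp add: divide_inverse)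
      qed
    qed
    moreover have "(\<tau> - b) * (1 - cnj \<tau> * b) * q / E0 \<noteq> 0"
      using bt q0 E0 tau_factor_boundary[OF b(1) bt] by simp
    \<comment> \<open>The limit is known on the radius only; the Lindelof argument behind
      \<open>regular_singularity_iff\<close> makes it angular.\<close>
    ultimately have "regular_singularity G \<alpha> x" unfolding radial_form by blast
    then show ?thesis by (simp add: regular_singularity_iff)
  qed
qed

text \<open>If x were fixed, the nontangential approach and the order \<open>u powr \<alpha>\<close>
  of G would send \<open>G \<circ> \<phi> t\<close> to 0 along the radius. But this function equals
  \<open>deriv (\<phi> t) * G\<close>, whose limit \<open>E * L\<close> is not 0.\<close>

lemma not_fixed_if_positive:
  assumes pos: "\<alpha> > 0" and t: "t \<ge> 0" and reg: "phi_regular t" and G: G_regular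
  shows "\<not> ((\<lambda>u. \<phi> t (pt u)) \<longlongrightarrow> x) ang"
proof
  assume fx: "((\<lambda>u. \<phi> t (pt u)) \<longlongrightarrow> x) ang"
  have \<beta>: "\<beta> > 0" using alpha by simp
  obtain y E M where E: "E \<noteq> 0" "M \<noteq> 0" "((\<lambda>u. deriv (\<phi> t) (pt u) * u powr of_real \<alpha>) \<longlongrightarrow> E) ang"
    "((\<lambda>u. \<phi> t (pt u)) \<longlongrightarrow> y) ang" "((\<lambda>u. (\<phi> t (pt u) - y) * u powr of_real (\<alpha> - 1)) \<longlongrightarrow> M) ang"
    "norm y \<le> 1"
    by (rule phi_limit[OF t reg])
  have yx: "y = x" using tendsto_unique[OF ang_neq_bot E(4) fx] .
  obtain C where ap: "approaches \<beta> (\<lambda>s. \<phi> t (pt (of_real s))) x C"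
    by (rule contact_approaches[OF t pos E(2,4,5)[unfolded yx] x])
  obtain L where L: "L \<noteq> 0" "((\<lambda>u. G (pt u) * u powr of_real (-\<alpha>)) \<longlongrightarrow> L) ang"
    using G unfolding G_regular_def by blast
  define g where "g = (\<lambda>s. 1 - cnj x * \<phi> t (pt (of_real s)))"
  have g: "filterlim g ang (at_right 0)" unfolding g_def by (rule approaches_facts(5)[OF ap \<beta>])
  have "((\<lambda>u. G (pt u) * u powr of_real (-\<alpha>) * u powr of_real \<alpha>) \<longlongrightarrow> L * 0) ang"
    by (intro tendsto_mult L powr_of_real_tendsto_0_ang pos)
  then have G0: "((\<lambda>u. G (pt u)) \<longlongrightarrow> 0) ang"
    by (rule ang_cong[OF _ zero_less_one]) (simp_all add: cap_nonzero mult.assoc)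
  have "pt (g s) = \<phi> t (pt (of_real s))" for s
    using unit_mult_cnj[OF x] by (simp add: g_def flip: mult.assoc)
  then have lim0: "((\<lambda>s. G (\<phi> t (pt (of_real s)))) \<longlongrightarrow> 0) (at_right 0)"
    using filterlim_compose[OF G0 g] by simp
  have lim1: "((\<lambda>u. (deriv (\<phi> t) (pt u) * u powr of_real \<alpha>) * (G (pt u) * u powr of_real (-\<alpha>))) \<longlongrightarrow> E * L) ang"
    by (intro tendsto_mult E L)
  have "((\<lambda>u. G (\<phi> t (pt u))) \<longlongrightarrow> E * L) ang"
  proof (rule ang_cong[OF lim1 zero_less_one])
    fix u :: complex assume u: "u \<in> cap 1"
    have "(deriv (\<phi> t) (pt u) * u powr of_real \<alpha>) * (G (pt u) * u powr of_real (-\<alpha>))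
        = (deriv (\<phi> t) (pt u) * G (pt u)) * (u powr of_real \<alpha> * u powr (- of_real \<alpha>))"
      by (simp add: mult_ac)
    then show "(deriv (\<phi> t) (pt u) * u powr of_real \<alpha>) * (G (pt u) * u powr of_real (-\<alpha>)) = G (\<phi> t (pt u))"
      using cap_nonzero[OF u] G_phi[OF t pt_in[OF u]] by simp
  qed simp
  from tendsto_unique[OF trivial_limit_at_right_real filterlim_compose[OF this filterlim_of_real_ang] lim0]
  have "E * L = 0" .
  then show False using E L by simp
qed

end


section \<open>From the generator to the derivative of the semigroup\<close>

lemma convex_sector: "M > 0 \<Longrightarrow> convex (sector M)"
proof (rule convexI)
  fix u v :: complex and a b :: real
  assume *: "M > 0" "u \<in> sector M" "v \<in> sector M" "0 \<le> a" "0 \<le> b" "a + b = 1"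
  have "norm (a *\<^sub>R u + b *\<^sub>R v) \<le> a * norm u + b * norm v"
    using norm_triangle_ineq[of "a *\<^sub>R u" "b *\<^sub>R v"] * by simp
  also have "\<dots> < a * (M * Re u) + b * (M * Re v)"
  proof (cases "a > 0")
    case True
    then show ?thesis using * by (intro add_less_le_mono mult_strict_left_mono mult_left_mono) (auto simp: sector_def)
  next
    case False
    then have "a = 0" "b = 1" using * by auto
    then show ?thesis using * by (simp add: sector_def)
  qed
  also have "\<dots> = M * Re (a *\<^sub>R u + b *\<^sub>R v)" by (simp add: algebra_simps)
  finally show "a *\<^sub>R u + b *\<^sub>R v \<in> sector M" by (simp add: sector_def)
qed

text \<open>The directions of \<open>sector M\<close> lie in a compact arc, on which
  \<open>Re (C * \<zeta> powr \<beta>)\<close> has a positive minimum \<delta>. It absorbs the error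
  term, so the image stays in a single sector.\<close>

lemma filterlim_ang_power:
  fixes g :: "complex \<Rightarrow> complex"
  assumes lim: "((\<lambda>u. g u * u powr of_real (-\<beta>)) \<longlongrightarrow> C) ang" and \<beta>: "\<beta> > 0"
    and pos: "\<And>\<zeta>. Re \<zeta> > 0 \<Longrightarrow> Re (C * \<zeta> powr of_real \<beta>) > 0"
  shows "filterlim g ang ang"
  unfolding filterlim_ang_iff[of g]
proof (intro allI impI)
  fix M :: real assume M: "M > 1"
  define K where "K = {\<zeta>::complex. Re \<zeta> \<ge> 1 / M} \<inter> sphere 0 1"
  have K: "compact K" unfolding K_def by (intro closed_Int_compact closed_halfspace_Re_ge) auto
  have Kre: "Re \<zeta> > 0" if "\<zeta> \<in> K" for \<zeta>
    using that M by (auto simp: K_def intro: less_le_trans[of 0 "1/M"])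
  have "1 \<in> K" using M by (simp add: K_def)
  moreover have "continuous_on K (\<lambda>\<zeta>. Re (C * \<zeta> powr of_real \<beta>))"
  proof -
    have "(\<lambda>\<zeta>. \<zeta> powr of_real \<beta>) holomorphic_on K"
      using Kre nonpos_Reals_Re_pos by (intro holomorphic_intros) auto
    then show ?thesis by (intro continuous_intros holomorphic_on_imp_continuous_on)
  qed
  ultimately obtain \<zeta>0 where \<zeta>0: "\<zeta>0 \<in> K" "\<And>\<zeta>. \<zeta> \<in> K \<Longrightarrow> Re (C * \<zeta>0 powr of_real \<beta>) \<le> Re (C * \<zeta> powr of_real \<beta>)"
    using continuous_attains_inf[OF K] by blast
  define \<delta> where "\<delta> = Re (C * \<zeta>0 powr of_real \<beta>)"
  have \<delta>: "\<delta> > 0" unfolding \<delta>_def by (rule pos[OF Kre[OF \<zeta>0(1)]])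
  \<comment> \<open>Bounds \<open>norm (g u) / Re (g u)\<close>: up to the common factor
    \<open>s powr \<beta>\<close> the numerator is below \<open>norm C + \<delta>\<close> and the
    denominator at least \<open>\<delta> / 2\<close>.\<close>
  define N where "N = 2 + 2 * (norm C + \<delta>) / \<delta>"
  have N: "N > 1" using \<delta> by (simp add: N_def add_pos_nonneg)
  have limM: "((\<lambda>u. g u * u powr of_real (-\<beta>)) \<longlongrightarrow> C) (at 0 within sector M)"
    using lim M unfolding filterlim_ang_iff by blast
  have sec: "\<forall>\<^sub>F u in at 0 within sector M. u \<in> sector M" unfolding eventually_at by (auto intro: exI[of _ 1])
  have "\<forall>\<^sub>F u in at 0 within sector M. dist (g u * u powr of_real (-\<beta>)) C < \<delta> / 2"
    using \<delta> by (intro tendstoD[OF limM]) auto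
  with sec have "\<forall>\<^sub>F u in at 0 within sector M. g u \<in> sector N"
  proof eventually_elim
    case (elim u)
    have Ru: "Re u > 0" using elim M sector_Re_pos[of u M] by simp
    define s where "s = norm u"
    define \<zeta> where "\<zeta> = u / of_real s"
    have s: "s > 0" using Ru by (auto simp: s_def)
    have u: "u = of_real s * \<zeta>" using s by (simp add: \<zeta>_def)
    have nz: "norm \<zeta> = 1" using s by (simp add: \<zeta>_def norm_divide s_def)
    have "\<zeta> \<in> K" using elim(1) s M nz unfolding K_def by (simp add: \<zeta>_def sector_def s_def[symmetric] field_simps)
    then have d1: "\<delta> \<le> Re (C * \<zeta> powr of_real \<beta>)" unfolding \<delta>_def by (rule \<zeta>0(2))
    define e where "e = g u * u powr of_real (-\<beta>) - C"
    have e: "norm e < \<delta> / 2" using elim by (simp add: e_def dist_norm)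
    have u0: "u \<noteq> 0" "\<zeta> \<noteq> 0" using s by (auto simp: s_def \<zeta>_def)
    have "g u = (C + e) * u powr of_real \<beta>" using u0 by (simp add: e_def mult.assoc flip: powr_add)
    also have "\<dots> = of_real (s powr \<beta>) * (C * \<zeta> powr of_real \<beta> + e * \<zeta> powr of_real \<beta>)"
      using s u0 unfolding u powr_of_real_times[OF s u0(2)] by (simp add: powr_of_real algebra_simps)
    finally have gu: "g u = of_real (s powr \<beta>) * (C * \<zeta> powr of_real \<beta> + e * \<zeta> powr of_real \<beta>)" .
    have nb: "norm (\<zeta> powr of_real \<beta>) = 1" using nz by (simp add: norm_powr_real_powr')
    have "Re (e * \<zeta> powr of_real \<beta>) \<ge> - norm (e * \<zeta> powr of_real \<beta>)"
      using complex_Re_le_cmod[of "- (e * \<zeta> powr of_real \<beta>)"] by simp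
    then have "Re (e * \<zeta> powr of_real \<beta>) \<ge> - (\<delta> / 2)" using e nb by (simp add: norm_mult)
    then have "\<delta> / 2 \<le> Re (C * \<zeta> powr of_real \<beta> + e * \<zeta> powr of_real \<beta>)" using d1 by simp
    then have R: "s powr \<beta> * (\<delta> / 2) \<le> Re (g u)" unfolding gu using s by simp
    have "norm (C * \<zeta> powr of_real \<beta> + e * \<zeta> powr of_real \<beta>) \<le> norm C + norm e"
      using norm_triangle_ineq[of "C * \<zeta> powr of_real \<beta>" "e * \<zeta> powr of_real \<beta>"] nb by (simp add: norm_mult)
    also have "\<dots> < norm C + \<delta>" using e \<delta> by linarith
    finally have "norm (g u) < s powr \<beta> * (norm C + \<delta>)" unfolding gu norm_mult using s by simp
    also have "\<dots> = 2 * (norm C + \<delta>) / \<delta> * (s powr \<beta> * (\<delta> / 2))" using \<delta> by simp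
    also have "\<dots> \<le> N * (s powr \<beta> * (\<delta> / 2))" unfolding N_def using s \<delta> by (intro mult_right_mono) auto
    also have "\<dots> \<le> N * Re (g u)" using R N by (intro mult_left_mono) auto
    finally show ?case by (simp add: sector_def)
  qed
  moreover have "(g \<longlongrightarrow> 0) (at 0 within sector M)"
  proof -
    have "((\<lambda>u. g u * u powr of_real (-\<beta>) * u powr of_real \<beta>) \<longlongrightarrow> C * 0) ang"
      using \<beta> by (intro tendsto_mult lim powr_of_real_tendsto_0_ang)
    then have "(g \<longlongrightarrow> 0) ang"
      by (rule ang_cong[OF _ zero_less_one]) (auto simp: cap_nonzero mult.assoc simp flip: powr_add)
    then show ?thesis using M unfolding filterlim_ang_iff by blast
  qed
  ultimately show "filterlim g ang (at 0 within sector M)" by (intro filterlim_angI[OF N])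
qed

text \<open>W is the image of the disc in the coordinate where the semigroup becomes the translation by t,
  \<Psi> is the inverse of that coordinate, and k is the coordinate near x, normalised to vanish at x.\<close>

locale semiflow_model = boundary_regularity \<phi> G h \<tau> x \<alpha> for \<phi> G h \<tau> x \<alpha> +
  fixes W :: "complex set" and \<Psi> k :: "complex \<Rightarrow> complex" and \<rho> :: real and C :: complex
  assumes G_reg: "G_regular" and \<rho>: "\<rho> > 0"
    and W_open: "open W" and W_shift: "\<zeta> \<in> W \<Longrightarrow> t \<ge> 0 \<Longrightarrow> \<zeta> + of_real t \<in> W"
    and Psi_hol: "\<Psi> holomorphic_on W" and Psi_in: "\<zeta> \<in> W \<Longrightarrow> norm (\<Psi> \<zeta>) < 1"
    and Psi_shift: "\<zeta> \<in> W \<Longrightarrow> t \<ge> 0 \<Longrightarrow> \<Psi> (\<zeta> + of_real t) = \<phi> t (\<Psi> \<zeta>)"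
    and proper: "(\<And>n::nat. w n \<in> W) \<Longrightarrow> w \<longlonglongrightarrow> \<zeta> \<Longrightarrow> (\<lambda>n. \<Psi> (w n)) \<longlonglongrightarrow> z \<Longrightarrow> norm z < 1 \<Longrightarrow> \<zeta> \<in> W"
    and k_hol: "k holomorphic_on cap \<rho>" and k_W: "u \<in> cap \<rho> \<Longrightarrow> k u \<in> W" and Psi_k: "u \<in> cap \<rho> \<Longrightarrow> \<Psi> (k u) = pt u"
    and C: "C \<noteq> 0" and k_lim: "((\<lambda>u. k u * u powr of_real (-\<beta>)) \<longlongrightarrow> C) ang"

section \<open>Construction of the semiflow model\<close>

context boundary_regularity
begin

text \<open>\<open>k\<close> integrates \<open>dz / G\<close>, the time of the flow, and
  \<open>\<alpha> < 1\<close> makes the integral converge at x. The equation for h then integrates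
  to \<open>h = c + k\<close> or \<open>h = c * exp (lam * k)\<close>, that is, \<open>e\<close>
  applied to \<open>k\<close>. So \<Psi> is the inverse of h after \<open>e\<close>, and W is the
  full preimage of the image of h; in the elliptic case this unwinds the exponential. The property
  \<open>proper\<close> says that \<Psi> tends to the circle at boundary points of W.\<close>

lemma semiflow_model_exists:
  assumes reg: G_regular
  obtains W \<Psi> k \<rho> C where "semiflow_model \<phi> G h \<tau> x \<alpha> W \<Psi> k \<rho> C"
proof -
  obtain L where L: "L \<noteq> 0" "((\<lambda>u. G (pt u) * u powr of_real (-\<alpha>)) \<longlongrightarrow> L) ang"
    using reg unfolding G_regular_def by blast
  have "x \<noteq> \<tau>" by (rule x_neq_tau[OF L(1) filterlim_compose[OF L(2) filterlim_of_real_ang]])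
  define \<rho> where "\<rho> = norm (x - \<tau>)"
  have \<rho>: "\<rho> > 0" using \<open>x \<noteq> \<tau>\<close> by (simp add: \<rho>_def)
  have nt: "pt u \<noteq> \<tau>" if "u \<in> cap \<rho>" for u
    using pt_neq_tau that by (simp add: \<rho>_def)
  have Gnz: "G (pt u) \<noteq> 0" if "u \<in> cap \<rho>" for u by (rule G_nz[OF pt_in[OF that] nt[OF that]])
  have holG: "(\<lambda>u. - x / G (pt u)) holomorphic_on cap \<rho>"
    using Gnz by (intro holomorphic_intros holomorphic_on_cap[OF G_hol x]) auto
  obtain k0 where k0: "\<And>u. u \<in> cap \<rho> \<Longrightarrow> (k0 has_field_derivative - x / G (pt u)) (at u)"
    using holomorphic_convex_primitive'[OF cap_convex cap_open holG] at_within_open[OF _ cap_open] by metis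
  have holk0: "k0 holomorphic_on cap \<rho>" using k0 by (auto simp: holomorphic_on_open)
  have "((\<lambda>u. - x * inverse (G (pt u) * u powr of_real (-\<alpha>))) \<longlongrightarrow> - x * inverse L) ang"
    by (intro tendsto_intros L)
  then have dk: "((\<lambda>u. deriv k0 u * u powr of_real \<alpha>) \<longlongrightarrow> - x * inverse L) ang"
    by (rule ang_cong[OF _ \<rho>]) (auto simp: DERIV_imp_deriv[OF k0] cap_nonzero powr_minus divide_inverse)
  obtain d where d: "(k0 \<longlongrightarrow> d) ang" "((\<lambda>u. (k0 u - d) * u powr of_real (\<alpha> - 1)) \<longlongrightarrow> (- x * inverse L) / of_real (1 - \<alpha>)) ang"
    by (rule ang_primitive[OF holk0 \<rho> alpha(2) dk])
  define k where "k = (\<lambda>u. k0 u - d)"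
  define C where "C = (- x * inverse L) / complex_of_real (1 - \<alpha>)"
  have C: "C \<noteq> 0" unfolding C_def using L x_nz alpha by (simp del: of_real_diff)
  have dk: "(k has_field_derivative - x / G (pt u)) (at u)" if "u \<in> cap \<rho>" for u
    unfolding k_def using DERIV_diff[OF k0[OF that] DERIV_const[of d]] by simp
  have holk: "k holomorphic_on cap \<rho>" unfolding k_def by (intro holomorphic_intros holk0)
  have dh: "((\<lambda>u. h (pt u)) has_field_derivative - x * deriv h (pt u)) (at u)" if "u \<in> cap \<rho>" for u
    using holomorphic_derivI[OF holomorphic_on_cap[OF h_hol x] cap_open that] unfolding deriv_on_cap[OF h_hol x that] .
  define lam where "lam = deriv G \<tau>"
  obtain c where c: "\<And>u. u \<in> cap \<rho> \<Longrightarrow> h (pt u) = (if norm \<tau> < 1 then c * exp (lam * k u) else c + k u)"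
    and c0: "norm \<tau> < 1 \<Longrightarrow> c \<noteq> 0"
  proof (cases "norm \<tau> < 1")
    case False
    have d0: "((\<lambda>u. h (pt u) - k u) has_field_derivative 0) (at u)" if u: "u \<in> cap \<rho>" for u
    proof -
      have "deriv h (pt u) = 1 / G (pt u)"
        using h_G_nonelliptic[OF False pt_in[OF u]] Gnz[OF u] by (simp add: eq_divide_eq)
      then show ?thesis using DERIV_diff[OF dh[OF u] dk[OF u]] by simp
    qed
    have "\<exists>c. \<forall>u\<in>cap \<rho>. h (pt u) - k u = c"
      by (rule has_field_derivative_zero_constant[OF cap_convex]) (rule has_field_derivative_at_within[OF d0])
    then obtain c where "\<And>u. u \<in> cap \<rho> \<Longrightarrow> h (pt u) - k u = c" by blast
    then have "\<And>u. u \<in> cap \<rho> \<Longrightarrow> h (pt u) = c + k u" by (simp add: algebra_simps)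
    then show ?thesis using that[of c] False by auto
  next
    case True
    have d0: "((\<lambda>u. h (pt u) * exp (- lam * k u)) has_field_derivative 0) (at u)" if u: "u \<in> cap \<rho>" for u
    proof -
      have "((\<lambda>u. exp (- lam * k u)) has_field_derivative exp (- lam * k u) * (- lam * (- x / G (pt u)))) (at u)"
        by (rule DERIV_chain2[where f = exp, OF DERIV_exp DERIV_cmult[OF dk[OF u]]])
      from DERIV_mult[OF dh[OF u] this]
      have "((\<lambda>u. h (pt u) * exp (- lam * k u)) has_field_derivative
        - x * deriv h (pt u) * exp (- lam * k u) + exp (- lam * k u) * (- lam * (- x / G (pt u))) * h (pt u)) (at u)" .
      moreover have "deriv h (pt u) = lam * h (pt u) / G (pt u)"
        using h_G_elliptic[OF True pt_in[OF u]] Gnz[OF u] by (simp add: eq_divide_eq lam_def)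
      ultimately show ?thesis by simp
    qed
    have "\<exists>c. \<forall>u\<in>cap \<rho>. h (pt u) * exp (- lam * k u) = c"
      by (rule has_field_derivative_zero_constant[OF cap_convex]) (rule has_field_derivative_at_within[OF d0])
    then obtain c where c: "\<And>u. u \<in> cap \<rho> \<Longrightarrow> h (pt u) * exp (- lam * k u) = c" by blast
    have hc: "h (pt u) = c * exp (lam * k u)" if "u \<in> cap \<rho>" for u
      unfolding c[OF that, symmetric] by (simp add: mult.assoc flip: exp_add)
    have "\<exists>u. u \<in> cap \<rho>" using eventually_happens'[OF ang_neq_bot eventually_ang_cap[OF \<rho>]] .
    then obtain u where u: "u \<in> cap \<rho>" by blast
    have "h (pt u) \<noteq> 0"
      using h_G_elliptic[OF True pt_in[OF u]] h_deriv_nz[OF pt_in[OF u]] Gnz[OF u] by auto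
    then have "c \<noteq> 0" using hc[OF u] by auto
    then show ?thesis using that[of c] hc True by auto
  qed
  define e where "e = (\<lambda>\<zeta>. if norm \<tau> < 1 then c * exp (lam * \<zeta>) else c + \<zeta>)"
  have hole: "e holomorphic_on UNIV" unfolding e_def by (cases "norm \<tau> < 1") (auto intro!: holomorphic_intros)
  have cont_e: "continuous_on UNIV e" by (rule holomorphic_on_imp_continuous_on[OF hole])
  define W where "W = e -` (h ` ball 0 1)"
  obtain g where g: "g holomorphic_on (h ` ball 0 1)" "\<And>z. z \<in> ball 0 1 \<Longrightarrow> g (h z) = z"
    using holomorphic_has_inverse[OF h_hol open_ball h_inj] by metis
  define \<Psi> where "\<Psi> = g \<circ> e"
  have PsiW: "norm (\<Psi> \<zeta>) < 1 \<and> h (\<Psi> \<zeta>) = e \<zeta>" if "\<zeta> \<in> W" for \<zeta>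
    using that g(2) unfolding W_def \<Psi>_def by auto
  have eq: "\<zeta> \<in> W \<and> \<Psi> \<zeta> = z" if "norm z < 1" "h z = e \<zeta>" for z \<zeta>
    using that g(2)[of z] unfolding W_def \<Psi>_def by (auto simp flip: that(2))
  have shift: "e (\<zeta> + of_real t) = h (\<phi> t z)" if "norm z < 1" "h z = e \<zeta>" "t \<ge> 0" for z \<zeta> t
  proof (cases "norm \<tau> < 1")
    case True
    then show ?thesis using h_phi_elliptic[OF True that(3,1)] that(2)
      by (simp add: e_def lam_def distrib_left exp_add mult_ac)
  next
    case False
    then show ?thesis using h_phi_nonelliptic[OF False that(3,1)] that(2) by (simp add: e_def)
  qed
  have "semiflow_model \<phi> G h \<tau> x \<alpha> W \<Psi> k \<rho> C"
  proof (unfold_locales)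
    show G_regular by (rule reg)
    show "open W" unfolding W_def
      using open_vimage[OF open_mapping_thm3[OF h_hol open_ball h_inj] cont_e] .
    show "\<zeta> + of_real t \<in> W" "\<Psi> (\<zeta> + of_real t) = \<phi> t (\<Psi> \<zeta>)" if "\<zeta> \<in> W" "t \<ge> 0" for \<zeta> t
      using eq[of "\<phi> t (\<Psi> \<zeta>)" "\<zeta> + of_real t"] PsiW[OF that(1)] shift[of "\<Psi> \<zeta>" \<zeta> t] phi_norm[OF that(2)] that by auto
    show "\<Psi> holomorphic_on W" unfolding \<Psi>_def
      by (rule holomorphic_on_compose_gen[OF holomorphic_on_subset[OF hole] g(1)]) (auto simp: W_def)
    show "norm (\<Psi> \<zeta>) < 1" if "\<zeta> \<in> W" for \<zeta> using PsiW[OF that] by blast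
    show "\<zeta> \<in> W" if w: "\<And>n::nat. w n \<in> W" "w \<longlonglongrightarrow> \<zeta>" "(\<lambda>n. \<Psi> (w n)) \<longlonglongrightarrow> z" "norm z < 1" for w \<zeta> z
    proof -
      have "isCont h z" using w(4) by (intro continuous_on_interior[OF holomorphic_on_imp_continuous_on[OF h_hol]]) auto
      then have "(\<lambda>n. h (\<Psi> (w n))) \<longlonglongrightarrow> h z" by (rule isCont_tendsto_compose[OF _ w(3)])
      moreover have "isCont e \<zeta>" using cont_e by (simp add: continuous_on_eq_continuous_at)
      then have "(\<lambda>n. e (w n)) \<longlonglongrightarrow> e \<zeta>" by (rule isCont_tendsto_compose[OF _ w(2)])
      ultimately have "h z = e \<zeta>" using PsiW[OF w(1)] LIMSEQ_unique by auto
      then show ?thesis using eq w(4) by blast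
    qed
    show "k u \<in> W" "\<Psi> (k u) = pt u" if "u \<in> cap \<rho>" for u
      using eq[OF pt_in[OF that], of "k u"] c[OF that] by (auto simp: e_def)
    show "((\<lambda>u. k u * u powr of_real (- \<beta>)) \<longlongrightarrow> C) ang" unfolding k_def C_def using d(2) by simp
  qed (use \<rho> holk C in auto)
  then show ?thesis by (rule that)
qed

text \<open>\<open>deriv (\<phi> t)\<close> is the quotient of \<open>G \<circ> \<phi> t\<close> by
  G, and the order of G at x is known.\<close>

lemma phi_regular_of_G_limit:
  assumes reg: G_regular and t: "t \<ge> 0" and lim: "((\<lambda>u. G (\<phi> t (pt u))) \<longlongrightarrow> E) ang" and E: "E \<noteq> 0"
  shows "phi_regular t"
proof -
  obtain L where L: "L \<noteq> 0" "((\<lambda>u. G (pt u) * u powr of_real (-\<alpha>)) \<longlongrightarrow> L) ang"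
    using reg unfolding G_regular_def by blast
  have xt: "x \<noteq> \<tau>" by (rule x_neq_tau[OF L(1) filterlim_compose[OF L(2) filterlim_of_real_ang]])
  have lim2: "((\<lambda>u. G (\<phi> t (pt u)) / (G (pt u) * u powr of_real (-\<alpha>))) \<longlongrightarrow> E / L) ang"
    by (intro tendsto_intros lim L)
  have "((\<lambda>u. deriv (\<phi> t) (pt u) * u powr of_real \<alpha>) \<longlongrightarrow> E / L) ang"
  proof (rule ang_cong[OF lim2])
    show "norm (x - \<tau>) > 0" using xt by simp
    fix u assume u: "u \<in> cap (norm (x - \<tau>))"
    have "pt u \<noteq> \<tau>" by (rule pt_neq_tau[OF u])
    then have "G (pt u) \<noteq> 0" by (rule G_nz[OF pt_in[OF u]])
    then show "G (\<phi> t (pt u)) / (G (pt u) * u powr of_real (-\<alpha>)) = deriv (\<phi> t) (pt u) * u powr of_real \<alpha>"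
      unfolding G_phi[OF t pt_in[OF u], symmetric] by (simp add: powr_minus divide_inverse)
  qed simp
  then show ?thesis unfolding phi_regular_def using E L by (intro exI[of _ "E / L"]) auto
qed

lemma phi_regular_of_interior_value:
  assumes reg: G_regular and t: "t \<ge> 0" and y: "((\<lambda>u. \<phi> t (pt u)) \<longlongrightarrow> y) ang" "norm y < 1"
  shows "phi_regular t"
proof (rule phi_regular_of_G_limit[OF reg t])
  have "isCont G y"
    using y(2) by (intro continuous_on_interior[OF holomorphic_on_imp_continuous_on[OF G_hol]]) auto
  then show "((\<lambda>u. G (\<phi> t (pt u))) \<longlongrightarrow> G y) ang" by (rule isCont_tendsto_compose[OF _ y(1)])
  have "y \<noteq> \<tau>"
    using injective_boundary_value_not_attained[OF phi_hol[OF t] phi_inj[OF t] x y(1), of \<tau>] phi_tau[OF _ t] y by auto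
  then show "G y \<noteq> 0" by (rule G_nz[OF y(2)])
qed

end

context semiflow_model
begin

lemma k_tendsto_0: "(k \<longlongrightarrow> 0) ang"
proof -
  have "((\<lambda>u. k u * u powr of_real (-\<beta>) * u powr of_real \<beta>) \<longlongrightarrow> C * 0) ang"
    using alpha by (intro tendsto_mult k_lim powr_of_real_tendsto_0_ang) auto
  then show ?thesis
    by (rule ang_cong[OF _ zero_less_one]) (auto simp: cap_nonzero mult.assoc simp flip: powr_add)
qed

lemma phi_Psi: "t \<ge> 0 \<Longrightarrow> u \<in> cap \<rho> \<Longrightarrow> \<phi> t (pt u) = \<Psi> (of_real t + k u)"
  using Psi_shift[OF k_W, of u t] Psi_k[of u] by (simp add: add.commute)

text \<open>In the model x corresponds to 0, so the value of \<open>\<phi> t\<close> at x is \<Psi>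
  at t whenever t lies in the open set W.\<close>

lemma interior_of_W:
  assumes t: "t \<ge> 0" "of_real t \<in> W"
  shows "((\<lambda>u. \<phi> t (pt u)) \<longlongrightarrow> \<Psi> (of_real t)) ang" "norm (\<Psi> (of_real t)) < 1" "phi_regular t"
proof -
  have "isCont \<Psi> (of_real t)"
    using t W_open holomorphic_on_imp_continuous_on[OF Psi_hol] by (simp add: continuous_on_eq_continuous_at)
  moreover have "((\<lambda>u. of_real t + k u) \<longlongrightarrow> of_real t) ang"
    using tendsto_add[OF tendsto_const k_tendsto_0, of "of_real t"] by simp
  ultimately have "((\<lambda>u. \<Psi> (of_real t + k u)) \<longlongrightarrow> \<Psi> (of_real t)) ang" by (rule isCont_tendsto_compose)
  then show 1: "((\<lambda>u. \<phi> t (pt u)) \<longlongrightarrow> \<Psi> (of_real t)) ang"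
    by (rule ang_cong[OF _ \<rho>]) (simp_all add: phi_Psi t)
  show 2: "norm (\<Psi> (of_real t)) < 1" by (rule Psi_in[OF t(2)])
  show "phi_regular t" by (rule phi_regular_of_interior_value[OF G_reg t(1) 1 2])
qed

text \<open>Near 0 the map \<open>k\<close> sends one ray below and the other above the real axis.
  On the segment joining them it takes a real value of modulus less than t, and translation to the
  right inside W reaches t.\<close>

lemma positive_reals_in_W:
  assumes \<zeta>: "Re \<zeta>1 > 0" "Re \<zeta>2 > 0" and sgn: "Im (C * \<zeta>1 powr of_real \<beta>) < 0" "0 < Im (C * \<zeta>2 powr of_real \<beta>)"
    and t: "t > 0"
  shows "complex_of_real t \<in> W"
proof -
  have lim: "((\<lambda>s. Im (k (of_real s * \<zeta>) / of_real (s powr \<beta>))) \<longlongrightarrow> Im (C * \<zeta> powr of_real \<beta>)) (at_right 0)" if "Re \<zeta> > 0" for \<zeta>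
    by (intro tendsto_Im ray_limit k_lim that)
  have sd: "Im (z / of_real (s powr \<beta>)) = Im z / s powr \<beta>" for z s by (rule Im_divide_of_real)
  have 1: "\<forall>\<^sub>F s in at_right 0. Im (k (of_real s * \<zeta>1) / of_real (s powr \<beta>)) < 0"
    by (rule order_tendstoD(2)[OF lim[OF \<zeta>(1)] sgn(1)])
  have 2: "\<forall>\<^sub>F s in at_right 0. 0 < Im (k (of_real s * \<zeta>2) / of_real (s powr \<beta>))"
    by (rule order_tendstoD(1)[OF lim[OF \<zeta>(2)] sgn(2)])
  obtain M1 M2 where M12: "M1 > 1" "\<zeta>1 \<in> sector M1" "M2 > 1" "\<zeta>2 \<in> sector M2" using in_some_sector \<zeta> by metis
  define M where "M = max M1 M2"
  have M: "M > 1" "\<zeta>1 \<in> sector M" "\<zeta>2 \<in> sector M"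
    using M12 sector_mono[of M1 M] sector_mono[of M2 M] by (auto simp: M_def)
  have "(k \<longlongrightarrow> 0) (at 0 within sector M)" using k_tendsto_0 M unfolding filterlim_ang_iff by blast
  from tendstoD[OF this t] obtain d where d: "d > 0"
    and kd: "\<And>u. u \<in> sector M \<Longrightarrow> u \<noteq> 0 \<Longrightarrow> norm u < d \<Longrightarrow> norm (k u) < t"
    unfolding eventually_at by (auto simp: dist_norm)
  have capev: "\<forall>\<^sub>F s in at_right (0::real). of_real s * \<zeta> \<in> cap \<rho> \<and> norm (of_real s * \<zeta>) < d" if "Re \<zeta> > 0" for \<zeta>
    using filterlim_ray_ang[OF that, unfolded filterlim_iff, rule_format, OF eventually_conj[OF eventually_ang_cap[OF \<rho>] eventually_ang_norm[OF d]]] .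
  have "\<forall>\<^sub>F s in at_right (0::real). \<exists>u. u \<in> cap \<rho> \<and> norm (k u) < t \<and> Im (k u) = 0"
    using 1 2 capev[OF \<zeta>(1)] capev[OF \<zeta>(2)] eventually_at_right_less[of "0::real"]
  proof eventually_elim
    case (elim s)
    define S where "S = closed_segment (of_real s * \<zeta>1) (of_real s * \<zeta>2)"
    have S1: "S \<subseteq> cap \<rho>" unfolding S_def using elim by (intro closed_segment_subset) auto
    have S2: "S \<subseteq> sector M" unfolding S_def using elim M by (intro closed_segment_subset sector_scale convex_sector) auto
    have S3: "S \<subseteq> ball 0 d" unfolding S_def using elim by (intro closed_segment_subset) auto
    have sp: "s powr \<beta> > 0" using elim by simp
    have n: "Im (k (of_real s * \<zeta>1)) \<le> 0" "0 \<le> Im (k (of_real s * \<zeta>2))"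
      using elim(1,2) sp unfolding sd by (auto simp: divide_less_0_iff zero_less_divide_iff)
    have "connected ((\<lambda>u. Im (k u)) ` S)"
      unfolding S_def using S1[unfolded S_def]
      by (intro connected_continuous_image continuous_intros continuous_on_subset[OF holomorphic_on_imp_continuous_on[OF k_hol]]) auto
    from connectedD_interval[OF this _ _ n] have "0 \<in> (\<lambda>u. Im (k u)) ` S"
      unfolding S_def by auto
    then obtain u where u: "u \<in> S" "Im (k u) = 0" by auto
    have "u \<noteq> 0" using u S1 by (intro cap_nonzero[of u \<rho>]) auto
    then have "norm (k u) < t" using u S2 S3 by (intro kd) auto
    then show ?case using u S1 by blast
  qed
  then obtain u where u: "u \<in> cap \<rho>" "norm (k u) < t" "Im (k u) = 0"
    using eventually_happens'[OF trivial_limit_at_right_real] by blast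
  have "Re (k u) \<le> t" using complex_Re_le_cmod[of "k u"] u by linarith
  then have "k u + of_real (t - Re (k u)) \<in> W" by (intro W_shift k_W u) auto
  moreover have "k u + of_real (t - Re (k u)) = of_real t" using u by (simp add: complex_eq_iff)
  ultimately show ?thesis by simp
qed

end


section \<open>Times strictly before the end of the boundary slit\<close>

context semiflow_model
begin

lemma deriv_Psi:
  assumes "\<zeta> \<in> W" shows "deriv \<Psi> \<zeta> = G (\<Psi> \<zeta>)"
proof (rule curve_deriv_unique)
  have "(\<Psi> has_field_derivative deriv \<Psi> \<zeta>) (at (\<zeta> + of_real 0))"
    using holomorphic_derivI[OF Psi_hol W_open assms] by simp
  moreover have "((\<lambda>s. \<zeta> + s) has_field_derivative 1) (at (complex_of_real 0))"
    by (auto intro!: derivative_eq_intros)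
  ultimately have "((\<lambda>s. \<Psi> (\<zeta> + s)) has_field_derivative deriv \<Psi> \<zeta> * 1) (at (complex_of_real 0))"
    by (rule DERIV_chain2[where f = \<Psi>])
  from has_vector_derivative_real_field[OF this]
  show "((\<lambda>s. \<Psi> (\<zeta> + of_real s)) has_vector_derivative deriv \<Psi> \<zeta>) (at 0 within {0..})" by simp
  have "((\<lambda>s. \<phi> s (\<Psi> \<zeta>)) has_vector_derivative G (\<Psi> \<zeta>)) (at 0 within {0..})"
    using phi_vderiv[of 0 "\<Psi> \<zeta>"] phi_0 Psi_in[OF assms] by simp
  then show "((\<lambda>s. \<Psi> (\<zeta> + of_real s)) has_vector_derivative G (\<Psi> \<zeta>)) (at 0 within {0..})"
    by (rule has_vector_derivative_transform[rotated 2]) (use Psi_shift[OF assms] in auto)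
qed

lemma notin_W_downward: "of_real T \<notin> W \<Longrightarrow> t \<le> T \<Longrightarrow> of_real t \<notin> W"
  using W_shift[of "of_real t" "T - t"] by auto

text \<open>On the positive axis \<open>k\<close> lies on the side \<sigma> and tends to 0, so by
  continuity it attains every small height, with real part below d. Translation to the right then
  fills the half-strip.\<close>

lemma half_strip_in_W:
  assumes \<sigma>: "\<sigma> = 1 \<or> \<sigma> = (-1::real)" and sgn: "\<And>\<zeta>. Re \<zeta> > 0 \<Longrightarrow> \<sigma> * Im (C * \<zeta> powr of_real \<beta>) > 0"
    and d: "d > 0"
  obtains \<eta>0 where "\<eta>0 > 0" "\<And>\<xi> \<eta>. \<xi> \<ge> d \<Longrightarrow> 0 < \<eta> \<Longrightarrow> \<eta> < \<eta>0 \<Longrightarrow> Complex \<xi> (\<sigma> * \<eta>) \<in> W"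
proof -
  define f where "f = (\<lambda>s. \<sigma> * Im (k (of_real s)))"
  have \<sigma>\<sigma>: "\<sigma> * (\<sigma> * a) = a" for a using \<sigma> by auto
  have "((\<lambda>s. \<sigma> * Im (k (of_real s * 1) / of_real (s powr \<beta>))) \<longlongrightarrow> \<sigma> * Im (C * 1 powr of_real \<beta>)) (at_right 0)"
    by (intro tendsto_mult tendsto_const tendsto_Im ray_limit k_lim) simp
  then have "\<forall>\<^sub>F s in at_right 0. 0 < \<sigma> * Im (k (of_real s * 1) / of_real (s powr \<beta>))"
    by (rule order_tendstoD) (rule sgn, simp)
  then have 1: "\<forall>\<^sub>F s in at_right 0. 0 < f s"
    using eventually_at_right_less[of "0::real"]
    by eventually_elim (auto simp: f_def Im_divide_of_real zero_less_divide_iff simp del: of_real_diff)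
  have krad: "((\<lambda>s. k (of_real s)) \<longlongrightarrow> 0) (at_right 0)"
    by (rule filterlim_compose[OF k_tendsto_0 filterlim_of_real_ang])
  have 2: "\<forall>\<^sub>F s in at_right 0. norm (k (of_real s)) < e" if "e > 0" for e
    using tendstoD[OF krad that] by simp
  have "\<forall>\<^sub>F s in at_right (0::real). 0 < f s \<and> norm (k (of_real s)) < d \<and> of_real s \<in> cap \<rho>"
    by (intro eventually_conj 1 2 d real_cap \<rho>)
  then obtain b where b: "b > 0" and bs: "\<And>s. 0 < s \<Longrightarrow> s < b \<Longrightarrow> 0 < f s \<and> norm (k (of_real s)) < d \<and> of_real s \<in> cap \<rho>"
    unfolding eventually_at_right_field by blast
  define s1 where "s1 = b / 2"
  have s1: "0 < s1" "s1 < b" using b by (auto simp: s1_def)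
  show ?thesis
  proof (rule that[of "f s1"])
    show "f s1 > 0" using bs s1 by blast
    fix \<xi> \<eta> assume h: "\<xi> \<ge> d" "0 < \<eta>" "\<eta> < f s1"
    obtain c where c: "c > 0" "\<And>s. 0 < s \<Longrightarrow> s < c \<Longrightarrow> norm (k (of_real s)) < \<eta>"
      using 2[OF h(2)] unfolding eventually_at_right_field by blast
    define s2 where "s2 = min s1 (c / 2)"
    have s2: "0 < s2" "s2 \<le> s1" "s2 < c" using s1 c by (auto simp: s2_def)
    have "f s2 \<le> norm (k (of_real s2))"
      using \<sigma> abs_Im_le_cmod[of "k (of_real s2)"] by (auto simp: f_def)
    then have "f s2 \<le> \<eta>" using c(2)[of s2] s2 by auto
    moreover have "continuous_on {s2..s1} f"
    proof -
      have "continuous_on {s2..s1} (\<lambda>s. k (of_real s))"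
        by (rule continuous_on_compose2[OF holomorphic_on_imp_continuous_on[OF k_hol]])
           (use bs s1 s2 in \<open>auto intro!: continuous_intros\<close>)
      then show ?thesis unfolding f_def by (intro continuous_intros)
    qed
    ultimately obtain s where s: "s2 \<le> s" "s \<le> s1" "f s = \<eta>"
      using IVT'[of f s2 \<eta> s1] h s2 by auto
    have sp: "0 < s" "s < b" using s s1 s2 by auto
    have "Re (k (of_real s)) \<le> \<xi>"
      using complex_Re_le_cmod[of "k (of_real s)"] bs[OF sp] h by linarith
    then have "k (of_real s) + of_real (\<xi> - Re (k (of_real s))) \<in> W" using bs[OF sp] by (intro W_shift k_W) auto
    moreover have "Im (k (of_real s)) = \<sigma> * \<eta>" unfolding s(3)[symmetric] f_def by (simp only: \<sigma>\<sigma>)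
    then have "k (of_real s) + of_real (\<xi> - Re (k (of_real s))) = Complex \<xi> (\<sigma> * \<eta>)" by (simp add: complex_eq_iff)
    ultimately show "Complex \<xi> (\<sigma> * \<eta>) \<in> W" by simp
  qed
qed

text \<open>W contains a rectangle resting on the real axis around \<open>t0\<close>, and the base
  of the rectangle is outside W. A linear bound for \<open>1 - (norm \<Psi>)^2\<close> above
  \<open>t0\<close> is what the Julia-Wolff-Caratheodory theorem needs; the angular derivative it
  provides is, through \<open>deriv_Psi\<close>, a nonzero limit of G.\<close>

lemma phi_regular_before:
  assumes \<sigma>: "\<sigma> = 1 \<or> \<sigma> = (-1::real)" and sgn: "\<And>\<zeta>. Re \<zeta> > 0 \<Longrightarrow> \<sigma> * Im (C * \<zeta> powr of_real \<beta>) > 0"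
    and t0: "0 < t0" "t0 < T" "of_real T \<notin> W"
  shows "phi_regular t0"
proof -
  have \<beta>: "\<beta> > 0" using alpha by simp
  obtain \<eta>0 where \<eta>0: "\<eta>0 > 0" "\<And>\<xi> \<eta>. \<xi> \<ge> t0 / 2 \<Longrightarrow> 0 < \<eta> \<Longrightarrow> \<eta> < \<eta>0 \<Longrightarrow> Complex \<xi> (\<sigma> * \<eta>) \<in> W"
    by (rule half_strip_in_W[OF \<sigma> sgn, of "t0 / 2"]) (use t0 in auto)
  \<comment> \<open>\<open>t0 / 2\<close> keeps the rectangle over the half-strip,
    \<open>T - t0\<close> keeps its base among reals outside W, and \<open>\<eta>0 / 2\<close> keeps
    its height inside the strip.\<close>
  define r where "r = min (t0 / 2) (min (T - t0) (\<eta>0 / 2))"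
  have r: "r > 0" "r \<le> t0 / 2" "r \<le> T - t0" "r < \<eta>0" unfolding r_def using t0 \<eta>0(1) by linarith+
  \<comment> \<open>Carries 0 to \<open>t0\<close>, the imaginary axis to the real axis and the
    right half-plane to the side \<sigma>.\<close>
  define A where "A = (\<lambda>w. of_real t0 + \<i> * of_real \<sigma> * w)"
  have A_eq: "A w = Complex (t0 - \<sigma> * Im w) (\<sigma> * Re w)" for w by (simp add: A_def complex_eq_iff)
  have \<sigma>b: "\<bar>\<sigma> * a\<bar> = \<bar>a\<bar>" for a using \<sigma> by auto
  define V where "V = A -` W"
  have inV: "w \<in> V" if "0 < Re w" "Re w \<le> r" "\<bar>Im w\<bar> \<le> r" for w
    unfolding V_def vimage_eq A_eq
  proof (rule \<eta>0(2))
    have "\<bar>\<sigma> * Im w\<bar> \<le> r" using that \<sigma>b by simp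
    then show "t0 / 2 \<le> t0 - \<sigma> * Im w" using r(2) by linarith
  qed (use that r in auto)
  define \<Phi> where "\<Phi> = (\<lambda>w. \<Psi> (A w))"
  have holA: "A holomorphic_on S" for S unfolding A_def by (intro holomorphic_intros)
  have hol\<Phi>: "\<Phi> holomorphic_on V"
  proof -
    have "(\<Psi> \<circ> A) holomorphic_on V"
      by (rule holomorphic_on_compose_gen[OF holA Psi_hol]) (auto simp: V_def)
    then show ?thesis by (simp add: \<Phi>_def o_def)
  qed
  have \<Phi>1: "norm (\<Phi> w) < 1" if "w \<in> V" for w using that Psi_in by (simp add: V_def \<Phi>_def)
  \<comment> \<open>Otherwise compactness yields a limit point on the base along which \<Psi> stays
    away from the circle. By \<open>proper\<close> it would belong to W, yet it is a real number at
    most T.\<close>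
  have near_1: "\<exists>\<epsilon>>0. \<forall>w. 0 < Re w \<and> Re w < \<epsilon> \<and> \<bar>Im w\<bar> \<le> r \<longrightarrow> \<eta> < norm (\<Phi> w)" if \<eta>: "\<eta> < 1" for \<eta>
  proof (rule ccontr)
    assume neg: "\<not> ?thesis"
    have "\<exists>w. 0 < Re w \<and> Re w < r / (real n + 1) \<and> \<bar>Im w\<bar> \<le> r \<and> norm (\<Phi> w) \<le> \<eta>" for n :: nat
    proof -
      have "r / (real n + 1) > 0" using r by simp
      then show ?thesis using neg by (meson not_less)
    qed
    then obtain w where w: "\<And>n. 0 < Re (w n)" "\<And>n. Re (w n) < r / (real n + 1)" "\<And>n. \<bar>Im (w n)\<bar> \<le> r" "\<And>n. norm (\<Phi> (w n)) \<le> \<eta>"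
      by metis
    have wr: "Re (w n) \<le> r" for n
    proof -
      have "r / (real n + 1) \<le> r / 1" using r by (intro divide_left_mono) auto
      then show ?thesis using w(2)[of n] by simp
    qed
    have wV: "w n \<in> V" for n using inV w wr by blast
    have "norm (w n) \<le> 2 * r" for n
      using cmod_le[of "w n"] w(1,3)[of n] wr[of n] by linarith
    then have "bounded (range w)" by (auto simp: bounded_iff)
    then obtain w0 s1 where s1: "strict_mono (s1 :: nat \<Rightarrow> nat)" "(\<lambda>n. w (s1 n)) \<longlonglongrightarrow> w0"
      using bounded_imp_convergent_subsequence[of w] by (auto simp: o_def)
    have "bounded (range (\<lambda>n. \<Phi> (w (s1 n))))" using w(4) by (auto simp: bounded_iff)
    then obtain z0 s2 where s2: "strict_mono (s2 :: nat \<Rightarrow> nat)" "(\<lambda>n. \<Phi> (w (s1 (s2 n)))) \<longlonglongrightarrow> z0"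
      using bounded_imp_convergent_subsequence[of "\<lambda>n. \<Phi> (w (s1 n))"] by (auto simp: o_def)
    define q where "q = s1 \<circ> s2"
    have q: "strict_mono q" unfolding q_def by (rule strict_mono_o[OF s1(1) s2(1)])
    have wq: "(\<lambda>n. w (q n)) \<longlonglongrightarrow> w0" using LIMSEQ_subseq_LIMSEQ[OF s1(2) s2(1)] by (simp add: o_def q_def)
    have \<Phi>q: "(\<lambda>n. \<Phi> (w (q n))) \<longlonglongrightarrow> z0" using s2(2) by (simp add: q_def)
    have rl: "(\<lambda>n. r / (real n + 1)) \<longlonglongrightarrow> 0" by real_asymp
    have "(\<lambda>n. Re (w n)) \<longlonglongrightarrow> 0"
      by (rule tendsto_sandwich[OF _ _ tendsto_const rl]) (use w in \<open>auto intro!: always_eventually less_imp_le\<close>)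
    from LIMSEQ_subseq_LIMSEQ[OF this q] have "(\<lambda>n. Re (w (q n))) \<longlonglongrightarrow> 0" by (simp add: o_def)
    then have R0: "Re w0 = 0" using tendsto_Re[OF wq] LIMSEQ_unique by blast
    have I0: "\<bar>Im w0\<bar> \<le> r"
      by (rule tendsto_upperbound[OF tendsto_rabs[OF tendsto_Im[OF wq]]]) (use w in auto)
    have "norm z0 \<le> \<eta>"
      by (rule tendsto_upperbound[OF tendsto_norm[OF \<Phi>q]]) (use w in auto)
    then have z0: "norm z0 < 1" using \<eta> by simp
    have "A w0 \<in> W"
    proof (rule proper[OF _ _ _ z0])
      show "A (w (q n)) \<in> W" for n using wV by (simp add: V_def)
      show "(\<lambda>n. A (w (q n))) \<longlonglongrightarrow> A w0" unfolding A_def by (intro tendsto_intros wq)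
      show "(\<lambda>n. \<Psi> (A (w (q n)))) \<longlonglongrightarrow> z0" using \<Phi>q by (simp add: \<Phi>_def)
    qed
    moreover have "A w0 = of_real (t0 - \<sigma> * Im w0)" unfolding A_eq by (simp add: R0 complex_eq_iff)
    moreover have "t0 - \<sigma> * Im w0 \<le> T" using I0 \<sigma>b[of "Im w0"] r by linarith
    ultimately show False using notin_W_downward[OF t0(3)] by metis
  qed
  obtain \<epsilon> where \<epsilon>: "\<epsilon> > 0" "\<And>w. 0 < Re w \<Longrightarrow> Re w < \<epsilon> \<Longrightarrow> \<bar>Im w\<bar> \<le> r \<Longrightarrow> 1 / 2 < norm (\<Phi> w)"
    using near_1[of "1/2"] by auto
  define \<rho>1 where "\<rho>1 = min r (\<epsilon> / 2)"
  have \<rho>1: "\<rho>1 > 0" "\<rho>1 \<le> r" "\<rho>1 < \<epsilon>" using r \<epsilon> by (auto simp: \<rho>1_def)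
  have half: "1 / 2 < norm (\<Phi> w)" if "0 < Re w" "Re w \<le> \<rho>1" "\<bar>Im w\<bar> \<le> \<rho>1" for w
    using \<epsilon>(2)[of w] that \<rho>1 by auto
  \<comment> \<open>This is \<open>1 - (1 - w / \<rho>1)^2\<close>. On the positive axis its real
    part is at most \<open>2 * w / \<rho>1\<close>, the source of the linear bound in
    \<open>low\<close>.\<close>
  define H where "H = (\<lambda>w::complex. 2 * w / of_real \<rho>1 - (w / of_real \<rho>1)\<^sup>2)"
  have ReH: "Re (H w) = (2 * (Re w / \<rho>1) - (Re w / \<rho>1)\<^sup>2) + (Im w / \<rho>1)\<^sup>2" for w
    unfolding H_def by (simp add: power2_eq_square Re_divide_of_real Im_divide_of_real diff_divide_distrib)
  define F where "F = (\<lambda>w. exp (- of_real (ln 2) * H w) / \<Phi> w)"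
  have nF: "norm (F w) = exp (- (ln 2 * Re (H w))) / norm (\<Phi> w)" for w
    unfolding F_def by (simp add: norm_divide)
  text \<open>The harmonic function Re H is at least 1 on three sides of the rectangle and nonnegative on
    the fourth, where the modulus of \<Phi> tends to 1; so ln 2 * Re H dominates - ln (norm \<Phi>).\<close>
  have F1: "norm (F (of_real s)) \<le> 1" if s: "0 < s" "s < \<rho>1" for s
  \<comment> \<open>The function \<Phi> is available only off the edge, so the rectangle starts at a
    small \<open>\<delta> > 0\<close> where the modulus exceeds \<open>1 / B\<close>; the bound 1
    results from all B above 1.\<close>
  proof (rule dense_ge)
    fix B :: real assume B: "1 < B"
    have "1 / B < 1" using B by simp
    from near_1[OF this] obtain \<epsilon>' where \<epsilon>': "\<epsilon>' > 0" "\<And>w. 0 < Re w \<Longrightarrow> Re w < \<epsilon>' \<Longrightarrow> \<bar>Im w\<bar> \<le> r \<Longrightarrow> 1 / B < norm (\<Phi> w)"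
      by auto
    define \<delta> where "\<delta> = min (\<epsilon>' / 2) s"
    have \<delta>: "0 < \<delta>" "\<delta> < \<epsilon>'" "\<delta> \<le> s" using s \<epsilon>' by (auto simp: \<delta>_def)
    define S where "S = cbox (Complex \<delta> (- \<rho>1)) (Complex \<rho>1 \<rho>1)"
    have S: "w \<in> S \<longleftrightarrow> \<delta> \<le> Re w \<and> Re w \<le> \<rho>1 \<and> \<bar>Im w\<bar> \<le> \<rho>1" for w
      unfolding S_def by (auto simp: in_cbox_complex_iff)
    have SV: "S \<subseteq> V" using S inV \<delta> \<rho>1 by force
    have \<Phi>nz: "\<Phi> w \<noteq> 0" if "w \<in> S" for w
    proof -
      have "1 / 2 < norm (\<Phi> w)" by (rule half) (use that S \<delta> in auto)
      then show ?thesis by auto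
    qed
    have holF: "F holomorphic_on S"
      unfolding F_def H_def using \<Phi>nz \<rho>1
      by (intro holomorphic_intros holomorphic_on_subset[OF hol\<Phi> SV]) auto
    show "norm (F (of_real s)) \<le> B"
    proof (rule maximum_modulus_frontier[of F S])
      show "F holomorphic_on interior S" by (rule holomorphic_on_subset[OF holF interior_subset])
      show "continuous_on (closure S) F"
        using holomorphic_on_imp_continuous_on[OF holF] by (simp add: S_def)
      show "bounded S" by (simp add: S_def)
      show "of_real s \<in> S" using s \<delta> by (simp add: S)
      fix w assume "w \<in> frontier S"
      then have wS: "w \<in> S" and nb: "\<not> (\<delta> < Re w \<and> Re w < \<rho>1 \<and> - \<rho>1 < Im w \<and> Im w < \<rho>1)"
        unfolding S_def frontier_cbox by (auto simp: in_box_complex_iff)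
      have w: "\<delta> \<le> Re w" "Re w \<le> \<rho>1" "\<bar>Im w\<bar> \<le> \<rho>1" using wS S by auto
      define a where "a = Re w / \<rho>1"
      have a: "0 \<le> a" "a \<le> 1" using w \<delta> \<rho>1 by (auto simp: a_def)
      have a2: "2 * a - a\<^sup>2 \<ge> 0" using a mult_left_mono[of a 2 a] by (simp add: power2_eq_square)
      show "norm (F w) \<le> B"
      proof (cases "Re w = \<delta>")
        case True
        have "1 / B < norm (\<Phi> w)" by (rule \<epsilon>'(2)) (use True \<delta> w \<rho>1 in auto)
        moreover have "Re (H w) \<ge> 0" unfolding ReH a_def[symmetric] using a2 by simp
        then have "exp (- (ln 2 * Re (H w))) \<le> 1" by simp
        ultimately have "exp (- (ln 2 * Re (H w))) / norm (\<Phi> w) \<le> 1 / (1 / B)"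
          using B by (intro frac_le) auto
        then show ?thesis unfolding nF using B by simp
      next
        case False
        then have "Re w = \<rho>1 \<or> \<bar>Im w\<bar> = \<rho>1" using nb w by auto
        then have "Re (H w) \<ge> 1"
        proof
          assume "Re w = \<rho>1"
          then show ?thesis unfolding ReH using \<rho>1 by simp
        next
          assume i: "\<bar>Im w\<bar> = \<rho>1"
          have "(Im w / \<rho>1)\<^sup>2 = \<bar>Im w\<bar>\<^sup>2 / \<rho>1\<^sup>2" by (simp add: power_divide)
          also have "\<dots> = 1" unfolding i using \<rho>1 by simp
          finally show ?thesis unfolding ReH a_def[symmetric] using a2 by simp
        qed
        then have "ln 2 * 1 \<le> ln 2 * Re (H w)" by (intro mult_left_mono) auto
        then have "exp (- (ln 2 * Re (H w))) \<le> exp (- ln 2)" by simp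
        also have "\<dots> = 1 / 2" by (simp add: exp_minus)
        finally have "exp (- (ln 2 * Re (H w))) \<le> 1 / 2" .
        moreover have "1 / 2 < norm (\<Phi> w)" by (rule half) (use w \<delta> in auto)
        ultimately have "exp (- (ln 2 * Re (H w))) / norm (\<Phi> w) \<le> (1 / 2) / (1 / 2)"
          by (intro frac_le) auto
        then show ?thesis unfolding nF using B by simp
      qed
    qed
  qed
  have low: "1 - (norm (\<Phi> (of_real s)))\<^sup>2 \<le> (4 * ln 2 / \<rho>1) * s" if s: "0 < s" "s < \<rho>1" for s
  proof -
    have "norm (\<Phi> (of_real s)) > 0" proof -
      have "1 / 2 < norm (\<Phi> (of_real s))" by (rule half) (use s in auto)
      then show ?thesis by linarith
    qed
    then have "exp (- (ln 2 * Re (H (of_real s)))) \<le> norm (\<Phi> (of_real s))"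
      using F1[OF s] unfolding nF by (simp add: divide_le_eq)
    moreover have "Re (H (of_real s)) \<le> 2 * (s / \<rho>1)" unfolding ReH by simp
    then have "ln 2 * Re (H (of_real s)) \<le> ln 2 * (2 * (s / \<rho>1))" by (intro mult_left_mono) auto
    then have "exp (- (ln 2 * (2 * (s / \<rho>1)))) \<le> exp (- (ln 2 * Re (H (of_real s))))" by simp
    ultimately have "exp (- (ln 2 * (2 * (s / \<rho>1)))) \<le> norm (\<Phi> (of_real s))" by linarith
    then have "(exp (- (ln 2 * (2 * (s / \<rho>1)))))\<^sup>2 \<le> (norm (\<Phi> (of_real s)))\<^sup>2" by (intro power_mono) auto
    moreover have "(exp (- (ln 2 * (2 * (s / \<rho>1)))))\<^sup>2 = exp (- ((4 * ln 2 / \<rho>1) * s))"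
      by (simp flip: exp_double)
    moreover have "1 + - ((4 * ln 2 / \<rho>1) * s) \<le> exp (- ((4 * ln 2 / \<rho>1) * s))" by (rule exp_ge_add_one_self)
    ultimately show ?thesis by linarith
  qed
  \<comment> \<open>The disc with diameter from 0 to \<open>\<rho>1\<close> lies in the rectangle
    and touches the edge at 0. The function f is \<Phi> on this disc, with the boundary point 1
    corresponding to 0.\<close>
  define R where "R = \<rho>1 / 2"
  have R: "R > 0" "2 * R = \<rho>1" using \<rho>1 by (auto simp: R_def)
  define f where "f = (\<lambda>z. \<Phi> (of_real R * (1 - z)))"
  have disc_V: "of_real R * (1 - z) \<in> V" if z: "norm z < 1" for z
  proof (rule inV)
    have rz: "\<bar>Re z\<bar> < 1" "\<bar>Im z\<bar> < 1" using abs_Re_le_cmod[of z] abs_Im_le_cmod[of z] z by auto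
    then show "0 < Re (of_real R * (1 - z))" using R by simp
    have "R * (1 - Re z) \<le> R * 2" using R rz by (intro mult_left_mono) auto
    then have "R * (1 - Re z) \<le> r" using R \<rho>1 by linarith
    then show "Re (of_real R * (1 - z)) \<le> r" by simp
    have "R * \<bar>Im z\<bar> \<le> R * 1" using R rz by (intro mult_left_mono) auto
    then have "R * \<bar>Im z\<bar> \<le> r" using R \<rho>1 by linarith
    then show "\<bar>Im (of_real R * (1 - z))\<bar> \<le> r" using R by (simp add: abs_mult)
  qed
  interpret f: disc_self_map f
  proof
    have "(\<Phi> \<circ> (\<lambda>z. of_real R * (1 - z))) holomorphic_on ball 0 1"
      by (rule holomorphic_on_compose_gen[OF _ hol\<Phi>]) (auto intro!: holomorphic_intros disc_V)
    then show "f holomorphic_on ball 0 1" by (simp add: f_def o_def)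
    show "norm (f z) < 1" if "norm z < 1" for z unfolding f_def by (intro \<Phi>1 disc_V that)
  qed
  define a where "a = (\<lambda>n::nat. complex_of_real (1 - 1 / (real n + 2)))"
  have na: "norm (a n) = 1 - 1 / (real n + 2)" for n unfolding a_def norm_of_real by simp
  have a1: "norm (a n) < 1" for n unfolding na by simp
  have al: "a \<longlonglongrightarrow> 1"
  proof -
    have "(\<lambda>n. 1 - 1 / (real n + 2)) \<longlonglongrightarrow> 1" by real_asymp
    from tendsto_of_real[OF this] show ?thesis unfolding a_def by (simp only: of_real_1)
  qed
  have aC: "1 - (norm (f (a n)))\<^sup>2 \<le> (4 * ln 2 / \<rho>1 * R) * (1 - (norm (a n))\<^sup>2)" for n
  proof -
    define e where "e = 1 / (real n + 2)"
    have e: "0 < e" "e \<le> 1" by (auto simp: e_def)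
    have Re: "of_real R * (1 - a n) = complex_of_real (R * e)" by (simp add: a_def e_def)
    have "R * e \<le> R * 1" using e R by (intro mult_left_mono) auto
    then have "R * e < \<rho>1" "R * e > 0" using e R by (linarith, simp)
    then have "1 - (norm (f (a n)))\<^sup>2 \<le> (4 * ln 2 / \<rho>1) * (R * e)"
      unfolding f_def Re by (intro low)
    also have "e * 1 \<le> e * (2 - e)" using e by (intro mult_left_mono) auto
    then have "e \<le> 1 - (norm (a n))\<^sup>2" unfolding na e_def[symmetric] by (simp add: power2_eq_square algebra_simps)
    then have "(4 * ln 2 / \<rho>1) * (R * e) \<le> (4 * ln 2 / \<rho>1) * (R * (1 - (norm (a n))\<^sup>2))"
      using R \<rho>1 by (intro mult_left_mono) auto
    finally show ?thesis by (simp add: mult.assoc)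
  qed
  obtain b \<kappa> where b: "norm b = 1" "\<kappa> > 0" "((\<lambda>u. deriv f (1 * (1 - u))) \<longlongrightarrow> b * of_real \<kappa> / 1) ang"
    by (rule f.julia_wolff_caratheodory[where y = 1 and a = a, OF norm_one a1 al aC])
  have b0: "b \<noteq> 0" using b by auto
  \<comment> \<open>The chain rule factor: f' is \<open>cc\<close> times
    \<open>deriv \<Psi>\<close>, and \<open>deriv \<Psi> = G \<circ> \<Psi>\<close>.\<close>
  define cc where "cc = - (of_real R * (\<i> * complex_of_real \<sigma>))"
  have cc: "cc \<noteq> 0" using R \<sigma> by (auto simp: cc_def)
  have "((\<lambda>u. deriv f (1 * (1 - u)) / cc) \<longlongrightarrow> (b * of_real \<kappa> / 1) / cc) ang"
    by (intro tendsto_intros b cc)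
  then have lim1: "((\<lambda>u. G (\<Psi> (A (of_real R * u)))) \<longlongrightarrow> b * of_real \<kappa> / cc) ang"
  proof (rule ang_cong[OF _ zero_less_one])
    fix u :: complex assume u: "u \<in> cap 1"
    define z where "z = 1 - u"
    have z: "norm z < 1" using u by (simp add: z_def cap_def dist_norm)
    have Wz: "A (of_real R * (1 - z)) \<in> W" using disc_V[OF z] by (simp add: V_def)
    have "((\<lambda>z. A (of_real R * (1 - z))) has_field_derivative cc) (at z)"
      unfolding A_def cc_def by (auto intro!: derivative_eq_intros)
    from DERIV_chain2[where f = \<Psi>, OF holomorphic_derivI[OF Psi_hol W_open Wz] this]
    have "deriv f z = deriv \<Psi> (A (of_real R * (1 - z))) * cc"
      unfolding f_def \<Phi>_def by (rule DERIV_imp_deriv)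
    then have "deriv f z / cc = G (\<Psi> (A (of_real R * (1 - z))))"
      using cc deriv_Psi[OF Wz] by simp
    then show "deriv f (1 * (1 - u)) / cc = G (\<Psi> (A (of_real R * u)))" by (simp add: z_def)
  qed simp
  \<comment> \<open>The position of \<open>of_real t0 + k u\<close> in the coordinate of the disc.
    It behaves like a constant times \<open>u powr \<beta>\<close>, and by \<open>sgn\<close> all
    its directions lie in the right half-plane, so nontangential approach of u passes to it.\<close>
  define w where "w = (\<lambda>u. - (\<i> * of_real \<sigma>) * k u / of_real R)"
  have Aw: "A (of_real R * w u) = of_real t0 + k u" for u
  proof -
    have ss: "of_real \<sigma> * of_real \<sigma> = (1::complex)" using \<sigma> by auto
    have "\<i> * of_real \<sigma> * (of_real R * w u) = - (\<i> * \<i>) * (of_real \<sigma> * of_real \<sigma>) * k u"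
    proof -
      have "\<i> * of_real \<sigma> * (of_real R * w u) = \<i> * of_real \<sigma> * (- (\<i> * of_real \<sigma>) * k u)"
        unfolding w_def using R by simp
      also have "\<dots> = - (\<i> * \<i>) * (of_real \<sigma> * of_real \<sigma>) * k u"
        by (simp only: mult_minus_left mult_minus_right ac_simps)
      finally show ?thesis .
    qed
    then show ?thesis unfolding A_def ss by simp
  qed
  have "filterlim w ang ang"
  proof (rule filterlim_ang_power[OF _ \<beta>])
    have "((\<lambda>u. - (\<i> * of_real \<sigma>) * (k u * u powr of_real (-\<beta>)) / of_real R) \<longlongrightarrow> - (\<i> * of_real \<sigma>) * C / of_real R) ang"
      using R by (intro tendsto_intros k_lim) auto
    then show "((\<lambda>u. w u * u powr of_real (- \<beta>)) \<longlongrightarrow> - (\<i> * of_real \<sigma>) * C / of_real R) ang"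
      by (simp add: w_def mult.assoc)
    show "0 < Re (- (\<i> * of_real \<sigma>) * C / of_real R * \<zeta> powr of_real \<beta>)" if "Re \<zeta> > 0" for \<zeta>
    proof -
      have "- (\<i> * of_real \<sigma>) * C / of_real R * \<zeta> powr of_real \<beta> = (- \<i> * (C * \<zeta> powr of_real \<beta>)) * of_real (\<sigma> / R)"
        using R by (simp add: field_simps)
      also have "Re ((- \<i> * Z) * of_real (\<sigma> / R)) = \<sigma> * Im Z / R" for Z by (simp add: mult.commute)
      finally show ?thesis using sgn[OF that] R by simp
    qed
  qed
  from filterlim_compose[OF lim1 this]
  have "((\<lambda>u. G (\<Psi> (of_real t0 + k u))) \<longlongrightarrow> b * of_real \<kappa> / cc) ang" unfolding Aw .
  then have "((\<lambda>u. G (\<phi> t0 (pt u))) \<longlongrightarrow> b * of_real \<kappa> / cc) ang"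
    by (rule ang_cong[OF _ \<rho>]) (use t0 phi_Psi in auto)
  then show ?thesis
    by (rule phi_regular_of_G_limit[OF G_reg less_imp_le[OF t0(1)]]) (use t0 b b0 cc in auto)
qed

text \<open>\<open>f \<theta>\<close> is the height of the image of the direction \<theta>, a
  sinusoid in \<open>\<beta> * \<theta>\<close> over an open interval of length
  \<open>\<beta> * pi\<close>. A zero inside the interval is a change of sign, and for negative
  \<alpha> the interval is longer than a half-period, so a change of sign is unavoidable.\<close>

lemma direction_dichotomy:
  "(\<forall>t>0. complex_of_real t \<in> W) \<or>
   (\<alpha> > 0 \<and> (\<exists>\<sigma>. (\<sigma> = 1 \<or> \<sigma> = (-1::real)) \<and> (\<forall>\<zeta>. Re \<zeta> > 0 \<longrightarrow> \<sigma> * Im (C * \<zeta> powr of_real \<beta>) > 0)))"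
proof (rule disjCI)
  assume neg: "\<not> (\<alpha> > 0 \<and> (\<exists>\<sigma>. (\<sigma> = 1 \<or> \<sigma> = (-1::real)) \<and> (\<forall>\<zeta>. Re \<zeta> > 0 \<longrightarrow> \<sigma> * Im (C * \<zeta> powr of_real \<beta>) > 0)))"
  have \<beta>: "0 < \<beta>" "\<beta> \<le> 2" using alpha by auto
  define opp where "opp \<longleftrightarrow> (\<exists>\<zeta>1 \<zeta>2. Re \<zeta>1 > 0 \<and> Re \<zeta>2 > 0 \<and> Im (C * \<zeta>1 powr of_real \<beta>) < 0 \<and> 0 < Im (C * \<zeta>2 powr of_real \<beta>))"
  define f where "f = (\<lambda>\<theta>. Im (C * exp (\<i> * of_real (\<beta> * \<theta>))))"
  have f: "Re (exp (\<i> * of_real \<theta>)) > 0 \<and> Im (C * exp (\<i> * of_real \<theta>) powr of_real \<beta>) = f \<theta>" if "\<bar>\<theta>\<bar> < pi / 2" for \<theta>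
  proof -
    have "- pi < \<theta>" "\<theta> \<le> pi" using that pi_gt_zero by linarith+
    then have "Ln (exp (\<i> * of_real \<theta>)) = \<i> * of_real \<theta>" by (intro Ln_exp) auto
    then have "exp (\<i> * of_real \<theta>) powr of_real \<beta> = exp (\<i> * of_real (\<beta> * \<theta>))"
      by (simp add: powr_def mult_ac del: of_real_diff)
    then show ?thesis using that cos_gt_zero_pi[of \<theta>] by (simp add: f_def Re_exp)
  qed
  have oppI: "opp" if "\<bar>\<theta>1\<bar> < pi / 2" "\<bar>\<theta>2\<bar> < pi / 2" "f \<theta>1 < 0" "0 < f \<theta>2" for \<theta>1 \<theta>2
    unfolding opp_def using f[OF that(1)] f[OF that(2)] that(3,4) by metis
  have zero: opp if \<theta>: "\<bar>\<theta>\<bar> < pi / 2" "f \<theta> = 0" for \<theta>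
  proof -
    \<comment> \<open>As \<open>\<beta> \<le> 2\<close>, the bound \<open>pi / 4\<close> gives
      \<open>\<beta> * \<delta> < pi\<close>, hence a positive sine; the other entry keeps both
      shifted angles in the range.\<close>
    define \<delta> where "\<delta> = min ((pi / 2 - \<bar>\<theta>\<bar>) / 2) (pi / 4)"
    have \<delta>: "\<delta> > 0" "\<delta> \<le> pi / 4" "\<bar>\<theta>\<bar> + \<delta> < pi / 2"
    proof -
      have d: "\<delta> \<le> (pi / 2 - \<bar>\<theta>\<bar>) / 2" "\<delta> \<le> pi / 4" unfolding \<delta>_def by simp_all
      have "(pi / 2 - \<bar>\<theta>\<bar>) / 2 > 0" using \<theta>(1) by simp
      then show "\<delta> > 0" by (simp add: \<delta>_def)
      show "\<delta> \<le> pi / 4" by (rule d(2))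
      show "\<bar>\<theta>\<bar> + \<delta> < pi / 2" 
      proof -
        have "a + d < p" if "d \<le> (p - a) / 2" "a < p" for a d p :: real using that by (simp add: field_simps)
        from this[OF d(1) \<theta>(1)] show ?thesis .
      qed
    qed
    have "\<beta> * \<delta> \<le> 2 * (pi / 4)" using \<beta> \<delta> by (intro mult_mono) auto
    then have "\<beta> * \<delta> < pi" using pi_gt_zero by linarith
    then have sn: "sin (\<beta> * \<delta>) > 0" using \<beta> \<delta> by (intro sin_gt_zero) auto
    define Z where "Z = C * exp (\<i> * of_real (\<beta> * \<theta>))"
    have Z: "Im Z = 0" "Z \<noteq> 0" using \<theta> C by (auto simp: Z_def f_def)
    then have RZ: "Re Z \<noteq> 0" by (auto simp: complex_eq_iff)
    have shift: "f (\<theta> + d) = Re Z * sin (\<beta> * d)" for d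
    proof -
      have eq: "C * exp (\<i> * of_real (\<beta> * (\<theta> + d))) = Z * exp (\<i> * of_real (\<beta> * d))"
        unfolding Z_def by (simp add: distrib_left exp_add mult.assoc del: of_real_diff)
      show ?thesis unfolding f_def eq using Z by (simp add: Im_exp Re_exp)
    qed
    have th: "\<bar>\<theta> + \<delta>\<bar> < pi / 2" "\<bar>\<theta> + - \<delta>\<bar> < pi / 2" using \<delta> by linarith+
    have v: "f (\<theta> + \<delta>) = Re Z * sin (\<beta> * \<delta>)" "f (\<theta> + - \<delta>) = - (Re Z * sin (\<beta> * \<delta>))"
      using shift[of \<delta>] shift[of "- \<delta>"] by auto
    show opp
    proof (cases "Re Z > 0")
      case True
      then have "f (\<theta> + \<delta>) > 0" "f (\<theta> + - \<delta>) < 0" unfolding v using sn by auto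
      then show ?thesis using oppI th by blast
    next
      case False
      then have "Re Z < 0" using RZ by simp
      then have "f (\<theta> + \<delta>) < 0" "f (\<theta> + - \<delta>) > 0" unfolding v using sn by (auto simp: mult_neg_pos)
      then show ?thesis using oppI th by blast
    qed
  qed
  have opp
  proof (rule ccontr)
    assume no: "\<not> opp"
    show False
    proof (cases "\<alpha> > 0")
      case False
      then have "\<beta> > 1" using alpha by simp
      then have th: "\<bar>pi / (2 * \<beta>)\<bar> < pi / 2" "\<bar>- (pi / (2 * \<beta>))\<bar> < pi / 2" by (auto simp: field_simps mult_pos_neg)
      have "b * (pi / (2 * b)) = pi / 2" "b * - (pi / (2 * b)) = - (pi / 2)" if "b > 0" for b
        using that by simp_all
      note this[OF \<beta>(1)]
      \<comment> \<open>At these two angles the exponential is \<open>\<i>\<close> and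
        \<open>- \<i>\<close>.\<close>
      then have v: "f (pi / (2 * \<beta>)) = Re C" "f (- (pi / (2 * \<beta>))) = - Re C"
        unfolding f_def by (simp_all only: ) (simp_all add: Re_exp Im_exp)
      show False
      proof (cases "Re C = 0")
        case True
        then show False using zero[OF th(1)] v no by simp
      next
        case False
        then show False using oppI[OF th(1) th(2)] oppI[OF th(2) th(1)] v no by (cases "Re C > 0") auto
      qed
    next
      case True
      have nz: "Im (C * \<zeta> powr of_real \<beta>) \<noteq> 0" if "Re \<zeta> > 0" for \<zeta>
      proof
        assume z: "Im (C * \<zeta> powr of_real \<beta>) = 0"
        have z0: "\<zeta> \<noteq> 0" using that by auto
        define \<theta> where "\<theta> = Im (Ln \<zeta>)"
        have th: "\<bar>\<theta>\<bar> < pi / 2" unfolding \<theta>_def by (rule Re_Ln_pos_lt_imp[OF that])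
        have "Ln \<zeta> = of_real (ln (norm \<zeta>)) + \<i> * of_real \<theta>" using z0 by (simp add: complex_eq_iff \<theta>_def)
        then have "of_real \<beta> * Ln \<zeta> = of_real (\<beta> * ln (norm \<zeta>)) + \<i> * of_real (\<beta> * \<theta>)"
          by (simp only: of_real_mult distrib_left ac_simps)
        then have "\<zeta> powr of_real \<beta> = of_real (exp (\<beta> * ln (norm \<zeta>))) * exp (\<i> * of_real (\<beta> * \<theta>))"
          using z0 by (simp only: powr_def if_False exp_add exp_of_real)
        then have "C * \<zeta> powr of_real \<beta> = of_real (exp (\<beta> * ln (norm \<zeta>))) * (C * exp (\<i> * of_real (\<beta> * \<theta>)))"
          by (simp only: ac_simps)
        then have "Im (C * \<zeta> powr of_real \<beta>) = exp (\<beta> * ln (norm \<zeta>)) * f \<theta>"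
          unfolding f_def by (simp only: Im_complex_of_real Re_complex_of_real times_complex.sel)
        then show False using z zero[OF th] no by simp
      qed
      define \<sigma> where "\<sigma> = (if Im C > 0 then 1 else (-1::real))"
      have one: "Im (C * 1 powr of_real \<beta>) = Im C" by simp
      have "\<sigma> * Im (C * \<zeta> powr of_real \<beta>) > 0" if \<zeta>: "Re \<zeta> > 0" for \<zeta>
      proof (cases "Im C > 0")
        case True
        then have "\<not> Im (C * \<zeta> powr of_real \<beta>) < 0" using no \<zeta> one unfolding opp_def by (metis one_complex.sel(1) zero_less_one)
        then show ?thesis using nz[OF \<zeta>] True by (simp add: \<sigma>_def)
      next
        case False
        then have "Im C < 0" using nz[of 1] one by simp
        then have "\<not> 0 < Im (C * \<zeta> powr of_real \<beta>)" using no \<zeta> one unfolding opp_def by (metis one_complex.sel(1) zero_less_one)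
        then show ?thesis using nz[OF \<zeta>] False by (simp add: \<sigma>_def)
      qed
      then show False using neg True by (metis \<sigma>_def)
    qed
  qed
  then show "\<forall>t>0. complex_of_real t \<in> W" unfolding opp_def using positive_reals_in_W by blast
qed

text \<open>A time that is not regular lies outside W, so every earlier positive time is regular by
  \<open>phi_regular_before\<close>. Two such times would contradict each other.\<close>

lemma phi_regular_all_but_one: "\<exists>t0. \<forall>t>0. t \<noteq> t0 \<longrightarrow> phi_regular t"
proof (cases "\<forall>t>0. complex_of_real t \<in> W")
  case True
  then show ?thesis using interior_of_W(3) by (meson less_imp_le)
next
  case False
  then obtain \<sigma> where \<sigma>: "\<sigma> = 1 \<or> \<sigma> = (-1::real)" "\<And>\<zeta>. Re \<zeta> > 0 \<Longrightarrow> \<sigma> * Im (C * \<zeta> powr of_real \<beta>) > 0"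
    using direction_dichotomy by blast
  have one: "phi_regular t" if "0 < t" "t < t'" "\<not> phi_regular t'" for t t'
  proof (rule phi_regular_before[OF \<sigma> that(1,2)])
    show "of_real t' \<notin> W" using interior_of_W(3)[of t'] that by auto
  qed
  show ?thesis
  proof (cases "\<exists>t0>0. \<not> phi_regular t0")
    case True
    then obtain t0 where "t0 > 0" "\<not> phi_regular t0" by blast
    then show ?thesis using one by (intro exI[of _ t0]) (metis linorder_neqE_linordered_idom)
  qed auto
qed

lemma interior_value_if_alpha_negative:
  assumes "\<alpha> < 0" "t > 0"
  shows "\<exists>y. ((\<lambda>u. \<phi> t (pt u)) \<longlongrightarrow> y) ang \<and> norm y < 1"
  using direction_dichotomy assms interior_of_W(1,2)[of t] by auto

end

text \<open>Every equivalence passes through \<open>G_regular\<close>. The exceptional time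
  \<open>t0\<close> ranges over all reals, so a nonpositive value covers the case without exception;
  in (v) the boundary value h(x) appears as a finite c.\<close>

theorem theorem1p1:
  fixes \<phi> :: "real \<Rightarrow> complex \<Rightarrow> complex" and G h :: "complex \<Rightarrow> complex"
    and \<tau> x :: complex and \<alpha> :: real
  assumes alpha: "-1 \<le> \<alpha>" "\<alpha> < 1" "\<alpha> \<noteq> 0"
    and x: "norm x = 1"
    and sg: "semigroup_disc \<phi>" and noaut: "no_automorphism \<phi>"
    and gen: "is_generator \<phi> G"
    and dw: "dw_point \<phi> \<tau>"
    and kh: "koenigs \<phi> G \<tau> h"
  defines "P \<equiv> (\<lambda>t. \<exists>L. L \<noteq> 0 \<and> angular_limit (\<lambda>z. deriv (\<phi> t) z * wpow x \<alpha> z) x L)"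
  shows "(regular_singularity G \<alpha> x \<longleftrightarrow> (\<exists>t0. \<forall>t>0. t \<noteq> t0 \<longrightarrow> P t))
    \<and> (regular_singularity G \<alpha> x \<longleftrightarrow>
         ((\<alpha> < 0 \<longrightarrow> (\<exists>t>0. P t)) \<and>
          (\<alpha> > 0 \<longrightarrow> (\<exists>t1>0. \<exists>t2>0. t1 \<noteq> t2 \<and> P t1 \<and> P t2))))
    \<and> (regular_singularity G \<alpha> x \<longleftrightarrow>
         (\<exists>L. L \<noteq> 0 \<and> angular_limit (\<lambda>z. deriv h z * wpow x \<alpha> z) x L))
    \<and> (regular_singularity G \<alpha> x \<longleftrightarrow>
         (\<exists>c L. angular_limit h x c \<and> L \<noteq> 0 \<and>
            angular_limit (\<lambda>z. (h z - c) * wpow x (\<alpha> - 1) z) x L))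
    \<and> (regular_singularity G \<alpha> x \<longrightarrow>
         \<not> sg_boundary_fixed_point \<phi> x \<and>
         (-1 < \<alpha> \<and> \<alpha> < 0 \<longrightarrow> (\<forall>t>0. \<not> contact_point (\<phi> t) x)))"
proof -
  interpret boundary_regularity \<phi> G h \<tau> x \<alpha>
    by unfold_locales (use assms in auto)
  note ang = angular_limit_iff[OF x] wpow_at[OF x]
  have P: "P t \<longleftrightarrow> phi_regular t" for t
    unfolding P_def phi_regular_def ang by simp
  have rs: "regular_singularity G \<alpha> x \<longleftrightarrow> G_regular" by (rule regular_singularity_iff)
  have all_but_one: "\<exists>t0. \<forall>t>0. t \<noteq> t0 \<longrightarrow> phi_regular t" if reg: G_regular
  proof -
    obtain W \<Psi> k \<rho> C where "semiflow_model \<phi> G h \<tau> x \<alpha> W \<Psi> k \<rho> C" by (rule semiflow_model_exists[OF reg])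
    then show ?thesis by (rule semiflow_model.phi_regular_all_but_one)
  qed
  have interior: "\<exists>y. ((\<lambda>u. \<phi> t (pt u)) \<longlongrightarrow> y) ang \<and> norm y < 1" if reg: G_regular "\<alpha> < 0" "t > 0" for t
  proof -
    obtain W \<Psi> k \<rho> C where "semiflow_model \<phi> G h \<tau> x \<alpha> W \<Psi> k \<rho> C" by (rule semiflow_model_exists[OF reg(1)])
    then show ?thesis using reg(2,3) by (rule semiflow_model.interior_value_if_alpha_negative)
  qed
  have two: "\<exists>t1>0. \<exists>t2>0. t1 \<noteq> t2 \<and> phi_regular t1 \<and> phi_regular t2" if ex: "\<exists>t0. \<forall>t>0. t \<noteq> t0 \<longrightarrow> phi_regular t"
  proof -
    obtain t0 where t0: "\<And>t. t > 0 \<Longrightarrow> t \<noteq> t0 \<Longrightarrow> phi_regular t" using ex by blast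
    define s where "s = \<bar>t0\<bar> + 1"
    have "s > 0" "s \<noteq> t0" "s + 1 > 0" "s + 1 \<noteq> t0" "s \<noteq> s + 1" unfolding s_def by linarith+
    then show ?thesis using t0 by blast
  qed
  have back_neg: G_regular if neg: "\<alpha> < 0" "t > 0" "phi_regular t" for t
  proof -
    obtain y E M where y: "E \<noteq> 0" "M \<noteq> 0" "((\<lambda>u. deriv (\<phi> t) (pt u) * u powr of_real \<alpha>) \<longlongrightarrow> E) ang"
      "((\<lambda>u. \<phi> t (pt u)) \<longlongrightarrow> y) ang" "((\<lambda>u. (\<phi> t (pt u) - y) * u powr of_real (\<alpha> - 1)) \<longlongrightarrow> M) ang" "norm y \<le> 1"
      by (rule phi_limit[of t]) (use neg in auto)
    have "norm y \<noteq> 1" using interior_value_if_negative[OF _ neg(1) y(4,5)] neg(2) by simp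
    then show ?thesis using G_regular_of_interior_value[OF _ neg(3) y(4)] y(6) neg(2) by simp
  qed
  have back_pos: G_regular if "\<alpha> > 0" "t1 > 0" "t2 > 0" "t1 \<noteq> t2" "phi_regular t1" "phi_regular t2" for t1 t2
    using G_regular_of_two_times[OF that(1), of t1 t2] G_regular_of_two_times[OF that(1), of t2 t1] that
    by (cases "t1 < t2") auto
  have iii: "G_regular \<longleftrightarrow> ((\<alpha> < 0 \<longrightarrow> (\<exists>t>0. phi_regular t)) \<and>
      (\<alpha> > 0 \<longrightarrow> (\<exists>t1>0. \<exists>t2>0. t1 \<noteq> t2 \<and> phi_regular t1 \<and> phi_regular t2)))"
    using all_but_one two back_neg back_pos alpha(3) by (metis linorder_neqE_linordered_idom)
  have ii: "G_regular \<longleftrightarrow> (\<exists>t0. \<forall>t>0. t \<noteq> t0 \<longrightarrow> phi_regular t)"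
    using all_but_one two iii by blast
  have fixed: "\<not> sg_boundary_fixed_point \<phi> x" if reg: G_regular
  proof
    assume fp: "sg_boundary_fixed_point \<phi> x"
    then have fx: "((\<lambda>u. \<phi> t (pt u)) \<longlongrightarrow> x) ang" if "t > 0" for t
      using that unfolding sg_boundary_fixed_point_def boundary_fixed_point_def ang by blast
    show False
    proof (cases "\<alpha> < 0")
      case True
      from interior[OF reg True zero_less_one] obtain y where "((\<lambda>u. \<phi> 1 (pt u)) \<longlongrightarrow> y) ang" "norm y < 1" by blast
      then show False using tendsto_unique[OF ang_neq_bot _ fx[OF zero_less_one]] x by force
    next
      case False
      then have "\<alpha> > 0" using alpha by simp
      obtain t where t: "t > 0" "phi_regular t" using two[OF all_but_one[OF reg]] by blast
      have "\<not> ((\<lambda>u. \<phi> t (pt u)) \<longlongrightarrow> x) ang"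
        by (rule not_fixed_if_positive[OF \<open>\<alpha> > 0\<close> less_imp_le[OF t(1)] t(2) reg])
      then show False using fx[OF t(1)] by blast
    qed
  qed
  have contact: "\<not> contact_point (\<phi> t) x" if reg: G_regular and "\<alpha> < 0" "t > 0" for t
  proof
    assume "contact_point (\<phi> t) x"
    then obtain L where L: "((\<lambda>u. \<phi> t (pt u)) \<longlongrightarrow> L) ang" "norm L = 1"
      unfolding contact_point_def ang by blast
    from interior[OF that] obtain y where "((\<lambda>u. \<phi> t (pt u)) \<longlongrightarrow> y) ang" "norm y < 1" by blast
    then show False using tendsto_unique[OF ang_neq_bot _ L(1)] L(2) by force
  qed
  show ?thesis
    unfolding P rs using ii iii h_regular_iff h_values_iff fixed contact unfolding ang by blast
qed

end
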